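(* Let $d\in\mathbb{N}$, let $\Omega\subseteq\mathbb{R}^d$ be measurable, and let $T=(e^{-tH})_{t\ge 0}$ be a selfadjoint positivity preserving $C_0$-semigroup on $L_2(\Omega)$, with generator $-H$, that is dominated by the free heat semigroup. Then for all $t>0$ the operator $e^{-tH}$ has an integral kernel $p_t$. If $E_0:=\inf\sigma(H)>0$, then $$0\le p_t(x,y)\le\Bigl(\frac{eE_0}{2\pi d}\Bigr)^{d/2}\exp\Bigl(-E_0t-\frac{|x-y|^2}{4t}\Bigr)\qquad\Bigl(t\ge\frac{d}{2E_0},\ x,y\in\mathbb{R}^d\Bigr).$$
   Context: Functions on $\Omega$ are extended by $0$ to $\mathbb{R}^d$, so $L_2(\Omega)\subseteq L_2(\mathbb{R}^d)$. The semigroup $T$ being dominated by the free heat semigroup means $0\le T(t)f\le e^{t\Delta}f$ for all $t\ge0$ and all $0\le f\in L_2(\Omega)$, where $(e^{t\Delta})_{t\ge0}$ is the heat semigroup on $L_2(\mathbb{R}^d)$, with convolution kernel $k_t(x)=(4\pi t)^{-d/2}\exp(-|x|^2/(4t))$. An integral kernel of $e^{-tH}$ is a measurable function $p_t$ on $\Omega\times\Omega$ such that $(e^{-tH}f)(x)=\int_\Omega p_t(x,y)f(y)\,dy$ for a.e. $x\in\Omega$ and all $f\in L_2(\Omega)$; it is extended by $0$ to $\mathbb{R}^d\times\mathbb{R}^d$. It is determined up to null sets of $\mathbb{R}^d\times\mathbb{R}^d$, and the pointwise inequalities are understood for almost every $(x,y)$ (equivalently, for all $(x,y)$ for a suitable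 version of $p_t$). *)

theory Defs
  imports "HOL-Analysis.Analysis"
begin

text \<open>
  The Hilbert space $L_2(\Omega)$ is handled through representatives: an element is a complex-valued,
  Lebesgue measurable, square-integrable function on the whole space that vanishes off \<open>\<Omega>\<close>
  (extension by 0), and equality in $L_2$ is equality almost everywhere (\<open>L2_eq\<close>). An operator on
  $L_2(\Omega)$ acts on representatives. Inequalities between complex numbers are those of
  \<open>HOL-Library.Complex_Order\<close>, so \<open>0 \<le> z\<close> says that \<open>z\<close> is real and nonnegative.
\<close>

definition L2 :: "'a::euclidean_space set \<Rightarrow> ('a \<Rightarrow> complex) set" where
  "L2 \<Omega> = {f. f \<in> borel_measurable lebesgue \<and> integrable lebesgue (\<lambda>x. (cmod (f x))\<^sup>2)
              \<and> (\<forall>x. x \<notin> \<Omega> \<longrightarrow> f x = 0)}"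

definition L2_eq :: "('a::euclidean_space \<Rightarrow> complex) \<Rightarrow> ('a \<Rightarrow> complex) \<Rightarrow> bool" where
  "L2_eq f g \<longleftrightarrow> (AE x in lebesgue. f x = g x)"

definition L2_inner :: "('a::euclidean_space \<Rightarrow> complex) \<Rightarrow> ('a \<Rightarrow> complex) \<Rightarrow> complex" where
  "L2_inner f g = (LINT x|lebesgue. f x * cnj (g x))"

definition L2_norm :: "('a::euclidean_space \<Rightarrow> complex) \<Rightarrow> real" where
  "L2_norm f = sqrt (LINT x|lebesgue. (cmod (f x))\<^sup>2)"

text \<open>Linearity and the norm bound together make such a map respect \<open>L2_eq\<close>.\<close>

definition bounded_operator ::
  "'a::euclidean_space set \<Rightarrow> (('a \<Rightarrow> complex) \<Rightarrow> ('a \<Rightarrow> complex)) \<Rightarrow> bool" where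
  "bounded_operator \<Omega> S \<longleftrightarrow>
     (\<forall>f\<in>L2 \<Omega>. S f \<in> L2 \<Omega>) \<and>
     (\<forall>f\<in>L2 \<Omega>. \<forall>g\<in>L2 \<Omega>. L2_eq (S (\<lambda>x. f x + g x)) (\<lambda>x. S f x + S g x)) \<and>
     (\<forall>c. \<forall>f\<in>L2 \<Omega>. L2_eq (S (\<lambda>x. c * f x)) (\<lambda>x. c * S f x)) \<and>
     (\<exists>C. \<forall>f\<in>L2 \<Omega>. L2_norm (S f) \<le> C * L2_norm f)"

definition C0_semigroup ::
  "'a::euclidean_space set \<Rightarrow> (real \<Rightarrow> ('a \<Rightarrow> complex) \<Rightarrow> ('a \<Rightarrow> complex)) \<Rightarrow> bool" where
  "C0_semigroup \<Omega> T \<longleftrightarrow>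
     (\<forall>t\<ge>0. bounded_operator \<Omega> (T t)) \<and>
     (\<forall>f\<in>L2 \<Omega>. L2_eq (T 0 f) f) \<and>
     (\<forall>s\<ge>0. \<forall>t\<ge>0. \<forall>f\<in>L2 \<Omega>. L2_eq (T (s + t) f) (T s (T t f))) \<and>
     (\<forall>f\<in>L2 \<Omega>. ((\<lambda>t. L2_norm (\<lambda>x. T t f x - f x)) \<longlongrightarrow> 0) (at_right 0))"

definition selfadjoint_semigroup ::
  "'a::euclidean_space set \<Rightarrow> (real \<Rightarrow> ('a \<Rightarrow> complex) \<Rightarrow> ('a \<Rightarrow> complex)) \<Rightarrow> bool" where
  "selfadjoint_semigroup \<Omega> T \<longleftrightarrow>
     (\<forall>t\<ge>0. \<forall>f\<in>L2 \<Omega>. \<forall>g\<in>L2 \<Omega>. L2_inner (T t f) g = L2_inner f (T t g))"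

definition L2_le :: "('a::euclidean_space \<Rightarrow> complex) \<Rightarrow> ('a \<Rightarrow> complex) \<Rightarrow> bool" where
  "L2_le f g \<longleftrightarrow> (AE x in lebesgue. f x \<le> g x)"

definition positivity_preserving ::
  "'a::euclidean_space set \<Rightarrow> (real \<Rightarrow> ('a \<Rightarrow> complex) \<Rightarrow> ('a \<Rightarrow> complex)) \<Rightarrow> bool" where
  "positivity_preserving \<Omega> T \<longleftrightarrow>
     (\<forall>t\<ge>0. \<forall>f\<in>L2 \<Omega>. L2_le (\<lambda>x. 0) f \<longrightarrow> L2_le (\<lambda>x. 0) (T t f))"

definition heat_kernel :: "real \<Rightarrow> 'a::euclidean_space \<Rightarrow> real" where
  "heat_kernel t x =
     (4 * pi * t) powr (- (real DIM('a) / 2)) * exp (- ((norm x)\<^sup>2 / (4 * t)))"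

definition heat_semigroup ::
  "real \<Rightarrow> ('a::euclidean_space \<Rightarrow> complex) \<Rightarrow> ('a \<Rightarrow> complex)" where
  "heat_semigroup t f =
     (if t = 0 then f else (\<lambda>x. LINT y|lebesgue. complex_of_real (heat_kernel t (x - y)) * f y))"

definition dominated_by_heat_semigroup ::
  "'a::euclidean_space set \<Rightarrow> (real \<Rightarrow> ('a \<Rightarrow> complex) \<Rightarrow> ('a \<Rightarrow> complex)) \<Rightarrow> bool" where
  "dominated_by_heat_semigroup \<Omega> T \<longleftrightarrow>
     (\<forall>t\<ge>0. \<forall>f\<in>L2 \<Omega>. L2_le (\<lambda>x. 0) f \<longrightarrow>
        L2_le (\<lambda>x. 0) (T t f) \<and> L2_le (T t f) (heat_semigroup t f))"

text \<open>
  An unbounded operator is given by its graph, a set of pairs of representatives.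
  The generator is the strong right derivative of the semigroup at 0.
\<close>

definition generator ::
  "'a::euclidean_space set \<Rightarrow> (real \<Rightarrow> ('a \<Rightarrow> complex) \<Rightarrow> ('a \<Rightarrow> complex))
     \<Rightarrow> (('a \<Rightarrow> complex) \<times> ('a \<Rightarrow> complex)) set" where
  "generator \<Omega> T = {(f, g). f \<in> L2 \<Omega> \<and> g \<in> L2 \<Omega> \<and>
     ((\<lambda>t. L2_norm (\<lambda>x. (T t f x - f x) / complex_of_real t - g x)) \<longlongrightarrow> 0) (at_right 0)}"

definition neg_operator ::
  "(('a \<Rightarrow> complex) \<times> ('a \<Rightarrow> complex)) set \<Rightarrow> (('a \<Rightarrow> complex) \<times> ('a \<Rightarrow> complex)) set" where
  "neg_operator A = {(f, \<lambda>x. - g x) | f g. (f, g) \<in> A}"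

text \<open>
  \<open>z\<close> lies in the resolvent set if \<open>z - A\<close>, from the domain of \<open>A\<close> to $L_2(\Omega)$, is
  injective and surjective and has a bounded inverse.
\<close>

definition resolvent_set ::
  "'a::euclidean_space set \<Rightarrow> (('a \<Rightarrow> complex) \<times> ('a \<Rightarrow> complex)) set \<Rightarrow> complex set" where
  "resolvent_set \<Omega> A = {z.
     (\<forall>(f, g)\<in>A. L2_eq (\<lambda>x. z * f x - g x) (\<lambda>x. 0) \<longrightarrow> L2_eq f (\<lambda>x. 0)) \<and>
     (\<forall>h\<in>L2 \<Omega>. \<exists>(f, g)\<in>A. L2_eq (\<lambda>x. z * f x - g x) h) \<and>
     (\<exists>C. \<forall>(f, g)\<in>A. L2_norm f \<le> C * L2_norm (\<lambda>x. z * f x - g x))}"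

definition spectrum ::
  "'a::euclidean_space set \<Rightarrow> (('a \<Rightarrow> complex) \<times> ('a \<Rightarrow> complex)) set \<Rightarrow> complex set" where
  "spectrum \<Omega> A = - resolvent_set \<Omega> A"

text \<open>
  The integrability clause is needed because the Bochner integral of a non-integrable function
  is 0 by convention.
\<close>

definition is_integral_kernel ::
  "'a::euclidean_space set \<Rightarrow> (('a \<Rightarrow> complex) \<Rightarrow> ('a \<Rightarrow> complex)) \<Rightarrow> ('a \<times> 'a \<Rightarrow> complex) \<Rightarrow> bool"
  where
  "is_integral_kernel \<Omega> S p \<longleftrightarrow>
     p \<in> borel_measurable lebesgue \<and>
     (\<forall>x y. (x, y) \<notin> \<Omega> \<times> \<Omega> \<longrightarrow> p (x, y) = 0) \<and>
     (\<forall>f\<in>L2 \<Omega>. AE x\<in>\<Omega> in lebesgue.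
        set_integrable lebesgue \<Omega> (\<lambda>y. p (x, y) * f y) \<and>
        S f x = (LINT y:\<Omega>|lebesgue. p (x, y) * f y))"

end

theory Submission
  imports Defs "HOL-Probability.Distributions"
begin

text \<open>
  The domination gives \<open>T t\<close> a kernel $p_t \le k_t$. Let \<open>\<phi>\<close> be \<open>\<xi> \<bullet> x\<close> truncated to $[-R, R]$. Since
  \<open>T t\<close> is selfadjoint, the quadratic form of $W(t) = e^{\phi} T(t) e^{-\phi}$ is the one with kernel
  $p_t(x,y) \cosh(\phi(x) - \phi(y))$, and as $\cosh - 1 \ge 0$ it exceeds the form of \<open>T t\<close> by at most the
  mass of $k_t(z) (\cosh(\xi \cdot z) - 1)$, which is $e^{t|\xi|^2} - 1$. With $\|T(t)\| \le e^{-E_0 t}$ this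
  makes \<open>W\<close> a semigroup whose generator has numerical range bounded by $|\xi|^2 - E_0$, so
  $\|W(t)\| \le e^{(|\xi|^2 - E_0) t}$, uniformly in \<open>R\<close>. Writing $T(t) = T(s) T(t - 2s) T(s)$ with
  $2s = d / (2 E_0)$, using this bound for the middle factor and the free Gaussian bounds for the outer
  ones, and choosing $\xi = (x - y) / (2t)$ gives the estimate.
\<close>


section \<open>Completeness of $L_2$ and densities of bimeasures\<close>

lemma L2_complete:
  fixes f :: "nat \<Rightarrow> 'a \<Rightarrow> 'b::{banach, second_countable_topology}"
  assumes [measurable]: "\<And>n. f n \<in> borel_measurable M"
    and cauchy: "\<And>e. e > 0 \<Longrightarrow> \<exists>N. \<forall>m\<ge>N. \<forall>n\<ge>N. (\<integral>\<^sup>+x. ennreal ((norm (f m x - f n x))\<^sup>2) \<partial>M) \<le> ennreal e"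
  obtains g where "g \<in> borel_measurable M"
    and "\<And>e. e > 0 \<Longrightarrow> \<exists>N. \<forall>n\<ge>N. (\<integral>\<^sup>+x. ennreal ((norm (f n x - g x))\<^sup>2) \<partial>M) \<le> ennreal e"
proof -
  have "\<forall>k::nat. \<exists>N. \<forall>m\<ge>N. \<forall>n\<ge>N. (\<integral>\<^sup>+x. ennreal ((norm (f m x - f n x))\<^sup>2) \<partial>M) \<le> ennreal ((1/8)^k)"
    using cauchy by simp
  then obtain N where N: "\<And>k m n. N k \<le> m \<Longrightarrow> N k \<le> n \<Longrightarrow>
      (\<integral>\<^sup>+x. ennreal ((norm (f m x - f n x))\<^sup>2) \<partial>M) \<le> ennreal ((1/8)^k)"
    by metis
  define r where "r k = (\<Sum>i\<le>k. N i) + k" for k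
  have r_ge: "N k \<le> r k" "k \<le> r k" "r k \<le> r (Suc k)" for k
    using member_le_sum[of k "{..k}" N] by (auto simp: r_def)
  define d where "d k x = norm (f (r (Suc k)) x - f (r k) x)" for k x
  have [measurable]: "d k \<in> borel_measurable M" for k
    unfolding d_def by measurable
  have d: "(\<integral>\<^sup>+x. ennreal ((d k x)\<^sup>2) \<partial>M) \<le> ennreal ((1/8)^k)" for k
    unfolding d_def using N[of k] r_ge[of k] by (meson order_trans)
  have "(\<integral>\<^sup>+x. (\<Sum>k. ennreal (4^k * (d k x)\<^sup>2)) \<partial>M) = (\<Sum>k. \<integral>\<^sup>+x. ennreal (4^k * (d k x)\<^sup>2) \<partial>M)"
    by (rule nn_integral_suminf) measurable
  also have "\<dots> \<le> (\<Sum>k. ennreal ((1/2)^k))"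
  proof (rule suminf_le)
    fix k
    have "(\<integral>\<^sup>+x. ennreal (4^k * (d k x)\<^sup>2) \<partial>M) = ennreal (4^k) * (\<integral>\<^sup>+x. ennreal ((d k x)\<^sup>2) \<partial>M)"
      by (subst nn_integral_cmult[symmetric]) (auto simp: ennreal_mult)
    also have "\<dots> \<le> ennreal (4^k) * ennreal ((1/8)^k)"
      by (intro mult_left_mono d) auto
    also have "\<dots> = ennreal ((1/2)^k)"
      by (simp add: ennreal_mult[symmetric] power_mult_distrib[symmetric])
    finally show "(\<integral>\<^sup>+x. ennreal (4^k * (d k x)\<^sup>2) \<partial>M) \<le> ennreal ((1/2)^k)" .
  qed auto
  also have "\<dots> = ennreal (\<Sum>k. (1/2)^k)"
    by (rule suminf_ennreal2) auto
  finally have "(\<integral>\<^sup>+x. (\<Sum>k. ennreal (4^k * (d k x)\<^sup>2)) \<partial>M) \<noteq> \<infinity>"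
    by (auto simp: top_unique)
  then have fin: "AE x in M. (\<Sum>k. ennreal (4^k * (d k x)\<^sup>2)) \<noteq> \<infinity>"
    by (intro nn_integral_noteq_infinite) auto
  define g where "g x = lim (\<lambda>k. f (r k) x)" for x
  have g_meas[measurable]: "g \<in> borel_measurable M"
    unfolding g_def by measurable
  have conv: "AE x in M. (\<lambda>k. f (r k) x) \<longlonglongrightarrow> g x"
    using fin
  proof eventually_elim
    case (elim x)
    then have "summable (\<lambda>k. 4^k * (d k x)\<^sup>2)"
      by (intro summable_suminf_not_top) auto
    then have "(\<lambda>k. 4^k * (d k x)\<^sup>2) \<longlonglongrightarrow> 0"
      by (rule summable_LIMSEQ_zero)
    then have "Bseq (\<lambda>k. 4^k * (d k x)\<^sup>2)"
      by (intro convergent_imp_Bseq convergentI)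
    then obtain C where C: "C > 0" "\<And>k. norm (4^k * (d k x)\<^sup>2) \<le> C"
      unfolding Bseq_def by auto
    have dk: "d k x \<le> sqrt C * (1/2)^k" for k
    proof (rule power2_le_imp_le)
      have "4^k * (d k x)\<^sup>2 \<le> C"
        using C(2)[of k] by simp
      then show "(d k x)\<^sup>2 \<le> (sqrt C * (1/2)^k)\<^sup>2"
        using C(1) by (simp add: power_mult_distrib power_divide field_simps power2_eq_square[of "2^k"]
            flip: power_mult_distrib)
    qed (use C in simp)
    have "summable (\<lambda>k. f (r (Suc k)) x - f (r k) x)"
      by (rule summable_comparison_test[where g = "\<lambda>k. sqrt C * (1/2)^k"])
        (use dk in \<open>auto simp: d_def intro!: summable_mult\<close>)
    then have "convergent (\<lambda>n. \<Sum>k<n. f (r (Suc k)) x - f (r k) x)"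
      by (simp add: summable_iff_convergent)
    then have "convergent (\<lambda>n. f (r n) x - f (r 0) x)"
      using sum_lessThan_telescope[of "\<lambda>n. f (r n) x"] by simp
    then have "convergent (\<lambda>n. f (r n) x)"
      by (simp add: convergent_diff_const_right_iff)
    then show ?case
      by (simp add: g_def convergent_LIMSEQ_iff)
  qed
  show ?thesis
  proof
    fix e :: real assume "e > 0"
    then obtain N where N: "\<And>m n. N \<le> m \<Longrightarrow> N \<le> n \<Longrightarrow>
      (\<integral>\<^sup>+x. ennreal ((norm (f m x - f n x))\<^sup>2) \<partial>M) \<le> ennreal e"
      using cauchy by blast
    show "\<exists>N. \<forall>n\<ge>N. (\<integral>\<^sup>+x. ennreal ((norm (f n x - g x))\<^sup>2) \<partial>M) \<le> ennreal e"
    proof (intro exI allI impI)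
      fix n assume n: "N \<le> n"
      have "(\<integral>\<^sup>+x. ennreal ((norm (f n x - g x))\<^sup>2) \<partial>M)
          = (\<integral>\<^sup>+x. liminf (\<lambda>k. ennreal ((norm (f n x - f (r k) x))\<^sup>2)) \<partial>M)"
      proof (rule nn_integral_cong_AE)
        show "AE x in M. ennreal ((norm (f n x - g x))\<^sup>2) =
            liminf (\<lambda>k. ennreal ((norm (f n x - f (r k) x))\<^sup>2))"
          using conv
        proof eventually_elim
          case (elim x)
          then have "(\<lambda>k. ennreal ((norm (f n x - f (r k) x))\<^sup>2)) \<longlonglongrightarrow> ennreal ((norm (f n x - g x))\<^sup>2)"
            by (intro tendsto_ennrealI tendsto_intros)
          from lim_imp_Liminf[OF _ this] show ?case
            by simp
        qed
      qed
      also have "\<dots> \<le> liminf (\<lambda>k. \<integral>\<^sup>+x. ennreal ((norm (f n x - f (r k) x))\<^sup>2) \<partial>M)"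
        by (rule nn_integral_liminf) measurable
      also have "\<dots> \<le> limsup (\<lambda>k. \<integral>\<^sup>+x. ennreal ((norm (f n x - f (r k) x))\<^sup>2) \<partial>M)"
        by (rule Liminf_le_Limsup) simp
      also have "\<dots> \<le> ennreal e"
      proof (rule Limsup_bounded)
        show "\<forall>\<^sub>F k in sequentially. (\<integral>\<^sup>+x. ennreal ((norm (f n x - f (r k) x))\<^sup>2) \<partial>M) \<le> ennreal e"
          using eventually_ge_at_top[of N] by eventually_elim (use N n r_ge(2) in \<open>blast intro: order_trans\<close>)
      qed
      finally show "(\<integral>\<^sup>+x. ennreal ((norm (f n x - g x))\<^sup>2) \<partial>M) \<le> ennreal e" .
    qed
  qed (rule g_meas)
qed

locale bounded_bimeasure = finite_measure M for M :: "'a measure" +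
  fixes \<Phi> :: "'a set \<Rightarrow> 'a set \<Rightarrow> real" and c :: real
  assumes c_nonneg: "0 \<le> c"
    and nonneg: "A \<in> sets M \<Longrightarrow> B \<in> sets M \<Longrightarrow> 0 \<le> \<Phi> A B"
    and bound: "A \<in> sets M \<Longrightarrow> B \<in> sets M \<Longrightarrow> \<Phi> A B \<le> c * (measure M A * measure M B)"
    and add_left: "A \<in> sets M \<Longrightarrow> A' \<in> sets M \<Longrightarrow> B \<in> sets M \<Longrightarrow> A \<inter> A' = {} \<Longrightarrow>
      \<Phi> (A \<union> A') B = \<Phi> A B + \<Phi> A' B"
    and add_right: "A \<in> sets M \<Longrightarrow> B \<in> sets M \<Longrightarrow> B' \<in> sets M \<Longrightarrow> B \<inter> B' = {} \<Longrightarrow>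
      \<Phi> A (B \<union> B') = \<Phi> A B + \<Phi> A B'"
begin

lemma measure_rect: "A \<in> sets M \<Longrightarrow> B \<in> sets M \<Longrightarrow>
    measure (M \<Otimes>\<^sub>M M) (A \<times> B) = measure M A * measure M B"
  by (simp add: measure_def emeasure_pair_measure_Times enn2real_mult)

sublocale pair_sigma_finite M M ..

sublocale PP: finite_measure "M \<Otimes>\<^sub>M M"
  by (rule finite_measure_pair_measure) unfold_locales

lemma zero_if_null: "A \<in> sets M \<Longrightarrow> B \<in> sets M \<Longrightarrow> measure M A * measure M B = 0 \<Longrightarrow> \<Phi> A B = 0"
  using nonneg[of A B] bound[of A B] by (metis mult_zero_right order_antisym)

lemma sum_left:
  assumes "finite I" "\<And>i. i \<in> I \<Longrightarrow> A i \<in> sets M" "B \<in> sets M" "disjoint_family_on A I"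
  shows "\<Phi> (\<Union>i\<in>I. A i) B = (\<Sum>i\<in>I. \<Phi> (A i) B)"
  using assms
proof (induction I)
  case empty
  then show ?case using zero_if_null[of "{}" B] by simp
next
  case (insert i I)
  have "A i \<inter> (\<Union>i\<in>I. A i) = {}"
    using insert.prems(3) insert.hyps(2) by (auto simp: disjoint_family_on_def)
  moreover have "disjoint_family_on A I"
    using insert.prems(3) by (rule disjoint_family_on_mono[rotated]) auto
  ultimately show ?case
    using insert by (simp add: add_left sets.finite_UN)
qed

lemma sum_right:
  assumes "finite I" "\<And>i. i \<in> I \<Longrightarrow> A i \<in> sets M" "B \<in> sets M" "disjoint_family_on A I"
  shows "\<Phi> B (\<Union>i\<in>I. A i) = (\<Sum>i\<in>I. \<Phi> B (A i))"
  using assms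
proof (induction I)
  case empty
  then show ?case using zero_if_null[of B "{}"] by simp
next
  case (insert i I)
  have "A i \<inter> (\<Union>i\<in>I. A i) = {}"
    using insert.prems(3) insert.hyps(2) by (auto simp: disjoint_family_on_def)
  moreover have "disjoint_family_on A I"
    using insert.prems(3) by (rule disjoint_family_on_mono[rotated]) auto
  ultimately show ?case
    using insert by (simp add: add_right sets.finite_UN)
qed

definition finite_partition :: "('a \<Rightarrow> nat) \<Rightarrow> bool" where
  "finite_partition h \<longleftrightarrow> h \<in> M \<rightarrow>\<^sub>M count_space UNIV \<and> finite (range h)"

definition cell :: "('a \<Rightarrow> nat) \<Rightarrow> nat \<Rightarrow> 'a set" where
  "cell h v = h -` {v} \<inter> space M"

definition step :: "('a \<Rightarrow> nat) \<Rightarrow> 'a \<times> 'a \<Rightarrow> real" where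
  "step h z = \<Phi> (cell h (h (fst z))) (cell h (h (snd z))) /
     (measure M (cell h (h (fst z))) * measure M (cell h (h (snd z))))"

lemma cell_sets: "finite_partition h \<Longrightarrow> cell h v \<in> sets M"
  unfolding finite_partition_def cell_def by (auto intro: measurable_sets)

lemma step_measurable: "finite_partition h \<Longrightarrow> (\<lambda>z. G (h (fst z)) (h (snd z)) :: real) \<in> borel_measurable (M \<Otimes>\<^sub>M M)"
proof -
  assume "finite_partition h"
  then have [measurable]: "h \<in> M \<rightarrow>\<^sub>M count_space UNIV"
    by (simp add: finite_partition_def)
  show ?thesis by measurable
qed

lemma step_borel: "finite_partition h \<Longrightarrow> step h \<in> borel_measurable (M \<Otimes>\<^sub>M M)"
  unfolding step_def[abs_def]
  by (rule step_measurable[of h "\<lambda>v w. \<Phi> (cell h v) (cell h w) / (measure M (cell h v) * measure M (cell h w))"])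

lemma step_bounds:
  assumes "finite_partition h"
  shows "0 \<le> step h z" "step h z \<le> c"
proof -
  let ?A = "cell h (h (fst z))" and ?B = "cell h (h (snd z))"
  have s: "?A \<in> sets M" "?B \<in> sets M"
    using assms by (auto intro: cell_sets)
  show "0 \<le> step h z"
    unfolding step_def using nonneg[OF s] by simp
  show "step h z \<le> c"
  proof (cases "measure M ?A * measure M ?B = 0")
    case True
    then show ?thesis unfolding step_def True using c_nonneg by simp
  next
    case False
    then have "measure M ?A * measure M ?B > 0"
      by (simp add: less_le)
    then show ?thesis
      unfolding step_def using bound[OF s] by (simp add: divide_le_eq)
  qed
qed

lemma integrable_bounded:
  assumes "f \<in> borel_measurable (M \<Otimes>\<^sub>M M)" "\<And>z. \<bar>f z\<bar> \<le> (C::real)"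
  shows "integrable (M \<Otimes>\<^sub>M M) f"
  using assms by (intro PP.integrable_const_bound[where B = C]) auto

lemma integral_step_rect:
  assumes h: "finite_partition h"
  shows "(\<integral>z. step h z * (indicator (h -` V \<inter> space M) (fst z) * indicator (h -` W \<inter> space M) (snd z)) \<partial>(M \<Otimes>\<^sub>M M))
    = \<Phi> (h -` V \<inter> space M) (h -` W \<inter> space M)"
proof -
  let ?R = "range h"
  let ?m = "\<lambda>v. measure M (cell h v)"
  have fin: "finite (range h)" using h by (simp add: finite_partition_def)
  have cs: "cell h v \<in> sets M" for v using h by (rule cell_sets)
  have dj: "disjoint_family_on (cell h) I" for I
    by (auto simp: disjoint_family_on_def cell_def)
  have un: "h -` V \<inter> space M = (\<Union>v\<in>V \<inter> ?R. cell h v)" for V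
    by (auto simp: cell_def)
  have vw: "(\<integral>z. step h z * indicator (cell h v \<times> cell h w) z \<partial>(M \<Otimes>\<^sub>M M)) = \<Phi> (cell h v) (cell h w)" for v w
  proof -
    have "(\<integral>z. step h z * indicator (cell h v \<times> cell h w) z \<partial>(M \<Otimes>\<^sub>M M))
      = (\<integral>z. (\<Phi> (cell h v) (cell h w) / (?m v * ?m w)) * indicator (cell h v \<times> cell h w) z \<partial>(M \<Otimes>\<^sub>M M))"
      by (intro Bochner_Integration.integral_cong refl)
        (auto simp: step_def cell_def split: split_indicator)
    also have "\<dots> = \<Phi> (cell h v) (cell h w) / (?m v * ?m w) * measure (M \<Otimes>\<^sub>M M) (cell h v \<times> cell h w)"
      using cs by simp
    also have "measure (M \<Otimes>\<^sub>M M) (cell h v \<times> cell h w) = ?m v * ?m w"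
      by (intro measure_rect cs)
    also have "\<Phi> (cell h v) (cell h w) / (?m v * ?m w) * (?m v * ?m w) = \<Phi> (cell h v) (cell h w)"
      using zero_if_null[OF cs[of v] cs[of w]] by (cases "?m v * ?m w = 0") auto
    finally show ?thesis .
  qed
  have int: "integrable (M \<Otimes>\<^sub>M M) (\<lambda>z. step h z * indicator (cell h v \<times> cell h w) z)" for v w
    using step_bounds[OF h] step_borel[OF h] cs c_nonneg
    by (intro integrable_bounded[where C = c]) (auto split: split_indicator)
  have "(\<integral>z. step h z * (indicator (h -` V \<inter> space M) (fst z) * indicator (h -` W \<inter> space M) (snd z)) \<partial>(M \<Otimes>\<^sub>M M))
     = (\<integral>z. (\<Sum>v\<in>V \<inter> ?R. \<Sum>w\<in>W \<inter> ?R. step h z * indicator (cell h v \<times> cell h w) z) \<partial>(M \<Otimes>\<^sub>M M))"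
  proof (intro Bochner_Integration.integral_cong refl)
    fix z assume "z \<in> space (M \<Otimes>\<^sub>M M)"
    have i: "indicator (h -` V \<inter> space M) x = (\<Sum>v\<in>V \<inter> ?R. indicator (cell h v) x :: real)" for V x
      unfolding un using fin dj by (intro indicator_UN_disjoint[symmetric, THEN sym]) auto
    show "step h z * (indicator (h -` V \<inter> space M) (fst z) * indicator (h -` W \<inter> space M) (snd z)) =
      (\<Sum>v\<in>V \<inter> ?R. \<Sum>w\<in>W \<inter> ?R. step h z * indicator (cell h v \<times> cell h w) z)"
      by (simp only: i sum_product) (simp only: sum_distrib_left indicator_times)
  qed
  also have "\<dots> = (\<Sum>v\<in>V \<inter> ?R. \<Sum>w\<in>W \<inter> ?R. \<Phi> (cell h v) (cell h w))"
    using int by (simp add: vw)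
  also have "\<dots> = \<Phi> (h -` V \<inter> space M) (h -` W \<inter> space M)"
    unfolding un using fin cs dj by (subst sum.swap) (simp add: sum_left sum_right sets.finite_UN)
  finally show ?thesis .
qed

lemma integral_step_refined:
  assumes h': "finite_partition h'" and h: "finite_partition h" and pi: "\<And>x. h x = \<pi> (h' x)"
  shows "(\<integral>z. step h' z * G (h (fst z)) (h (snd z)) \<partial>(M \<Otimes>\<^sub>M M))
    = (\<Sum>v\<in>range h. \<Sum>w\<in>range h. G v w * \<Phi> (cell h v) (cell h w))"
proof -
  have fin: "finite (range h)" using h by (simp add: finite_partition_def)
  have c: "cell h v = h' -` (\<pi> -` {v}) \<inter> space M" for v
    by (auto simp: cell_def pi)
  have cs: "cell h v \<in> sets M" for v using h by (rule cell_sets)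
  have "(\<integral>z. step h' z * G (h (fst z)) (h (snd z)) \<partial>(M \<Otimes>\<^sub>M M))
    = (\<integral>z. (\<Sum>v\<in>range h. \<Sum>w\<in>range h. G v w * (step h' z * (indicator (cell h v) (fst z) * indicator (cell h w) (snd z)))) \<partial>(M \<Otimes>\<^sub>M M))"
  proof (intro Bochner_Integration.integral_cong refl)
    fix z assume "z \<in> space (M \<Otimes>\<^sub>M M)"
    then have z: "fst z \<in> space M" "snd z \<in> space M"
      by (auto simp: space_pair_measure)
    have "(\<Sum>v\<in>range h. \<Sum>w\<in>range h. G v w * (step h' z * (indicator (cell h v) (fst z) * indicator (cell h w) (snd z))))
      = (\<Sum>v\<in>range h. \<Sum>w\<in>range h. if w = h (snd z) then (if v = h (fst z) then G v w * step h' z else 0) else 0)"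
      using z by (intro sum.cong refl) (auto simp: cell_def)
    also have "\<dots> = (\<Sum>v\<in>range h. if v = h (fst z) then G v (h (snd z)) * step h' z else 0)"
      using fin by (simp add: sum.delta)
    also have "\<dots> = step h' z * G (h (fst z)) (h (snd z))"
      using fin by (simp add: sum.delta)
    finally show "step h' z * G (h (fst z)) (h (snd z)) = (\<Sum>v\<in>range h. \<Sum>w\<in>range h. G v w * (step h' z * (indicator (cell h v) (fst z) * indicator (cell h w) (snd z))))"
      by simp
  qed
  also have "\<dots> = (\<Sum>v\<in>range h. \<Sum>w\<in>range h. G v w *
      (\<integral>z. step h' z * (indicator (cell h v) (fst z) * indicator (cell h w) (snd z)) \<partial>(M \<Otimes>\<^sub>M M)))"
  proof -
    have "integrable (M \<Otimes>\<^sub>M M) (\<lambda>z. step h' z * (indicator (cell h v) (fst z) * indicator (cell h w) (snd z)))" for v w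
      using step_bounds[OF h'] step_borel[OF h'] cs c_nonneg
      by (intro integrable_bounded[where C = c]) (auto split: split_indicator)
    then show ?thesis
      by simp
  qed
  also have "\<dots> = (\<Sum>v\<in>range h. \<Sum>w\<in>range h. G v w * \<Phi> (cell h v) (cell h w))"
    unfolding c integral_step_rect[OF h'] ..
  finally show ?thesis .
qed

definition energy :: "('a \<Rightarrow> nat) \<Rightarrow> real" where
  "energy h = (\<integral>z. (step h z)\<^sup>2 \<partial>(M \<Otimes>\<^sub>M M))"

lemma energy_bounds:
  assumes "finite_partition h"
  shows "energy h \<le> c\<^sup>2 * measure (M \<Otimes>\<^sub>M M) (space (M \<Otimes>\<^sub>M M))"
proof -
  have "energy h \<le> (\<integral>z. c\<^sup>2 \<partial>(M \<Otimes>\<^sub>M M))"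
    unfolding energy_def using step_bounds[OF assms] step_borel[OF assms]
    by (intro integral_mono integrable_bounded[where C = "c\<^sup>2"]) (auto intro: power_mono)
  then show ?thesis by (simp add: mult.commute)
qed

lemma step_diff:
  assumes h': "finite_partition h'" and h: "finite_partition h" and pi: "\<And>x. h x = \<pi> (h' x)"
  shows "(\<integral>z. (step h' z - step h z)\<^sup>2 \<partial>(M \<Otimes>\<^sub>M M)) = energy h' - energy h"
proof -
  let ?G = "\<lambda>v w. \<Phi> (cell h v) (cell h w) / (measure M (cell h v) * measure M (cell h w))"
  have "(\<integral>z. step h' z * step h z \<partial>(M \<Otimes>\<^sub>M M)) = (\<integral>z. step h z * step h z \<partial>(M \<Otimes>\<^sub>M M))"
    using integral_step_refined[OF h' h pi, of ?G] integral_step_refined[OF h h, of id ?G]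
    unfolding step_def[of h] by simp
  moreover have "integrable (M \<Otimes>\<^sub>M M) (\<lambda>z. step k z * step l z)" if "finite_partition k" "finite_partition l" for k l
    using step_bounds[OF that(1)] step_borel[OF that(1)] step_bounds[OF that(2)] step_borel[OF that(2)] c_nonneg
    by (intro integrable_bounded[where C = "c * c"]) (auto simp: abs_mult intro!: mult_mono)
  ultimately show ?thesis
    using h h' by (simp add: energy_def power2_eq_square algebra_simps)
qed

text \<open>The density is the $L_2$-limit of step functions along partitions whose energies approach the
  supremum: refining a partition changes its step function orthogonally, so these form a Cauchy
  sequence.\<close>

lemma density_exists:
  obtains p where "p \<in> borel_measurable (M \<Otimes>\<^sub>M M)" "\<And>z. 0 \<le> p z" "\<And>z. p z \<le> c"
    "\<And>A B. A \<in> sets M \<Longrightarrow> B \<in> sets M \<Longrightarrow> \<Phi> A B = (\<integral>z. indicator (A \<times> B) z * p z \<partial>(M \<Otimes>\<^sub>M M))"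
proof -
  let ?P = "M \<Otimes>\<^sub>M M"
  define s where "s = Sup (energy ` Collect finite_partition)"
  have bdd: "bdd_above (energy ` Collect finite_partition)"
    using energy_bounds by (auto intro!: bdd_aboveI)
  have triv: "finite_partition (\<lambda>_. 0)"
    by (simp add: finite_partition_def)
  have le_s: "energy h \<le> s" if "finite_partition h" for h
    unfolding s_def using that bdd by (intro cSup_upper) auto
  have "\<exists>h. finite_partition h \<and> s - inverse (real (Suc n)) < energy h" for n
  proof -
    have "s - inverse (real (Suc n)) < Sup (energy ` Collect finite_partition)"
      by (simp add: s_def)
    then show ?thesis
      using triv bdd by (subst (asm) less_cSup_iff) auto
  qed
  then obtain g where g: "\<And>n. finite_partition (g n)" "\<And>n. s - inverse (real (Suc n)) < energy (g n)"
    by metis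
  define join :: "('a \<Rightarrow> nat) \<Rightarrow> ('a \<Rightarrow> nat) \<Rightarrow> 'a \<Rightarrow> nat" where "join h h' x = prod_encode (h x, h' x)" for h h' x
  have join: "finite_partition (join h h')" if "finite_partition h" "finite_partition h'" for h h'
  proof -
    have [measurable]: "h \<in> M \<rightarrow>\<^sub>M count_space UNIV" "h' \<in> M \<rightarrow>\<^sub>M count_space UNIV"
      and fin: "finite (range h)" "finite (range h')"
      using that by (auto simp: finite_partition_def)
    have "finite (range (join h h'))"
      by (rule finite_subset[of _ "prod_encode ` (range h \<times> range h')"])
        (use fin in \<open>auto simp: join_def\<close>)
    moreover have "join h h' \<in> M \<rightarrow>\<^sub>M count_space UNIV"
      unfolding join_def by measurable
    ultimately show ?thesis by (simp add: finite_partition_def)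
  qed
  have near: "(\<integral>z. (step (join (g n) h) z - step (g n) z)\<^sup>2 \<partial>?P) \<le> inverse (real (Suc n))"
    "(\<integral>z. (step (join h (g n)) z - step (g n) z)\<^sup>2 \<partial>?P) \<le> inverse (real (Suc n))" if h: "finite_partition h" for n h
  proof -
    have "(\<integral>z. (step (join (g n) h) z - step (g n) z)\<^sup>2 \<partial>?P) = energy (join (g n) h) - energy (g n)"
      using h g by (intro step_diff[where \<pi> = "\<lambda>v. fst (prod_decode v)"] join) (auto simp: join_def)
    then show "(\<integral>z. (step (join (g n) h) z - step (g n) z)\<^sup>2 \<partial>?P) \<le> inverse (real (Suc n))"
      using le_s[OF join[OF g(1)[of n] h]] g(2)[of n] by linarith
    have "(\<integral>z. (step (join h (g n)) z - step (g n) z)\<^sup>2 \<partial>?P) = energy (join h (g n)) - energy (g n)"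
      using h g by (intro step_diff[where \<pi> = "\<lambda>v. snd (prod_decode v)"] join) (auto simp: join_def)
    then show "(\<integral>z. (step (join h (g n)) z - step (g n) z)\<^sup>2 \<partial>?P) \<le> inverse (real (Suc n))"
      using le_s[OF join[OF h g(1)[of n]]] g(2)[of n] by linarith
  qed
  have sq_int: "integrable ?P (\<lambda>z. (a z - b z)\<^sup>2)" if "a \<in> borel_measurable ?P" "b \<in> borel_measurable ?P"
    "\<And>z. 0 \<le> a z \<and> a z \<le> c" "\<And>z. 0 \<le> b z \<and> b z \<le> c" for a b
  proof (rule integrable_bounded[where C = "c\<^sup>2"])
    fix z
    have "\<bar>a z - b z\<bar> \<le> c" using that(3,4)[of z] by auto
    then show "\<bar>(a z - b z)\<^sup>2\<bar> \<le> c\<^sup>2"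
      by (simp add: abs_le_square_iff[symmetric] c_nonneg)
  qed (use that in measurable)
  have sq_tri: "(\<integral>z. (a z - b z)\<^sup>2 \<partial>?P) \<le> 2 * (\<integral>z. (k z - a z)\<^sup>2 \<partial>?P) + 2 * (\<integral>z. (k z - b z)\<^sup>2 \<partial>?P)"
    if "a \<in> borel_measurable ?P" "b \<in> borel_measurable ?P" "k \<in> borel_measurable ?P"
    "\<And>z. 0 \<le> a z \<and> a z \<le> c" "\<And>z. 0 \<le> b z \<and> b z \<le> c" "\<And>z. 0 \<le> k z \<and> k z \<le> c" for a b k
  proof -
    have "(\<integral>z. (a z - b z)\<^sup>2 \<partial>?P) \<le> (\<integral>z. 2 * (k z - a z)\<^sup>2 + 2 * (k z - b z)\<^sup>2 \<partial>?P)"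
    proof (intro integral_mono)
      fix z
      have "0 \<le> (2 * k z - a z - b z)\<^sup>2" by simp
      then show "(a z - b z)\<^sup>2 \<le> 2 * (k z - a z)\<^sup>2 + 2 * (k z - b z)\<^sup>2"
        by (simp add: power2_eq_square algebra_simps)
    next
      show "integrable ?P (\<lambda>z. 2 * (k z - a z)\<^sup>2 + 2 * (k z - b z)\<^sup>2)"
        by (intro Bochner_Integration.integrable_add integrable_mult_right sq_int that)
    qed (intro sq_int that)
    also have "\<dots> = 2 * (\<integral>z. (k z - a z)\<^sup>2 \<partial>?P) + 2 * (\<integral>z. (k z - b z)\<^sup>2 \<partial>?P)"
      using sq_int that by simp
    finally show ?thesis .
  qed
  have sb: "step h \<in> borel_measurable ?P" "0 \<le> step h z \<and> step h z \<le> c" if "finite_partition h" for h z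
    using step_borel[OF that] step_bounds[OF that] by auto
  have cau: "(\<integral>z. (step (g m) z - step (g n) z)\<^sup>2 \<partial>?P) \<le> 2 * inverse (real (Suc m)) + 2 * inverse (real (Suc n))" for m n
    using sq_tri[of "step (g m)" "step (g n)" "step (join (g m) (g n))"] sb[OF g(1)] sb[OF join[OF g(1) g(1)]]
      near(1)[OF g(1), of m n] near(2)[OF g(1), of m n] by fastforce
  obtain p0 where p0[measurable]: "p0 \<in> borel_measurable ?P"
    and p0_lim: "\<And>e. e > 0 \<Longrightarrow> \<exists>N. \<forall>n\<ge>N. (\<integral>\<^sup>+z. ennreal ((norm (step (g n) z - p0 z))\<^sup>2) \<partial>?P) \<le> ennreal e"
  proof (rule L2_complete[of "\<lambda>n. step (g n)" ?P])
    fix e :: real assume "e > 0"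
    then obtain N where N: "inverse (real (Suc N)) < e / 4"
      using reals_Archimedean[of "e/4"] by auto
    show "\<exists>N. \<forall>m\<ge>N. \<forall>n\<ge>N. (\<integral>\<^sup>+z. ennreal ((norm (step (g m) z - step (g n) z))\<^sup>2) \<partial>?P) \<le> ennreal e"
    proof (intro exI allI impI)
      fix m n assume "N \<le> m" "N \<le> n"
      then have "inverse (real (Suc m)) \<le> inverse (real (Suc N))" "inverse (real (Suc n)) \<le> inverse (real (Suc N))"
        by (auto simp: field_simps)
      then have "(\<integral>z. (step (g m) z - step (g n) z)\<^sup>2 \<partial>?P) \<le> e"
        using cau[of m n] N by linarith
      moreover have "(\<integral>\<^sup>+z. ennreal ((norm (step (g m) z - step (g n) z))\<^sup>2) \<partial>?P) = ennreal (\<integral>z. (step (g m) z - step (g n) z)\<^sup>2 \<partial>?P)"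
        using sq_int[OF sb(1)[OF g(1)] sb(1)[OF g(1)] sb(2)[OF g(1)] sb(2)[OF g(1)]]
        by (simp add: nn_integral_eq_integral)
      ultimately show "(\<integral>\<^sup>+z. ennreal ((norm (step (g m) z - step (g n) z))\<^sup>2) \<partial>?P) \<le> ennreal e"
        by (simp add: ennreal_leI)
    qed
  qed (use sb g in auto)
  define p where "p z = max 0 (min c (p0 z))" for z
  have p[measurable]: "p \<in> borel_measurable ?P" unfolding p_def by measurable
  have p_b: "0 \<le> p z \<and> p z \<le> c" for z using c_nonneg by (auto simp: p_def)
  have p_lim: "\<exists>N. \<forall>n\<ge>N. (\<integral>z. (step (g n) z - p z)\<^sup>2 \<partial>?P) \<le> e" if "e > 0" for e
  proof -
    obtain N where N: "\<And>n. n \<ge> N \<Longrightarrow> (\<integral>\<^sup>+z. ennreal ((norm (step (g n) z - p0 z))\<^sup>2) \<partial>?P) \<le> ennreal e"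
      using p0_lim[OF \<open>e > 0\<close>] by auto
    have "(\<integral>z. (step (g n) z - p z)\<^sup>2 \<partial>?P) \<le> e" if n: "n \<ge> N" for n
    proof -
      have "ennreal (\<integral>z. (step (g n) z - p z)\<^sup>2 \<partial>?P) = (\<integral>\<^sup>+z. ennreal ((step (g n) z - p z)\<^sup>2) \<partial>?P)"
        using sq_int[OF sb(1)[OF g(1)] p sb(2)[OF g(1)] p_b] by (simp add: nn_integral_eq_integral)
      also have "\<dots> \<le> (\<integral>\<^sup>+z. ennreal ((norm (step (g n) z - p0 z))\<^sup>2) \<partial>?P)"
      proof (intro nn_integral_mono ennreal_leI)
        fix z
        have "\<bar>step (g n) z - p z\<bar> \<le> \<bar>step (g n) z - p0 z\<bar>"
          using sb(2)[OF g(1)[of n], of z] by (auto simp: p_def max_def min_def abs_if)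
        then show "(step (g n) z - p z)\<^sup>2 \<le> (norm (step (g n) z - p0 z))\<^sup>2"
          by (simp add: abs_le_square_iff)
      qed
      also have "\<dots> \<le> ennreal e" by (rule N[OF n])
      finally show ?thesis using \<open>e > 0\<close> by (simp add: ennreal_le_iff)
    qed
    then show ?thesis by blast
  qed
  show ?thesis
  proof
    fix A B assume AB[measurable]: "A \<in> sets M" "B \<in> sets M"
    define h :: "'a \<Rightarrow> nat" where "h x = (if x \<in> A then 1 else 0) + (if x \<in> B then 2 else 0)" for x
    have h: "finite_partition h"
    proof -
      have "h \<in> M \<rightarrow>\<^sub>M count_space UNIV" unfolding h_def by measurable
      moreover have "finite (range h)"
        by (rule finite_subset[of _ "{0..3}"]) (auto simp: h_def)
      ultimately show ?thesis by (simp add: finite_partition_def)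
    qed
    have AM: "A \<subseteq> space M" "B \<subseteq> space M" by (simp_all add: sets.sets_into_space)
    let ?m = "measure ?P (space ?P)"
    let ?I = "\<lambda>f. \<integral>z. indicator (A \<times> B) z * f z \<partial>?P"
    have rect: "?I (step (join (g n) h)) = \<Phi> A B" for n
    proof -
      let ?V = "{v. snd (prod_decode v) \<in> {1,3}}" and ?W = "{v. snd (prod_decode v) \<in> {2,3}}"
      have "A = join (g n) h -` ?V \<inter> space M" "B = join (g n) h -` ?W \<inter> space M"
        using AM by (auto simp: join_def h_def split: if_splits)
      then show ?thesis
        using integral_step_rect[OF join[OF g(1)[of n] h], of ?V ?W]
        by (simp add: indicator_times mult.commute mult.assoc)
    qed
    have "\<bar>\<Phi> A B - ?I p\<bar> \<le> \<delta> * (?m + 4)" if \<delta>: "\<delta> > 0" for \<delta>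
    proof -
      obtain N where N: "\<And>n. n \<ge> N \<Longrightarrow> (\<integral>z. (step (g n) z - p z)\<^sup>2 \<partial>?P) \<le> \<delta>\<^sup>2"
        using p_lim[of "\<delta>\<^sup>2"] \<delta> by auto
      obtain N' where N': "inverse (real (Suc N')) < \<delta>\<^sup>2"
        using reals_Archimedean[of "\<delta>\<^sup>2"] \<delta> by auto
      define n where "n = max N N'"
      have "inverse (real (Suc n)) \<le> inverse (real (Suc N'))"
        by (auto simp: n_def field_simps)
      then have n: "inverse (real (Suc n)) \<le> \<delta>\<^sup>2" using N' by linarith
      define j where "j = join (g n) h"
      have j: "finite_partition j" unfolding j_def by (intro join g h)
      note sj = sb[OF j] and sg = sb[OF g(1)[of n]]
      have d1: "(\<integral>z. (step (g n) z - step j z)\<^sup>2 \<partial>?P) \<le> \<delta>\<^sup>2"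
        using near(1)[OF h, of n] n unfolding j_def by (simp add: power2_commute)
      have d2: "(\<integral>z. (step j z - p z)\<^sup>2 \<partial>?P) \<le> 4 * \<delta>\<^sup>2"
        using sq_tri[OF sj(1) p sg(1) sj(2) p_b sg(2)] d1 N[of n] by (simp add: n_def)
      have "\<Phi> A B - ?I p = (\<integral>z. indicator (A \<times> B) z * step j z - indicator (A \<times> B) z * p z \<partial>?P)"
      proof (subst Bochner_Integration.integral_diff)
        show "integrable ?P (\<lambda>z. indicator (A \<times> B) z * step j z)" "integrable ?P (\<lambda>z. indicator (A \<times> B) z * p z)"
          using sj p_b c_nonneg AB by (auto intro!: integrable_bounded[where C = c] split: split_indicator)
      qed (simp add: rect[folded j_def] j_def rect)
      also have "\<bar>\<dots>\<bar> \<le> (\<integral>z. \<bar>indicator (A \<times> B) z * step j z - indicator (A \<times> B) z * p z\<bar> \<partial>?P)"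
        by (rule integral_abs_bound)
      also have "\<dots> \<le> (\<integral>z. \<delta> + (step j z - p z)\<^sup>2 / \<delta> \<partial>?P)"
      proof (intro integral_mono)
        fix z
        let ?u = "step j z - p z"
        have "\<bar>?u\<bar> \<le> \<delta> + ?u\<^sup>2 / \<delta>"
        proof (cases "\<bar>?u\<bar> \<le> \<delta>")
          case True then show ?thesis using \<delta> by (simp add: add_increasing2)
        next
          case False
          then have "\<bar>?u\<bar> * \<delta> \<le> \<bar>?u\<bar> * \<bar>?u\<bar>" by (intro mult_left_mono) auto
          then have "\<bar>?u\<bar> \<le> ?u\<^sup>2 / \<delta>" using \<delta> by (simp add: le_divide_eq power2_eq_square)
          then show ?thesis using \<delta> by simp
        qed
        then show "\<bar>indicator (A \<times> B) z * step j z - indicator (A \<times> B) z * p z\<bar> \<le> \<delta> + ?u\<^sup>2 / \<delta>"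
          using \<delta> by (auto split: split_indicator intro: order_trans add_nonneg_nonneg)
      next
        show "integrable ?P (\<lambda>z. \<bar>indicator (A \<times> B) z * step j z - indicator (A \<times> B) z * p z\<bar>)"
          using sj(1) p AB
        proof (intro integrable_bounded[where C = c])
          fix z
          show "\<bar>\<bar>indicator (A \<times> B) z * step j z - indicator (A \<times> B) z * p z\<bar>\<bar> \<le> c"
            using sj(2)[of z] p_b[of z] by (auto split: split_indicator)
        qed auto
      qed (use sq_int[OF sj(1) p sj(2) p_b] in auto)
      also have "\<dots> = \<delta> * ?m + (\<integral>z. (step j z - p z)\<^sup>2 \<partial>?P) / \<delta>"
        using sq_int[OF sj(1) p sj(2) p_b] by (simp add: mult.commute)
      also have "\<dots> \<le> \<delta> * ?m + 4 * \<delta>\<^sup>2 / \<delta>"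
        using d2 \<delta> by (intro add_left_mono divide_right_mono) auto
      also have "\<dots> = \<delta> * (?m + 4)"
        using \<delta> by (simp add: power2_eq_square algebra_simps)
      finally show ?thesis .
    qed
    note * = this
    have "\<bar>\<Phi> A B - ?I p\<bar> \<le> e" if "e > 0" for e
    proof -
      have "?m + 4 > 0" by (simp add: add_nonneg_pos)
      then show ?thesis
        using *[of "e / (?m + 4)"] that by simp
    qed
    then have "\<bar>\<Phi> A B - ?I p\<bar> \<le> 0"
      by (meson dense_ge)
    then show "\<Phi> A B = ?I p" by simp
  qed (use p p_b in auto)
qed

end

text \<open>The bimeasure with density \<open>g - f\<close> has a nonnegative density by \<open>density_exists\<close>.\<close>

lemma AE_le_of_rectangles_finite:
  fixes f g :: "'a \<times> 'a \<Rightarrow> real"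
  assumes "finite_measure M"
    and [measurable]: "f \<in> borel_measurable (M \<Otimes>\<^sub>M M)" "g \<in> borel_measurable (M \<Otimes>\<^sub>M M)"
    and f: "\<And>z. 0 \<le> f z" "\<And>z. f z \<le> c" and g: "\<And>z. 0 \<le> g z" "\<And>z. g z \<le> c"
    and le: "\<And>A B. A \<in> sets M \<Longrightarrow> B \<in> sets M \<Longrightarrow>
      (\<integral>z. indicator (A \<times> B) z * f z \<partial>(M \<Otimes>\<^sub>M M)) \<le> (\<integral>z. indicator (A \<times> B) z * g z \<partial>(M \<Otimes>\<^sub>M M))"
  shows "AE z in M \<Otimes>\<^sub>M M. f z \<le> g z"
proof -
  interpret M: finite_measure M by fact
  interpret PP: finite_measure "M \<Otimes>\<^sub>M M"
    by (rule finite_measure_pair_measure) fact+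
  let ?P = "M \<Otimes>\<^sub>M M"
  have c: "0 \<le> c" using f order_trans by blast
  have int: "integrable ?P (\<lambda>z. indicator (A \<times> B) z * h z)"
    if "A \<in> sets M" "B \<in> sets M" "h \<in> borel_measurable ?P" "\<And>z. \<bar>h z\<bar> \<le> C" for A B h and C :: real
  proof (rule PP.integrable_const_bound[where B = C])
    show "AE z in ?P. norm (indicator (A \<times> B) z * h z) \<le> C"
      using that(4) by (intro AE_I2) (auto split: split_indicator intro: order_trans[OF abs_ge_zero])
  qed (use that in measurable)
  have bd: "\<bar>g z - f z\<bar> \<le> c" "\<bar>f z\<bar> \<le> c" "\<bar>g z\<bar> \<le> c" for z
    using f[of z] g[of z] by auto
  define \<Phi> where "\<Phi> A B = (\<integral>z. indicator (A \<times> B) z * (g z - f z) \<partial>?P)" for A B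
  have \<Phi>: "\<Phi> A B = (\<integral>z. indicator (A \<times> B) z * g z \<partial>?P) - (\<integral>z. indicator (A \<times> B) z * f z \<partial>?P)"
    if "A \<in> sets M" "B \<in> sets M" for A B
    unfolding \<Phi>_def right_diff_distrib
    by (intro Bochner_Integration.integral_diff int[where C = c] that bd) auto
  interpret bounded_bimeasure M \<Phi> c
  proof
    fix A B assume AB: "A \<in> sets M" "B \<in> sets M"
    show "0 \<le> \<Phi> A B" using le[OF AB] by (simp add: \<Phi>[OF AB])
    have "\<Phi> A B \<le> (\<integral>z. c * indicator (A \<times> B) z \<partial>?P)"
      unfolding \<Phi>_def
    proof (intro integral_mono int[where C = c] AB bd)
      fix z
      show "indicator (A \<times> B) z * (g z - f z) \<le> c * indicator (A \<times> B) z"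
        using bd(1)[of z] by (auto split: split_indicator)
      show "integrable ?P (\<lambda>z. c * indicator (A \<times> B) z)"
        using int[OF AB, of "\<lambda>_. c" "\<bar>c\<bar>"] by (simp add: mult.commute)
    qed auto
    also have "\<dots> = c * measure ?P (A \<times> B)"
      using AB by simp
    also have "measure ?P (A \<times> B) = measure M A * measure M B"
      using AB by (simp add: measure_def M.emeasure_pair_measure_Times enn2real_mult)
    finally show "\<Phi> A B \<le> c * (measure M A * measure M B)" .
  next
    fix A A' B assume s: "A \<in> sets M" "A' \<in> sets M" "B \<in> sets M" "A \<inter> A' = {}"
    have "\<Phi> (A \<union> A') B = (\<integral>z. indicator (A \<times> B) z * (g z - f z) + indicator (A' \<times> B) z * (g z - f z) \<partial>?P)"
      unfolding \<Phi>_def using s(4)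
      by (intro Bochner_Integration.integral_cong refl) (auto split: split_indicator)
    also have "\<dots> = \<Phi> A B + \<Phi> A' B"
      unfolding \<Phi>_def by (intro Bochner_Integration.integral_add int[where C = c] s bd) auto
    finally show "\<Phi> (A \<union> A') B = \<Phi> A B + \<Phi> A' B" .
  next
    fix A B B' assume s: "A \<in> sets M" "B \<in> sets M" "B' \<in> sets M" "B \<inter> B' = {}"
    have "\<Phi> A (B \<union> B') = (\<integral>z. indicator (A \<times> B) z * (g z - f z) + indicator (A \<times> B') z * (g z - f z) \<partial>?P)"
      unfolding \<Phi>_def using s(4)
      by (intro Bochner_Integration.integral_cong refl) (auto split: split_indicator)
    also have "\<dots> = \<Phi> A B + \<Phi> A B'"
      unfolding \<Phi>_def by (intro Bochner_Integration.integral_add int[where C = c] s bd) auto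
    finally show "\<Phi> A (B \<union> B') = \<Phi> A B + \<Phi> A B'" .
  qed (rule c)
  obtain p where [measurable]: "p \<in> borel_measurable ?P" and p: "\<And>z. 0 \<le> p z" "\<And>z. p z \<le> c"
    and p\<Phi>: "\<And>A B. A \<in> sets M \<Longrightarrow> B \<in> sets M \<Longrightarrow> \<Phi> A B = (\<integral>z. indicator (A \<times> B) z * p z \<partial>?P)"
    by (rule density_exists) blast
  let ?D = "\<lambda>h. density ?P (\<lambda>z. ennreal (h z))"
  have D: "emeasure (?D h) (A \<times> B) = ennreal (\<integral>z. indicator (A \<times> B) z * h z \<partial>?P)"
    if "A \<in> sets M" "B \<in> sets M" "h \<in> borel_measurable ?P" "\<And>z. 0 \<le> h z" "\<And>z. h z \<le> C" for A B h and C :: real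
  proof -
    have "\<bar>h z\<bar> \<le> C" for z using that(4,5)[of z] by simp
    then have i: "integrable ?P (\<lambda>z. indicator (A \<times> B) z * h z)"
      by (rule int[OF that(1-3)])
    have "emeasure (?D h) (A \<times> B) = (\<integral>\<^sup>+z. ennreal (indicator (A \<times> B) z * h z) \<partial>?P)"
      using that(1-3) by (subst emeasure_density) (auto intro!: nn_integral_cong split: split_indicator)
    also have "\<dots> = ennreal (\<integral>z. indicator (A \<times> B) z * h z \<partial>?P)"
      using i that(4) by (intro nn_integral_eq_integral) auto
    finally show ?thesis .
  qed
  have fp: "0 \<le> f z + p z" "f z + p z \<le> c + c" for z
    using f(1)[of z] p(1)[of z] f(2)[of z] p(2)[of z] by linarith+
  have "?D (\<lambda>z. f z + p z) = ?D g"
  proof (rule measure_eqI_generator_eq[where \<Omega> = "space M \<times> space M" and A = "\<lambda>_. space M \<times> space M"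
      and E = "{A \<times> B | A B. A \<in> sets M \<and> B \<in> sets M}"])
    show "Int_stable {A \<times> B | A B. A \<in> sets M \<and> B \<in> sets M}"
      by (rule Int_stable_pair_measure_generator)
    show "{A \<times> B | A B. A \<in> sets M \<and> B \<in> sets M} \<subseteq> Pow (space M \<times> space M)"
      using sets.sets_into_space by auto
    fix X assume "X \<in> {A \<times> B | A B. A \<in> sets M \<and> B \<in> sets M}"
    then obtain A B where AB: "A \<in> sets M" "B \<in> sets M" "X = A \<times> B" by auto
    have "(\<integral>z. indicator (A \<times> B) z * (f z + p z) \<partial>?P) = (\<integral>z. indicator (A \<times> B) z * f z \<partial>?P) + (\<integral>z. indicator (A \<times> B) z * p z \<partial>?P)"
      unfolding distrib_left using p by (intro Bochner_Integration.integral_add int[where C = c] AB bd) auto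
    also have "\<dots> = (\<integral>z. indicator (A \<times> B) z * g z \<partial>?P)"
      using p\<Phi>[OF AB(1,2)] \<Phi>[OF AB(1,2)] by simp
    finally show "emeasure (?D (\<lambda>z. f z + p z)) X = emeasure (?D g) X"
      unfolding AB(3) using D[OF AB(1,2), of "\<lambda>z. f z + p z", OF _ fp] D[OF AB(1,2), of g, OF _ g] by simp
  next
    show "sets (?D (\<lambda>z. f z + p z)) = sigma_sets (space M \<times> space M) {A \<times> B | A B. A \<in> sets M \<and> B \<in> sets M}"
      "sets (?D g) = sigma_sets (space M \<times> space M) {A \<times> B | A B. A \<in> sets M \<and> B \<in> sets M}"
      by (simp_all add: sets_pair_measure)
    fix i :: nat
    show "emeasure (?D (\<lambda>z. f z + p z)) (space M \<times> space M) \<noteq> \<infinity>"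
      by (subst D[OF _ _ _ fp]) auto
  qed auto
  then have "AE z in ?P. ennreal (f z + p z) = ennreal (g z)"
    by (subst (asm) PP.density_unique_iff) auto
  then show ?thesis
  proof eventually_elim
    case (elim z)
    then have "f z + p z = g z" using fp[of z] g[of z] by simp
    then show ?case using p[of z] by linarith
  qed
qed

lemma AE_le_of_rectangles:
  fixes f g :: "'a::euclidean_space \<times> 'a \<Rightarrow> real"
  assumes [measurable]: "f \<in> borel_measurable borel" "g \<in> borel_measurable borel"
    and f: "\<And>z. 0 \<le> f z" "\<And>z. f z \<le> c" and g: "\<And>z. 0 \<le> g z"
    and g_bdd: "\<And>n::nat. \<exists>C. \<forall>x\<in>ball 0 n. \<forall>y\<in>ball 0 n. g (x, y) \<le> C"
    and le: "\<And>A B. A \<in> sets borel \<Longrightarrow> B \<in> sets borel \<Longrightarrow> bounded A \<Longrightarrow> bounded B \<Longrightarrow>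
      (\<integral>\<^sup>+x. \<integral>\<^sup>+y. ennreal (f (x, y) * (indicator A x * indicator B y)) \<partial>lborel \<partial>lborel)
      \<le> (\<integral>\<^sup>+x. \<integral>\<^sup>+y. ennreal (g (x, y) * (indicator A x * indicator B y)) \<partial>lborel \<partial>lborel)"
  shows "AE z in lborel. f z \<le> g z"
proof -
  have "AE z in lborel. z \<in> ball 0 (real n) \<times> ball 0 (real n) \<longrightarrow> f z \<le> g z" for n :: nat
  proof -
    let ?b = "ball (0::'a) (real n)"
    let ?i = "\<lambda>x. ennreal (indicator ?b x)"
    let ?M = "density lborel ?i"
    have [measurable_cong]: "sets ?M = sets borel" by simp
    have b_sets[measurable]: "?b \<in> sets borel" by simp
    interpret M: finite_measure ?M
    proof (rule finite_measureI)
      have "emeasure ?M (space ?M) = emeasure lborel ?b"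
        by (subst emeasure_density) (auto simp: ennreal_indicator intro!: borel_measurable_indicator)
      then show "emeasure ?M (space ?M) \<noteq> \<infinity>"
        using emeasure_bounded_finite[OF bounded_ball, of "0::'a" "real n"] by (simp add: less_top)
    qed
    obtain C where C: "\<And>x y. x \<in> ?b \<Longrightarrow> y \<in> ?b \<Longrightarrow> g (x, y) \<le> C"
      using g_bdd[of n] by blast
    define C' where "C' = max 0 (max C c)"
    define f' where "f' z = f z * indicator (?b \<times> ?b) z" for z
    define g' where "g' z = g z * indicator (?b \<times> ?b) z" for z
    have bM: "borel_measurable (?M \<Otimes>\<^sub>M ?M) = (borel_measurable borel :: ('a \<times> 'a \<Rightarrow> real) set)"
    proof (rule measurable_cong_sets)
      have "sets (?M \<Otimes>\<^sub>M ?M) = sets ((borel :: 'a measure) \<Otimes>\<^sub>M (borel :: 'a measure))"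
        by (intro sets_pair_measure_cong) simp_all
      then show "sets (?M \<Otimes>\<^sub>M ?M) = sets borel" by (simp only: borel_prod)
    qed simp
    have [measurable]: "f' \<in> borel_measurable borel" "g' \<in> borel_measurable borel"
      unfolding f'_def g'_def
      by (intro borel_measurable_times borel_measurable_indicator assms(1,2) borel_open open_Times open_ball)+
    have b: "0 \<le> f' z" "f' z \<le> C'" "0 \<le> g' z" "g' z \<le> C'" for z
      using f[of z] g[of z] C[of "fst z" "snd z"]
      by (auto simp: f'_def g'_def C'_def indicator_def)
    have rect: "ennreal (\<integral>z. indicator (A \<times> B) z * h z \<partial>(?M \<Otimes>\<^sub>M ?M)) =
      (\<integral>\<^sup>+x. \<integral>\<^sup>+y. ennreal (h (x, y) * (indicator (A \<inter> ?b) x * indicator (B \<inter> ?b) y)) \<partial>lborel \<partial>lborel)"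
      if AB: "A \<in> sets borel" "B \<in> sets borel" and h[measurable]: "h \<in> borel_measurable borel" and hb: "\<And>z. 0 \<le> h z" "\<And>z. h z \<le> C'"
      for A B and h :: "'a \<times> 'a \<Rightarrow> real"
    proof -
      interpret PP: finite_measure "?M \<Otimes>\<^sub>M ?M"
        by (rule finite_measure_pair_measure) unfold_locales
      have [measurable]: "h \<in> borel_measurable (?M \<Otimes>\<^sub>M ?M)" unfolding bM by (rule h)
      have hp[measurable]: "h \<in> borel_measurable (borel \<Otimes>\<^sub>M borel)" by (simp add: borel_prod h)
      have [measurable]: "A \<in> sets borel" "B \<in> sets borel" by fact+
      have "ennreal (\<integral>z. indicator (A \<times> B) z * h z \<partial>(?M \<Otimes>\<^sub>M ?M)) = (\<integral>\<^sup>+z. ennreal (indicator (A \<times> B) z * h z) \<partial>(?M \<Otimes>\<^sub>M ?M))"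
        using hb AB
        by (intro nn_integral_eq_integral[symmetric] PP.integrable_const_bound[where B = C'])
          (auto split: split_indicator intro!: AE_I2 order_trans[OF hb(1) hb(2)])
      also have "\<dots> = (\<integral>\<^sup>+x. \<integral>\<^sup>+y. ennreal (indicator (A \<times> B) (x, y) * h (x, y)) \<partial>?M \<partial>?M)"
        by (rule M.nn_integral_fst[symmetric]) (use AB in measurable)
      also have "\<dots> = (\<integral>\<^sup>+x. (\<integral>\<^sup>+y. ?i y * ennreal (indicator (A \<times> B) (x, y) * h (x, y)) \<partial>lborel) \<partial>?M)"
        by (intro nn_integral_cong nn_integral_density) measurable
      also have "\<dots> = (\<integral>\<^sup>+x. ?i x * (\<integral>\<^sup>+y. ?i y * ennreal (indicator (A \<times> B) (x, y) * h (x, y)) \<partial>lborel) \<partial>lborel)"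
        by (intro nn_integral_density) measurable
      also have "\<dots> = (\<integral>\<^sup>+x. (\<integral>\<^sup>+y. ?i x * (?i y * ennreal (indicator (A \<times> B) (x, y) * h (x, y))) \<partial>lborel) \<partial>lborel)"
        by (intro nn_integral_cong nn_integral_cmult[symmetric]) measurable
      also have "\<dots> = (\<integral>\<^sup>+x. \<integral>\<^sup>+y. ennreal (h (x, y) * (indicator (A \<inter> ?b) x * indicator (B \<inter> ?b) y)) \<partial>lborel \<partial>lborel)"
        by (intro nn_integral_cong) (auto split: split_indicator)
      finally show ?thesis .
    qed
    have "AE z in ?M \<Otimes>\<^sub>M ?M. f' z \<le> g' z"
    proof (rule AE_le_of_rectangles_finite[where c = C'])
      fix A B assume "A \<in> sets ?M" "B \<in> sets ?M"
      then have AB[measurable]: "A \<in> sets borel" "B \<in> sets borel" by auto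
      have "ennreal (\<integral>z. indicator (A \<times> B) z * f' z \<partial>(?M \<Otimes>\<^sub>M ?M)) \<le> ennreal (\<integral>z. indicator (A \<times> B) z * g' z \<partial>(?M \<Otimes>\<^sub>M ?M))"
      proof -
        have "(\<integral>\<^sup>+x. \<integral>\<^sup>+y. ennreal (f (x, y) * (indicator (A \<inter> ?b) x * indicator (B \<inter> ?b) y)) \<partial>lborel \<partial>lborel)
          \<le> (\<integral>\<^sup>+x. \<integral>\<^sup>+y. ennreal (g (x, y) * (indicator (A \<inter> ?b) x * indicator (B \<inter> ?b) y)) \<partial>lborel \<partial>lborel)"
          by (intro le) auto
        moreover have "f' (x, y) * (indicator (A \<inter> ?b) x * indicator (B \<inter> ?b) y) = f (x, y) * (indicator (A \<inter> ?b) x * indicator (B \<inter> ?b) y)"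
          "g' (x, y) * (indicator (A \<inter> ?b) x * indicator (B \<inter> ?b) y) = g (x, y) * (indicator (A \<inter> ?b) x * indicator (B \<inter> ?b) y)" for x y
          by (auto simp: indicator_def f'_def g'_def)
        ultimately show ?thesis
          by (simp only: rect[OF AB _ b(1,2)] rect[OF AB _ b(3,4)] \<open>f' \<in> borel_measurable borel\<close> \<open>g' \<in> borel_measurable borel\<close>)
      qed
      moreover have "0 \<le> (\<integral>z. indicator (A \<times> B) z * g' z \<partial>(?M \<Otimes>\<^sub>M ?M))"
        using b by (intro integral_nonneg_AE AE_I2) auto
      ultimately show "(\<integral>z. indicator (A \<times> B) z * f' z \<partial>(?M \<Otimes>\<^sub>M ?M)) \<le> (\<integral>z. indicator (A \<times> B) z * g' z \<partial>(?M \<Otimes>\<^sub>M ?M))"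
        by (simp add: ennreal_le_iff)
    qed (use b in \<open>auto simp: bM intro: M.finite_measure_axioms\<close>)
    moreover have "?M \<Otimes>\<^sub>M ?M = density (lborel \<Otimes>\<^sub>M lborel) (\<lambda>(x, y). ?i x * ?i y)"
      by (rule pair_measure_density) (auto intro: sigma_finite_lborel M.sigma_finite_measure_axioms)
    ultimately have "AE z in density lborel (\<lambda>(x, y). ?i x * ?i y). f' z \<le> g' z"
      unfolding lborel_prod by (rule back_subst[where P = "\<lambda>M. AE z in M. f' z \<le> g' z"])
    then have "AE z in lborel. (case z of (x, y) \<Rightarrow> ?i x * ?i y) > 0 \<longrightarrow> f' z \<le> g' z"
      by (subst (asm) AE_density) (auto simp: lborel_prod[symmetric])
    then show ?thesis
      by eventually_elim (auto simp: f'_def g'_def indicator_def split: if_splits)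
  qed
  then have "AE z in lborel. \<forall>n::nat. z \<in> ball 0 (real n) \<times> ball 0 (real n) \<longrightarrow> f z \<le> g z"
    unfolding AE_all_countable by blast
  then show ?thesis
  proof eventually_elim
    case (elim z)
    obtain n :: nat where "max (norm (fst z)) (norm (snd z)) < real n"
      using reals_Archimedean2 by blast
    then show ?case using elim[rule_format, of n] by (auto simp: mem_Times_iff)
  qed
qed

section \<open>Spectral and growth bounds of semigroups on a Hilbert space\<close>

locale bounded_semigroup =
  fixes T :: "real \<Rightarrow> 'h::{real_inner, banach} \<Rightarrow> 'h" and K :: real
  assumes lin: "t \<ge> 0 \<Longrightarrow> bounded_linear (T t)"
    and add: "s \<ge> 0 \<Longrightarrow> t \<ge> 0 \<Longrightarrow> T (s + t) f = T s (T t f)"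
    and bounded: "t \<ge> 0 \<Longrightarrow> norm (T t f) \<le> K * norm f"
    and strong: "((\<lambda>t. T t f) \<longlongrightarrow> T 0 f) (at_right 0)"
begin

lemma T0: "t \<ge> 0 \<Longrightarrow> T t (T 0 f) = T t f" "t \<ge> 0 \<Longrightarrow> T 0 (T t f) = T t f"
  using add[of t 0 f, symmetric] add[of 0 t f, symmetric] by simp_all

lemma T_diff: "t \<ge> 0 \<Longrightarrow> T t (f - g) = T t f - T t g"
  by (intro linear_diff bounded_linear.linear lin)

lemma T_scale: "t \<ge> 0 \<Longrightarrow> T t (c *\<^sub>R f) = c *\<^sub>R T t f"
  by (intro linear_scale bounded_linear.linear lin)

lemma K_nonneg: "0 \<le> K \<or> (\<forall>f::'h. f = 0)"
proof (rule disjCI)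
  assume "\<not> (\<forall>f::'h. f = 0)"
  then obtain f :: 'h where "norm f > 0" by auto
  moreover have "0 \<le> K * norm f" using bounded[of 0 f] by (meson norm_ge_zero order_trans order_refl)
  ultimately show "0 \<le> K" by (simp add: zero_le_mult_iff)
qed

lemma orbit_continuous: "continuous_on {0..} (\<lambda>t. T t f)"
proof (cases "\<forall>f::'h. f = 0")
  case True
  then have "(\<lambda>t. T t f) = (\<lambda>t. 0)" by blast
  then show ?thesis by (metis continuous_on_const)
next
  case False
  then have K: "0 \<le> K" using K_nonneg by blast
  have diff: "norm (T t f - T s f) \<le> K * norm (T (t - s) f - T 0 f)" if "0 \<le> s" "s \<le> t" for s t
  proof -
    have "T t f - T s f = T s (T (t - s) f - T 0 f)"
      using that add[of s "t - s" f] by (simp add: T_diff T0)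
    then show ?thesis using bounded that by simp
  qed
  show ?thesis
    unfolding continuous_on_iff
  proof safe
    fix s e :: real assume s: "0 \<le> s" and e: "0 < e"
    have "eventually (\<lambda>t. dist (T t f) (T 0 f) < e / (K + 1)) (at_right 0)"
      using strong e K by (intro tendstoD) auto
    then obtain d where d: "d > 0" "\<And>t. 0 < t \<Longrightarrow> t < d \<Longrightarrow> dist (T t f) (T 0 f) < e / (K + 1)"
      unfolding eventually_at_right_field by auto
    have small: "K * norm (T t f - T 0 f) < e" if "0 \<le> t" "t < d" for t
    proof (cases "t = 0")
      case False
      then have "norm (T t f - T 0 f) < e / (K + 1)"
        using d(2)[of t] that by (simp add: dist_norm)
      then have "(K + 1) * norm (T t f - T 0 f) < e"
        using K by (simp add: field_simps)
      then show ?thesis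
        by (smt (verit) norm_ge_zero mult_right_mono)
    qed (use e in simp)
    have "dist (T t f) (T s f) < e" if "0 \<le> t" "dist t s < d" for t
    proof (cases "s \<le> t")
      case True
      then show ?thesis
        using diff[of s t] small[of "t - s"] s that by (simp add: dist_norm)
    next
      case False
      then have "norm (T s f - T t f) < e"
        using diff[of t s] small[of "s - t"] s that by (simp add: dist_norm)
      then show ?thesis by (simp add: dist_norm norm_minus_commute)
    qed
    with d(1) show "\<exists>d>0. \<forall>x'\<in>{0..}. dist x' s < d \<longrightarrow> dist (T x' f) (T s f) < e"
      by auto
  qed
qed

definition gen :: "'h \<Rightarrow> 'h \<Rightarrow> bool" where
  "gen f g \<longleftrightarrow> T 0 f = f \<and> T 0 g = g \<and> ((\<lambda>h. (T h f - f) /\<^sub>R h) \<longlongrightarrow> g) (at_right 0)"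

definition orbit_integral :: "real \<Rightarrow> 'h \<Rightarrow> real \<Rightarrow> 'h" where
  "orbit_integral \<mu> f b = integral {0..b} (\<lambda>s. exp (\<mu> * s) *\<^sub>R T s f)"

lemma twisted_continuous: "continuous_on {0..b} (\<lambda>s. exp (\<mu> * s) *\<^sub>R T s f)"
  by (intro continuous_intros continuous_on_subset[OF orbit_continuous]) auto

lemma orbit_integral_derivative:
  assumes "0 \<le> x" "x \<le> b"
  shows "(orbit_integral \<mu> f has_vector_derivative exp (\<mu> * x) *\<^sub>R T x f) (at x within {0..b})"
  unfolding orbit_integral_def[abs_def]
  using integral_has_vector_derivative[OF twisted_continuous, of x b \<mu> f] assms by simp

lemma T_orbit_integral:
  assumes h: "h \<ge> 0" and b: "b \<ge> 0"
  shows "T h (orbit_integral \<mu> f b) = exp (- \<mu> * h) *\<^sub>R (orbit_integral \<mu> f (b + h) - orbit_integral \<mu> f h)"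
proof -
  let ?F = "\<lambda>s. exp (\<mu> * s) *\<^sub>R T s f"
  have int: "?F integrable_on {0..c}" for c
    by (rule integrable_continuous_real[OF twisted_continuous])
  have "T h (orbit_integral \<mu> f b) = integral {0..b} (T h \<circ> ?F)"
    unfolding orbit_integral_def by (rule integral_linear[OF int lin[OF h], symmetric])
  also have "\<dots> = integral {0..b} (\<lambda>s. exp (- \<mu> * h) *\<^sub>R ?F (s + h))"
  proof (rule integral_cong)
    fix s assume "s \<in> {0..b}"
    then show "(T h \<circ> ?F) s = exp (- \<mu> * h) *\<^sub>R ?F (s + h)"
      using h by (simp add: T_scale add[symmetric] add.commute mult_exp_exp algebra_simps)
  qed
  also have "\<dots> = exp (- \<mu> * h) *\<^sub>R integral {0..b} (\<lambda>s. ?F (s + h))"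
    by (rule integral_cmul)
  also have "integral {0..b} (\<lambda>s. ?F (s + h)) = integral {h..b+h} ?F"
    using integral_shift_real_ivl[of h h "b + h" ?F] by simp
  also have "\<dots> = orbit_integral \<mu> f (b + h) - orbit_integral \<mu> f h"
    unfolding orbit_integral_def using Henstock_Kurzweil_Integration.integral_combine[OF h _ int[of "b + h"]] b
    by (simp add: algebra_simps)
  finally show ?thesis .
qed

lemma T_orbit_integral_derivative:
  assumes x: "0 \<le> x" "x \<le> c" and b: "b \<ge> 0"
  shows "((\<lambda>h. T h (orbit_integral \<mu> f b)) has_vector_derivative
    exp (- \<mu> * x) *\<^sub>R (exp (\<mu> * (b + x)) *\<^sub>R T (b + x) f - exp (\<mu> * x) *\<^sub>R T x f)
      - \<mu> *\<^sub>R T x (orbit_integral \<mu> f b)) (at x within {0..c})"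
proof -
  let ?G = "orbit_integral \<mu> f"
  have "((\<lambda>h. ?G (b + h)) has_vector_derivative exp (\<mu> * (b + x)) *\<^sub>R T (b + x) f) (at x within {0..c})"
  proof -
    have "((\<lambda>h. b + h) has_vector_derivative 1) (at x within {0..c})"
      by (auto intro!: derivative_eq_intros)
    moreover have "(?G has_vector_derivative exp (\<mu> * (b + x)) *\<^sub>R T (b + x) f) (at (b + x) within (\<lambda>h. b + h) ` {0..c})"
      by (rule has_vector_derivative_within_subset[OF orbit_integral_derivative[of _ "b + c"]])
        (use x b in auto)
    ultimately show ?thesis
      using vector_diff_chain_within[of "\<lambda>h. b + h" 1 x "{0..c}" ?G] by (simp add: o_def)
  qed
  moreover have "(?G has_vector_derivative exp (\<mu> * x) *\<^sub>R T x f) (at x within {0..c})"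
    by (rule orbit_integral_derivative[OF x])
  moreover have "((\<lambda>h. exp (- \<mu> * h)) has_real_derivative - \<mu> * exp (- \<mu> * x)) (at x within {0..c})"
    by (auto intro!: derivative_eq_intros)
  ultimately have "((\<lambda>h. exp (- \<mu> * h) *\<^sub>R (?G (b + h) - ?G h)) has_vector_derivative
     exp (- \<mu> * x) *\<^sub>R (exp (\<mu> * (b + x)) *\<^sub>R T (b + x) f - exp (\<mu> * x) *\<^sub>R T x f)
      + (- \<mu> * exp (- \<mu> * x)) *\<^sub>R (?G (b + x) - ?G x)) (at x within {0..c})"
    by (intro has_vector_derivative_scaleR has_vector_derivative_diff)
  then have "((\<lambda>h. T h (?G b)) has_vector_derivative
     exp (- \<mu> * x) *\<^sub>R (exp (\<mu> * (b + x)) *\<^sub>R T (b + x) f - exp (\<mu> * x) *\<^sub>R T x f)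
      + (- \<mu> * exp (- \<mu> * x)) *\<^sub>R (?G (b + x) - ?G x)) (at x within {0..c})"
    by (rule has_vector_derivative_transform[rotated 2]) (use x b in \<open>auto simp: T_orbit_integral\<close>)
  moreover have "(- \<mu> * exp (- \<mu> * x)) *\<^sub>R (?G (b + x) - ?G x) = - \<mu> *\<^sub>R T x (?G b)"
    using x b by (simp add: T_orbit_integral)
  ultimately show ?thesis by simp
qed

lemma right_difference_quotient:
  fixes u :: "real \<Rightarrow> 'h"
  assumes "(u has_vector_derivative D) (at 0 within {0..1})"
  shows "((\<lambda>h. (u h - u 0) /\<^sub>R h) \<longlongrightarrow> D) (at_right 0)"
proof -
  have "((\<lambda>h. norm (u h - u 0 - h *\<^sub>R D) / norm h) \<longlongrightarrow> 0) (at_right 0)"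
    using assms unfolding has_vector_derivative_def has_derivative_iff_norm
    by (simp add: at_within_Icc_at_right)
  then have "((\<lambda>h. norm ((u h - u 0) /\<^sub>R h - D)) \<longlongrightarrow> 0) (at_right 0)"
  proof (rule Lim_transform_eventually)
    show "\<forall>\<^sub>F h in at_right 0. norm (u h - u 0 - h *\<^sub>R D) / norm h = norm ((u h - u 0) /\<^sub>R h - D)"
      using eventually_at_right_less[of 0]
    proof eventually_elim
      case (elim h)
      then have "(u h - u 0) /\<^sub>R h - D = (u h - u 0 - h *\<^sub>R D) /\<^sub>R h"
        by (simp add: algebra_simps)
      then show ?case using elim by (simp add: divide_inverse mult.commute)
    qed
  qed
  then show ?thesis
    by (subst Lim_null) (rule tendsto_norm_zero_cancel)
qed

lemma gen_orbit_integral: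
  assumes b: "b \<ge> 0"
  shows "gen (orbit_integral \<mu> f b) (exp (\<mu> * b) *\<^sub>R T b f - T 0 f - \<mu> *\<^sub>R orbit_integral \<mu> f b)"
proof -
  let ?G = "orbit_integral \<mu> f b"
  have G0: "T 0 ?G = ?G"
    using T_orbit_integral[of 0 b \<mu> f] b by (simp add: orbit_integral_def)
  have "((\<lambda>h. (T h ?G - T 0 ?G) /\<^sub>R h) \<longlongrightarrow>
     exp (\<mu> * b) *\<^sub>R T b f - T 0 f - \<mu> *\<^sub>R ?G) (at_right 0)"
    using right_difference_quotient[OF T_orbit_integral_derivative[of 0 1 b \<mu> f]] b
    by (simp add: G0)
  then show ?thesis
    unfolding gen_def using b by (simp add: G0 T_diff T_scale T0)
qed

lemma growth_bound:
  assumes num: "\<And>h u. h > 0 \<Longrightarrow> T h u \<bullet> u \<le> \<beta> h * (norm u)\<^sup>2"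
    and \<beta>: "((\<lambda>h. (\<beta> h - 1) / h) \<longlongrightarrow> \<omega>) (at_right 0)"
    and f: "T 0 f = f" and t: "t \<ge> 0"
  shows "norm (T t f) \<le> exp (\<omega> * t) * norm f"
proof -
  let ?v = "\<lambda>b. orbit_integral 0 f b"
  have v: "norm (T t (?v b)) \<le> exp (\<omega> * t) * norm (?v b)" if b: "b \<ge> 0" for b
  proof -
    define u where "u x = T x (?v b)" for x
    define u' where "u' x = T (b + x) f - T x f" for x
    have u: "(u has_vector_derivative u' x) (at x within {0..t})" if "0 \<le> x" "x \<le> t" for x
      using T_orbit_integral_derivative[OF that b, of 0 f] by (simp add: u_def[abs_def] u'_def)
    have diss: "u' x \<bullet> u x \<le> \<omega> * (norm (u x))\<^sup>2" if x: "0 \<le> x" for x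
    proof -
      have "((\<lambda>h. (u (x + h) - u x) /\<^sub>R h) \<longlongrightarrow> u' x) (at_right 0)"
      proof -
        have shift: "((\<lambda>h. x + h) has_vector_derivative 1) (at 0 within {0..1})"
          by (auto intro!: derivative_eq_intros)
        have "(u has_vector_derivative u' x) (at x within {0..x+1})"
          using T_orbit_integral_derivative[OF x _ b, of "x + 1" 0 f] by (simp add: u_def[abs_def] u'_def)
        then have "(u has_vector_derivative u' x) (at x within (\<lambda>h. x + h) ` {0..1})"
          by (rule has_vector_derivative_within_subset) (use x in auto)
        then have "(u has_vector_derivative u' x) (at (x + 0) within (\<lambda>h. x + h) ` {0..1})"
          by simp
        from vector_diff_chain_within[OF shift this]
        have "((\<lambda>h. u (x + h)) has_vector_derivative u' x) (at 0 within {0..1})"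
          by (simp add: o_def)
        from right_difference_quotient[OF this] show ?thesis by simp
      qed
      then have "((\<lambda>h. ((u (x + h) - u x) /\<^sub>R h) \<bullet> u x) \<longlongrightarrow> u' x \<bullet> u x) (at_right 0)"
        by (intro tendsto_intros)
      moreover have "((\<lambda>h. (\<beta> h - 1) / h * (norm (u x))\<^sup>2) \<longlongrightarrow> \<omega> * (norm (u x))\<^sup>2) (at_right 0)"
        by (intro tendsto_intros \<beta>)
      moreover have "\<forall>\<^sub>F h in at_right 0. ((u (x + h) - u x) /\<^sub>R h) \<bullet> u x \<le> (\<beta> h - 1) / h * (norm (u x))\<^sup>2"
        using eventually_at_right_less[of 0]
      proof eventually_elim
        case (elim h)
        have "u (x + h) = T h (u x)"
          using add[of h x "?v b"] x elim by (simp add: u_def add.commute)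
        then have "(u (x + h) - u x) \<bullet> u x \<le> (\<beta> h - 1) * (norm (u x))\<^sup>2"
          using num[OF elim, of "u x"] by (simp add: inner_diff_left power2_norm_eq_inner algebra_simps)
        then show ?case
          using elim by (simp add: divide_inverse mult.assoc mult.commute mult_left_mono)
      qed
      ultimately show ?thesis
        by (intro tendsto_le[of "at_right 0"]) auto
    qed
    define \<phi> where "\<phi> x = exp (- 2 * \<omega> * x) * (u x \<bullet> u x)" for x
    have \<phi>: "(\<phi> has_real_derivative exp (- 2 * \<omega> * x) * (2 * (u' x \<bullet> u x)) - 2 * \<omega> * exp (- 2 * \<omega> * x) * (u x \<bullet> u x)) (at x within {0..t})"
      if "0 \<le> x" "x \<le> t" for x
    proof -
      have "((\<lambda>x. u x \<bullet> u x) has_derivative (\<lambda>h. u x \<bullet> (h *\<^sub>R u' x) + (h *\<^sub>R u' x) \<bullet> u x)) (at x within {0..t})"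
        using u[OF that] unfolding has_vector_derivative_def by (intro has_derivative_inner)
      then have "((\<lambda>x. u x \<bullet> u x) has_real_derivative 2 * (u' x \<bullet> u x)) (at x within {0..t})"
        unfolding has_field_derivative_def by (rule has_derivative_eq_rhs) (auto simp: inner_commute)
      then show ?thesis
        unfolding \<phi>_def[abs_def] by (auto intro!: derivative_eq_intros)
    qed
    have "\<phi> t \<le> \<phi> 0"
    proof (rule ccontr)
      assume "\<not> \<phi> t \<le> \<phi> 0"
      moreover have "t \<noteq> 0" using calculation by auto
      ultimately have "0 < t" using t by auto
      define D where "D x = exp (- 2 * \<omega> * x) * (2 * (u' x \<bullet> u x)) - 2 * \<omega> * exp (- 2 * \<omega> * x) * (u x \<bullet> u x)" for x
      have "(\<phi> has_derivative (*) (D x)) (at x within {0..t})" if "0 \<le> x" "x \<le> t" for x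
        using \<phi>[OF that] unfolding has_field_derivative_def D_def .
      from mvt_simple[OF \<open>0 < t\<close> this]
      have "\<exists>x\<in>{0<..<t}. \<phi> t - \<phi> 0 = D x * (t - 0)" .
      then obtain x where x: "0 < x" "x < t"
        and mv: "\<phi> t - \<phi> 0 = t * (exp (- 2 * \<omega> * x) * (2 * (u' x \<bullet> u x)) - 2 * \<omega> * exp (- 2 * \<omega> * x) * (u x \<bullet> u x))"
        by (auto simp: D_def mult.commute)
      have "exp (- 2 * \<omega> * x) * (2 * (u' x \<bullet> u x)) - 2 * \<omega> * exp (- 2 * \<omega> * x) * (u x \<bullet> u x)
          = exp (- 2 * \<omega> * x) * (2 * (u' x \<bullet> u x - \<omega> * (u x \<bullet> u x)))"
        by (simp add: algebra_simps)
      also have "\<dots> \<le> 0"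
        using diss[of x] x by (intro mult_nonneg_nonpos) (auto simp: power2_norm_eq_inner)
      finally have "\<phi> t - \<phi> 0 \<le> 0"
        unfolding mv using \<open>0 < t\<close> by (intro mult_nonneg_nonpos) auto
      with \<open>\<not> \<phi> t \<le> \<phi> 0\<close> show False by simp
    qed
    then have "exp (- 2 * \<omega> * t) * (norm (u t))\<^sup>2 \<le> (norm (u 0))\<^sup>2"
      by (simp add: \<phi>_def power2_norm_eq_inner)
    then have "(norm (u t))\<^sup>2 \<le> exp (2 * \<omega> * t) * (norm (u 0))\<^sup>2"
      by (simp add: exp_minus field_simps)
    also have "\<dots> = (exp (\<omega> * t) * norm (u 0))\<^sup>2"
      by (simp add: power_mult_distrib exp_double[symmetric] mult.assoc)
    finally have "norm (u t) \<le> exp (\<omega> * t) * norm (u 0)"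
      by (rule power2_le_imp_le) simp
    moreover have "u 0 = ?v b"
      using gen_orbit_integral[OF b, of 0 f] by (simp add: u_def gen_def)
    ultimately show ?thesis by (simp add: u_def)
  qed
  have "((\<lambda>b. (?v b - ?v 0) /\<^sub>R b) \<longlongrightarrow> f) (at_right 0)"
    using right_difference_quotient[OF orbit_integral_derivative[of 0 1 0 f]] by (simp add: f)
  then have lim: "((\<lambda>b. ?v b /\<^sub>R b) \<longlongrightarrow> f) (at_right 0)"
    by (simp add: orbit_integral_def)
  have "((\<lambda>b. norm (T t (?v b /\<^sub>R b))) \<longlongrightarrow> norm (T t f)) (at_right 0)"
    by (intro tendsto_norm bounded_linear.tendsto[OF lin[OF t]] lim)
  moreover have "((\<lambda>b. exp (\<omega> * t) * norm (?v b /\<^sub>R b)) \<longlongrightarrow> exp (\<omega> * t) * norm f) (at_right 0)"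
    by (intro tendsto_intros lim)
  moreover have "\<forall>\<^sub>F b in at_right 0. norm (T t (?v b /\<^sub>R b)) \<le> exp (\<omega> * t) * norm (?v b /\<^sub>R b)"
    using eventually_at_right_less[of 0]
  proof eventually_elim
    case (elim b)
    then show ?case using v[of b] t by (simp add: T_scale divide_inverse mult.left_commute mult_left_mono)
  qed
  ultimately show ?thesis
    by (intro tendsto_le[of "at_right 0"]) auto
qed

end

locale selfadjoint_contraction_semigroup = bounded_semigroup T 1 for T :: "real \<Rightarrow> 'h::{real_inner, banach} \<Rightarrow> 'h" +
  assumes sym: "t \<ge> 0 \<Longrightarrow> T t f \<bullet> g = f \<bullet> T t g"
begin

lemma contraction: "t \<ge> 0 \<Longrightarrow> norm (T t f) \<le> norm f"
  using bounded by simp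

text \<open>With $A$ the generator and $H = -A$, this says that \<open>r\<close> lies in the resolvent set of $H$.\<close>

definition regular :: "real \<Rightarrow> bool" where
  "regular r \<longleftrightarrow>
    (\<forall>f g. gen f g \<longrightarrow> r *\<^sub>R f + g = 0 \<longrightarrow> f = 0) \<and>
    (\<forall>h. T 0 h = h \<longrightarrow> (\<exists>f g. gen f g \<and> r *\<^sub>R f + g = h)) \<and>
    (\<exists>C. \<forall>f g. gen f g \<longrightarrow> norm f \<le> C * norm (r *\<^sub>R f + g))"

lemma half: "t \<ge> 0 \<Longrightarrow> T t f \<bullet> f = (norm (T (t / 2) f))\<^sup>2"
proof -
  assume t: "t \<ge> 0"
  have "T t f = T (t / 2) (T (t / 2) f)"
    using add[of "t/2" "t/2" f] t by simp
  then show ?thesis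
    using sym[of "t/2" "T (t/2) f" f] t by (simp only: power2_norm_eq_inner)
qed

lemma gen_dissipative:
  assumes "gen f g"
  shows "g \<bullet> f \<le> 0"
proof (rule tendsto_upperbound)
  show "((\<lambda>h. ((T h f - f) /\<^sub>R h) \<bullet> f) \<longlongrightarrow> g \<bullet> f) (at_right 0)"
    using assms unfolding gen_def by (intro tendsto_intros) auto
  show "\<forall>\<^sub>F h in at_right 0. ((T h f - f) /\<^sub>R h) \<bullet> f \<le> 0"
    using eventually_at_right_less[of 0]
  proof eventually_elim
    case (elim h)
    have "T h f \<bullet> f \<le> norm (T h f) * norm f" by (rule norm_cauchy_schwarz)
    also have "\<dots> \<le> norm f * norm f" using contraction[of h f] elim by (intro mult_right_mono) auto
    finally have "(T h f - f) \<bullet> f \<le> 0"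
      by (simp add: inner_diff_left norm_eq_sqrt_inner)
    then show ?case using elim by (simp add: mult_nonneg_nonpos)
  qed
qed simp

lemma regular_negative:
  assumes r: "r < 0"
  shows "regular r"
proof -
  have lower: "norm f \<le> (1 / - r) * norm (r *\<^sub>R f + g)" if "gen f g" for f g
  proof -
    have "- r * (norm f)\<^sup>2 \<le> - ((r *\<^sub>R f + g) \<bullet> f)"
      using gen_dissipative[OF that] by (simp add: inner_add_left power2_norm_eq_inner)
    also have "\<dots> \<le> norm (r *\<^sub>R f + g) * norm f"
      using Cauchy_Schwarz_ineq2[of "r *\<^sub>R f + g" f] by linarith
    finally have "(- r * norm f) * norm f \<le> norm (r *\<^sub>R f + g) * norm f"
      by (simp add: power2_eq_square)
    then have "- r * norm f \<le> norm (r *\<^sub>R f + g)"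
      by (cases "norm f = 0") (simp, rule mult_right_le_imp_le, auto)
    then show ?thesis using r by (simp add: field_simps)
  qed
  have "\<exists>f g. gen f g \<and> r *\<^sub>R f + g = h" if h: "T 0 h = h" for h
  proof -
    let ?a = "\<lambda>n::nat. exp (r * n) *\<^sub>R T n h"
    have sm: "summable ?a"
    proof (rule summable_comparison_test)
      show "\<exists>N. \<forall>n\<ge>N. norm (?a n) \<le> exp r ^ n * norm h"
        using contraction[of _ h] by (auto simp: exp_of_nat_mult[symmetric] mult.commute intro!: mult_left_mono)
      show "summable (\<lambda>n. exp r ^ n * norm h)"
        using r by (intro summable_mult2 summable_geometric) auto
    qed
    define k where "k = - (\<Sum>n. ?a n)"
    have l1: "bounded_linear (T 1)" and l0: "bounded_linear (T 0)" using lin by auto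
    have "exp r *\<^sub>R T 1 (\<Sum>n. ?a n) = (\<Sum>n. exp r *\<^sub>R T 1 (?a n))"
      using bounded_linear.suminf[OF l1 sm] bounded_linear.summable[OF l1 sm]
      by (simp add: suminf_scaleR_right)
    also have "\<dots> = (\<Sum>n. ?a (Suc n))"
    proof (rule suminf_cong)
      fix n
      show "exp r *\<^sub>R T 1 (?a n) = ?a (Suc n)"
        using add[of 1 "real n" h] by (simp add: T_scale mult_exp_exp algebra_simps)
    qed
    also have "\<dots> = (\<Sum>n. ?a n) - ?a 0"
      by (rule suminf_split_head[OF sm])
    finally have k1: "exp r *\<^sub>R T 1 k - k = h"
      using h linear_neg[OF bounded_linear.linear[OF l1], of "\<Sum>n. ?a n"] by (simp add: k_def)
    have "T 0 (\<Sum>n. ?a n) = (\<Sum>n. ?a n)"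
      using bounded_linear.suminf[OF l0 sm] by (simp add: T_scale T0)
    then have k0: "T 0 k = k"
      using linear_neg[OF bounded_linear.linear[OF l0], of "\<Sum>n. ?a n"] by (simp add: k_def)
    have "gen (orbit_integral r k 1) (h - r *\<^sub>R orbit_integral r k 1)"
      using gen_orbit_integral[of 1 r k] k1 k0 by simp
    then show ?thesis
      by (intro exI[of _ "orbit_integral r k 1"] exI[of _ "h - r *\<^sub>R orbit_integral r k 1"]) simp
  qed
  moreover have "f = 0" if "gen f g" "r *\<^sub>R f + g = 0" for f g
    using lower[OF that(1)] that(2) by simp
  ultimately show ?thesis
    unfolding regular_def using lower by blast
qed

text \<open>The growth rate is an approximate eigenvalue: if \<open>f\<close> nearly attains the norm of $T(t)$, then
  \<open>f\<close> is nearly an eigenvector of $T(t)$ with top eigenvalue \<open>onorm (T t)\<close>, and averaging it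
  along the orbit gives an element of the domain of the generator.\<close>

lemma growth_rate_singular:
  assumes t: "t > 0" and rho: "onorm (T t) > 0"
  shows "\<not> regular (- ln (onorm (T t)) / t)"
proof
  let ?\<rho> = "onorm (T t)"
  define \<mu> where "\<mu> = - ln ?\<rho> / t"
  assume "regular (- ln ?\<rho> / t)"
  then obtain C where C: "\<And>f g. gen f g \<Longrightarrow> norm f \<le> C * norm (\<mu> *\<^sub>R f + g)"
    unfolding regular_def \<mu>_def by blast
  have bl: "bounded_linear (T t)" using lin t by auto
  have rho1: "?\<rho> \<le> 1"
    using contraction[of t] t by (intro onorm_bound) auto
  have lam: "\<mu> \<ge> 0" using rho rho1 t by (simp add: \<mu>_def divide_nonpos_pos)
  have e\<mu>: "exp (\<mu> * t) = inverse ?\<rho>"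
    using t rho by (simp add: \<mu>_def exp_minus)
  have half_norm: "(norm (T (t/2) f))\<^sup>2 \<le> ?\<rho> * (norm f)\<^sup>2" for f
  proof -
    have "(norm (T (t/2) f))\<^sup>2 = T t f \<bullet> f" using half t by simp
    also have "\<dots> \<le> norm (T t f) * norm f" by (rule norm_cauchy_schwarz)
    also have "\<dots> \<le> (?\<rho> * norm f) * norm f" by (intro mult_right_mono onorm[OF bl]) auto
    finally show ?thesis by (simp add: power2_eq_square mult.assoc)
  qed
  have key: "t * ?\<rho> * (1 - \<delta>)\<^sup>2 \<le> \<bar>C\<bar> * sqrt (2 * \<delta>)" if \<delta>: "0 < \<delta>" "\<delta> < 1" for \<delta>
  proof -
    have "\<exists>f. norm (T t f) > (1 - \<delta>) * ?\<rho> * norm f"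
    proof (rule ccontr)
      assume "\<not> ?thesis"
      then have "?\<rho> \<le> (1 - \<delta>) * ?\<rho>"
        using \<delta> rho by (intro onorm_bound) (auto simp: not_less)
      then show False using mult_pos_pos[OF \<delta>(1) rho] by (simp add: left_diff_distrib)
    qed
    then obtain f0 where f0: "norm (T t f0) > (1 - \<delta>) * ?\<rho> * norm f0" by blast
    define f where "f = T 0 f0"
    have f: "T 0 f = f" "norm (T t f) \<ge> (1 - \<delta>) * ?\<rho> * norm f" "f \<noteq> 0"
    proof -
      show "T 0 f = f" by (simp add: f_def T0)
      have "(1 - \<delta>) * ?\<rho> * norm f \<le> (1 - \<delta>) * ?\<rho> * norm f0"
        unfolding f_def using \<delta> rho by (intro mult_left_mono contraction) auto
      then show "norm (T t f) \<ge> (1 - \<delta>) * ?\<rho> * norm f"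
        using f0 t by (simp add: f_def T0)
      have "0 \<le> (1 - \<delta>) * ?\<rho> * norm f0" using \<delta> rho by simp
      then have "T t f \<noteq> 0" using f0 t by (auto simp: f_def T0)
      then show "f \<noteq> 0" using linear_0[OF bounded_linear.linear[OF bl]] by auto
    qed
    define S where "S = T t f /\<^sub>R ?\<rho>"
    have normS: "norm S \<ge> (1 - \<delta>) * norm f"
      using f(2) rho by (simp add: S_def field_simps)
    have "(norm (T t f))\<^sup>2 \<le> ?\<rho> * (T t f \<bullet> f)"
      using half_norm[of "T (t/2) f"] half[of t f] add[of "t/2" "t/2" f] t by simp
    then have S2: "(norm S)\<^sup>2 \<le> S \<bullet> f"
      using rho by (simp add: S_def power_mult_distrib power2_eq_square[of ?\<rho>] field_simps)
    have normS2: "((1 - \<delta>) * norm f)\<^sup>2 \<le> (norm S)\<^sup>2"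
      using normS \<delta> by (intro power_mono) auto
    have "(norm (S - f))\<^sup>2 = (norm f)\<^sup>2 - 2 * (S \<bullet> f) + (norm S)\<^sup>2"
      by (simp add: power2_norm_eq_inner inner_diff_left inner_diff_right inner_commute)
    also have "\<dots> \<le> (norm f)\<^sup>2 - ((1 - \<delta>) * norm f)\<^sup>2"
      using S2 normS2 by linarith
    also have "\<dots> \<le> 2 * \<delta> * (norm f)\<^sup>2"
    proof -
      have "(norm f)\<^sup>2 - ((1 - \<delta>) * norm f)\<^sup>2 = (2 * \<delta> - \<delta>\<^sup>2) * (norm f)\<^sup>2"
        by (simp add: power_mult_distrib power2_eq_square algebra_simps)
      then show ?thesis by (simp add: mult_right_mono)
    qed
    also have "\<dots> = (sqrt (2 * \<delta>) * norm f)\<^sup>2"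
      using \<delta> by (simp add: power_mult_distrib)
    finally have Sf: "norm (S - f) \<le> sqrt (2 * \<delta>) * norm f"
      by (rule power2_le_imp_le) (use \<delta> in simp)
    let ?G = "orbit_integral \<mu> f t"
    have "norm ?G \<le> C * norm (S - f)"
      using C[OF gen_orbit_integral[of t \<mu> f]] t f(1) by (simp add: e\<mu> S_def)
    also have "\<dots> \<le> \<bar>C\<bar> * (sqrt (2 * \<delta>) * norm f)"
      using Sf by (intro mult_mono) auto
    finally have G: "norm ?G \<le> \<bar>C\<bar> * (sqrt (2 * \<delta>) * norm f)" .
    have "t * (T t f \<bullet> f) \<le> ?G \<bullet> f"
    proof -
      have int: "(\<lambda>s. exp (\<mu> * s) *\<^sub>R T s f) integrable_on {0..t}"
        by (rule integrable_continuous_real[OF twisted_continuous])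
      have "?G \<bullet> f = integral {0..t} ((\<lambda>x. x \<bullet> f) \<circ> (\<lambda>s. exp (\<mu> * s) *\<^sub>R T s f))"
        unfolding orbit_integral_def by (rule integral_linear[OF int bounded_linear_inner_left, symmetric])
      also have "\<dots> \<ge> integral {0..t} (\<lambda>s. T t f \<bullet> f)"
      proof (rule integral_le)
        show "(\<lambda>x. x \<bullet> f) \<circ> (\<lambda>s. exp (\<mu> * s) *\<^sub>R T s f) integrable_on {0..t}"
          by (rule integrable_linear[OF int bounded_linear_inner_left])
        fix s assume s: "s \<in> {0..t}"
        have "norm (T (t/2) f) \<le> norm (T (s/2) f)"
          using add[of "(t-s)/2" "s/2" f] contraction[of "(t-s)/2" "T (s/2) f"] s
          by (simp add: diff_divide_distrib)
        then have "T t f \<bullet> f \<le> T s f \<bullet> f"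
          using half[of t f] half[of s f] t s by (auto intro: power_mono)
        also have "\<dots> \<le> exp (\<mu> * s) * (T s f \<bullet> f)"
        proof -
          have "1 \<le> exp (\<mu> * s)" using lam s by simp
          moreover have "0 \<le> T s f \<bullet> f" using half[of s f] s by simp
          ultimately show ?thesis by (metis mult_1 mult_right_mono)
        qed
        finally show "T t f \<bullet> f \<le> ((\<lambda>x. x \<bullet> f) \<circ> (\<lambda>s. exp (\<mu> * s) *\<^sub>R T s f)) s"
          by simp
      qed (rule integrable_const_ivl)
      finally show ?thesis using t by simp
    qed
    also have "\<dots> \<le> norm ?G * norm f" by (rule norm_cauchy_schwarz)
    also have "\<dots> \<le> \<bar>C\<bar> * (sqrt (2 * \<delta>) * norm f) * norm f"
      using G by (rule mult_right_mono) simp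
    finally have "t * (T t f \<bullet> f) \<le> \<bar>C\<bar> * sqrt (2 * \<delta>) * (norm f)\<^sup>2"
      by (simp add: power2_eq_square mult.assoc)
    moreover have "?\<rho> * ((1 - \<delta>)\<^sup>2 * (norm f)\<^sup>2) \<le> T t f \<bullet> f"
    proof -
      have "T t f \<bullet> f = ?\<rho> * (S \<bullet> f)" using rho by (simp add: S_def)
      then show ?thesis
        using S2 normS2 rho by (simp add: power_mult_distrib)
    qed
    then have "t * (?\<rho> * ((1 - \<delta>)\<^sup>2 * (norm f)\<^sup>2)) \<le> t * (T t f \<bullet> f)"
      using t by (intro mult_left_mono) auto
    ultimately have "(t * ?\<rho> * (1 - \<delta>)\<^sup>2) * (norm f)\<^sup>2 \<le> (\<bar>C\<bar> * sqrt (2 * \<delta>)) * (norm f)\<^sup>2"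
      by (simp add: mult.assoc)
    then show ?thesis using f(3) by simp
  qed
  have "t * ?\<rho> * (1 - 0)\<^sup>2 \<le> \<bar>C\<bar> * sqrt (2 * 0)"
  proof (rule tendsto_le[of "at_right (0::real)"])
    show "((\<lambda>\<delta>. t * ?\<rho> * (1 - \<delta>)\<^sup>2) \<longlongrightarrow> t * ?\<rho> * (1 - 0)\<^sup>2) (at_right 0)"
      by (intro tendsto_intros)
    show "((\<lambda>\<delta>. \<bar>C\<bar> * sqrt (2 * \<delta>)) \<longlongrightarrow> \<bar>C\<bar> * sqrt (2 * 0)) (at_right 0)"
      by (intro tendsto_intros)
    show "\<forall>\<^sub>F \<delta> in at_right 0. t * ?\<rho> * (1 - \<delta>)\<^sup>2 \<le> \<bar>C\<bar> * sqrt (2 * \<delta>)"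
      unfolding eventually_at_right_field by (intro exI[of _ 1]) (auto intro: key)
  qed simp
  then show False using t rho by (simp add: mult_le_0_iff)
qed

lemma spectral_bound:
  assumes E: "E = Inf {r. \<not> regular r}" and t: "t \<ge> 0"
  shows "norm (T t f) \<le> exp (- E * t) * norm f"
proof (cases "t = 0 \<or> onorm (T t) = 0")
  case True
  then show ?thesis
  proof
    assume "t = 0" then show ?thesis using contraction[of 0 f] by simp
  next
    assume "onorm (T t) = 0"
    then have "T t f = 0" using onorm[OF lin[OF t], of f] by simp
    then show ?thesis by simp
  qed
next
  case False
  then have t: "t > 0" and rho: "onorm (T t) > 0"
    using t onorm_pos_le[OF lin[OF t]] by auto
  let ?\<mu> = "- ln (onorm (T t)) / t"
  have "bdd_below {r. \<not> regular r}"
    using regular_negative by (intro bdd_belowI[of _ 0]) (auto simp: not_less[symmetric])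
  then have "E \<le> ?\<mu>"
    unfolding E using growth_rate_singular[OF t rho] by (intro cInf_lower) auto
  then have "ln (onorm (T t)) \<le> - E * t"
    using t by (simp add: field_simps)
  then have "onorm (T t) \<le> exp (- E * t)"
    using rho by (metis exp_le_cancel_iff exp_ln)
  then show ?thesis
    using onorm[OF lin, of t f] t by (meson less_imp_le mult_right_mono norm_ge_zero order_trans)
qed

end

section \<open>The Gaussian kernel\<close>

lemma heat_kernel_nonneg [simp]: "0 \<le> heat_kernel t x"
  by (simp add: heat_kernel_def)

lemma heat_kernel_pos: "t > 0 \<Longrightarrow> 0 < heat_kernel t x"
  by (simp add: heat_kernel_def)

lemma heat_kernel_minus: "heat_kernel t (- x) = heat_kernel t x"
  by (simp add: heat_kernel_def)

lemma heat_kernel_measurable [measurable]: "heat_kernel t \<in> borel_measurable borel"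
  unfolding heat_kernel_def[abs_def] by measurable

lemma heat_kernel_le:
  fixes x :: "'a::euclidean_space"
  assumes "t > 0"
  shows "heat_kernel t x \<le> (4 * pi * t) powr (- (real DIM('a) / 2))"
  unfolding heat_kernel_def using assms by (intro mult_left_le) auto

lemma nn_integral_normal_density:
  assumes "\<sigma> > 0"
  shows "(\<integral>\<^sup>+x. ennreal (normal_density \<mu> \<sigma> x) \<partial>lborel) = 1"
proof -
  interpret prob_space "density lborel (normal_density \<mu> \<sigma>)"
    by (rule prob_space_normal_density[OF assms])
  show ?thesis
    using emeasure_space_1 by (simp add: emeasure_density)
qed

lemma nn_integral_heat_kernel_exp:
  fixes \<xi> :: "'a::euclidean_space"
  assumes t: "t > 0"
  shows "(\<integral>\<^sup>+x. ennreal (heat_kernel t x * exp (\<xi> \<bullet> x)) \<partial>lborel) = ennreal (exp (t * (norm \<xi>)\<^sup>2))"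
proof -
  let ?f = "\<lambda>b x. ennreal (exp (t * (\<xi> \<bullet> b)\<^sup>2)) * ennreal (normal_density (2 * t * (\<xi> \<bullet> b)) (sqrt (2 * t)) x)"
  have one: "(4 * pi * t) powr (- (1 / 2)) * exp (- (y\<^sup>2 / (4 * t)) + c * y)
     = exp (t * c\<^sup>2) * normal_density (2 * t * c) (sqrt (2 * t)) y" for y c :: real
  proof -
    have "(4 * pi * t) powr (- (1 / 2)) = 1 / sqrt (2 * pi * (sqrt (2 * t))\<^sup>2)"
      using t by (simp add: powr_minus_divide powr_half_sqrt)
    moreover have "- (y\<^sup>2 / (4 * t)) + c * y = t * c\<^sup>2 + (- (y - 2 * t * c)\<^sup>2 / (2 * (sqrt (2 * t))\<^sup>2))"
      using t by (simp add: field_simps power2_eq_square)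
    ultimately show ?thesis
      by (simp only: normal_density_def exp_add mult_ac)
  qed
  have "ennreal (heat_kernel t x * exp (\<xi> \<bullet> x)) = (\<Prod>b\<in>Basis. ?f b (x \<bullet> b))" for x :: 'a
  proof -
    have "heat_kernel t x * exp (\<xi> \<bullet> x) =
       (\<Prod>b\<in>(Basis :: 'a set). (4 * pi * t) powr (- (1 / 2))) * exp (\<Sum>b\<in>Basis. - ((x \<bullet> b)\<^sup>2 / (4 * t)) + (\<xi> \<bullet> b) * (x \<bullet> b))"
    proof -
      have "(norm x)\<^sup>2 = (\<Sum>b\<in>Basis. (x \<bullet> b)\<^sup>2)" for x :: 'a
        by (simp only: power2_norm_eq_inner euclidean_inner[of x x]) (simp only: power2_eq_square)
      moreover have "\<xi> \<bullet> x = (\<Sum>b\<in>Basis. (\<xi> \<bullet> b) * (x \<bullet> b))"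
        by (rule euclidean_inner)
      moreover have "(\<Prod>b\<in>(Basis :: 'a set). (4 * pi * t) powr (- (1 / 2))) = (4 * pi * t) powr (- (real DIM('a) / 2))"
        using t by (simp add: powr_power)
      ultimately show ?thesis
        by (simp add: heat_kernel_def sum.distrib sum_negf sum_subtractf exp_add[symmetric] sum_divide_distrib mult.assoc)
    qed
    also have "\<dots> = (\<Prod>b\<in>Basis. (4 * pi * t) powr (- (1 / 2)) * exp (- ((x \<bullet> b)\<^sup>2 / (4 * t)) + (\<xi> \<bullet> b) * (x \<bullet> b)))"
      by (simp add: exp_sum prod.distrib)
    also have "\<dots> = (\<Prod>b\<in>Basis. exp (t * (\<xi> \<bullet> b)\<^sup>2) * normal_density (2 * t * (\<xi> \<bullet> b)) (sqrt (2 * t)) (x \<bullet> b))"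
      by (simp only: one)
    finally show ?thesis
      by (simp add: prod_ennreal[symmetric] ennreal_mult)
  qed
  then have "(\<integral>\<^sup>+x. ennreal (heat_kernel t x * exp (\<xi> \<bullet> x)) \<partial>lborel) = (\<integral>\<^sup>+(x::'a). (\<Prod>b\<in>Basis. ?f b (x \<bullet> b)) \<partial>lborel)"
    by simp
  also have "\<dots> = (\<Prod>b\<in>(Basis :: 'a set). (\<integral>\<^sup>+x. ?f b x \<partial>lborel))"
    by (rule nn_integral_lborel_prod) auto
  also have "\<dots> = (\<Prod>b\<in>(Basis :: 'a set). ennreal (exp (t * (\<xi> \<bullet> b)\<^sup>2)))"
    using t by (simp add: nn_integral_cmult nn_integral_normal_density)
  also have "\<dots> = ennreal (exp (\<Sum>b\<in>Basis. t * (\<xi> \<bullet> b)\<^sup>2))"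
    by (simp add: prod_ennreal exp_sum)
  also have "(\<Sum>b\<in>Basis. t * (\<xi> \<bullet> b)\<^sup>2) = t * (norm \<xi>)\<^sup>2"
    by (simp only: power2_norm_eq_inner euclidean_inner[of \<xi> \<xi>] sum_distrib_left) (simp only: power2_eq_square)
  finally show ?thesis .
qed

lemma nn_integral_heat_kernel:
  assumes "t > 0"
  shows "(\<integral>\<^sup>+x. ennreal (heat_kernel t x) \<partial>(lborel :: 'a::euclidean_space measure)) = 1"
  using nn_integral_heat_kernel_exp[OF assms, of "0::'a"] by simp

lemma nn_integral_translate:
  fixes y :: "'a::euclidean_space"
  assumes [measurable]: "f \<in> borel_measurable borel"
  shows "(\<integral>\<^sup>+x. f (x - y) \<partial>lborel) = (\<integral>\<^sup>+x. f x \<partial>lborel)"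
proof -
  have "(\<integral>\<^sup>+x. f x \<partial>lborel) = (\<integral>\<^sup>+x. f x \<partial>distr lborel borel ((+) (- y)))"
    by (simp add: lborel_distr_plus)
  also have "\<dots> = (\<integral>\<^sup>+x. f (x - y) \<partial>lborel)"
    by (subst nn_integral_distr) auto
  finally show ?thesis by simp
qed

lemma ennreal_half_sum:
  assumes "0 \<le> a" "0 \<le> b"
  shows "ennreal (1 / 2) * (ennreal a + ennreal b) = ennreal (1 / 2 * (a + b))"
  using assms by (subst ennreal_mult) (simp_all add: ennreal_plus)

lemma nn_integral_heat_kernel_cosh:
  fixes \<xi> :: "'a::euclidean_space"
  assumes t: "t > 0"
  shows "(\<integral>\<^sup>+x. ennreal (heat_kernel t x * (cosh (\<xi> \<bullet> x) - 1)) \<partial>lborel) = ennreal (exp (t * (norm \<xi>)\<^sup>2) - 1)"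
proof -
  have c1: "cosh y \<ge> (1::real)" for y by (rule cosh_real_ge_1)
  have "ennreal (exp (t * (norm \<xi>)\<^sup>2)) = ennreal (1/2) * ((\<integral>\<^sup>+x. ennreal (heat_kernel t x * exp (\<xi> \<bullet> x)) \<partial>lborel) + (\<integral>\<^sup>+x. ennreal (heat_kernel t x * exp ((- \<xi>) \<bullet> x)) \<partial>lborel))"
    unfolding nn_integral_heat_kernel_exp[OF t]
    by (subst ennreal_half_sum) auto
  also have "\<dots> = (\<integral>\<^sup>+x. ennreal (1/2) * (ennreal (heat_kernel t x * exp (\<xi> \<bullet> x)) + ennreal (heat_kernel t x * exp ((- \<xi>) \<bullet> x))) \<partial>lborel)"
    by (simp add: nn_integral_add nn_integral_cmult)
  also have "\<dots> = (\<integral>\<^sup>+x. ennreal (heat_kernel t x * (cosh (\<xi> \<bullet> x) - 1)) + ennreal (heat_kernel t x) \<partial>lborel)"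
  proof (rule nn_integral_cong)
    fix x
    show "ennreal (1/2) * (ennreal (heat_kernel t x * exp (\<xi> \<bullet> x)) + ennreal (heat_kernel t x * exp ((- \<xi>) \<bullet> x)))
        = ennreal (heat_kernel t x * (cosh (\<xi> \<bullet> x) - 1)) + ennreal (heat_kernel t x)"
    proof -
      have "1/2 * (heat_kernel t x * exp (\<xi> \<bullet> x) + heat_kernel t x * exp ((- \<xi>) \<bullet> x))
          = heat_kernel t x * (cosh (\<xi> \<bullet> x) - 1) + heat_kernel t x"
        by (simp add: cosh_def algebra_simps)
      then have "ennreal (1/2) * (ennreal (heat_kernel t x * exp (\<xi> \<bullet> x)) + ennreal (heat_kernel t x * exp ((- \<xi>) \<bullet> x)))
          = ennreal (heat_kernel t x * (cosh (\<xi> \<bullet> x) - 1) + heat_kernel t x)"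
        by (subst ennreal_half_sum) (simp_all only: heat_kernel_nonneg exp_ge_zero mult_nonneg_nonneg)
      also have "\<dots> = ennreal (heat_kernel t x * (cosh (\<xi> \<bullet> x) - 1)) + ennreal (heat_kernel t x)"
        using c1[of "\<xi> \<bullet> x"] by (intro ennreal_plus) auto
      finally show ?thesis .
    qed
  qed
  also have "\<dots> = (\<integral>\<^sup>+x. ennreal (heat_kernel t x * (cosh (\<xi> \<bullet> x) - 1)) \<partial>lborel) + 1"
    using nn_integral_heat_kernel[OF t] by (subst nn_integral_add) (auto simp: cosh_def)
  finally have "(\<integral>\<^sup>+x. ennreal (heat_kernel t x * (cosh (\<xi> \<bullet> x) - 1)) \<partial>lborel) + 1 = ennreal (exp (t * (norm \<xi>)\<^sup>2) - 1) + 1"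
    using t by (simp flip: ennreal_1 ennreal_plus)
  then show ?thesis
    by (metis ennreal_add_left_cancel add.commute ennreal_one_neq_top infinity_ennreal_def)
qed

lemma heat_kernel_product:
  fixes x y y' :: "'a::euclidean_space"
  assumes s: "s > 0"
  shows "heat_kernel s (x - y) * heat_kernel s (x - y') =
    heat_kernel (2 * s) (y - y') * heat_kernel (s / 2) (x - (1/2) *\<^sub>R (y + y'))"
proof -
  let ?m = "(1/2) *\<^sub>R (y + y')" and ?a = "- (real DIM('a) / 2)"
  have "(norm (x - y))\<^sup>2 + (norm (x - y'))\<^sup>2 = 2 * (norm (x - ?m))\<^sup>2 + (norm (y - y'))\<^sup>2 / 2"
    by (simp add: power2_norm_eq_inner inner_diff_left inner_diff_right inner_add_left inner_add_right inner_commute field_simps)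
  then have "- (((norm (x - y))\<^sup>2 + (norm (x - y'))\<^sup>2) / (4 * s)) = - ((2 * (norm (x - ?m))\<^sup>2 + (norm (y - y'))\<^sup>2 / 2) / (4 * s))"
    by (rule arg_cong)
  then   have e: "- ((norm (x - y))\<^sup>2 / (4 * s)) + - ((norm (x - y'))\<^sup>2 / (4 * s))
      = - ((norm (y - y'))\<^sup>2 / (4 * (2 * s))) + - ((norm (x - ?m))\<^sup>2 / (4 * (s / 2)))"
    by (simp add: add_divide_distrib mult.commute)
  have p: "(4 * pi * s) powr ?a * (4 * pi * s) powr ?a = (4 * pi * (2 * s)) powr ?a * (4 * pi * (s / 2)) powr ?a"
    using s by (simp add: powr_mult[symmetric] mult_ac)
  have "heat_kernel s (x - y) * heat_kernel s (x - y') = ((4 * pi * s) powr ?a * (4 * pi * s) powr ?a) *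
      exp (- ((norm (x - y))\<^sup>2 / (4 * s)) + - ((norm (x - y'))\<^sup>2 / (4 * s)))"
    by (simp only: heat_kernel_def exp_add mult_ac)
  also have "\<dots> = heat_kernel (2 * s) (y - y') * heat_kernel (s / 2) (x - ?m)"
    unfolding e p by (simp only: heat_kernel_def exp_add mult_ac)
  finally show ?thesis .
qed

lemma nn_integral_heat_kernel_product_le:
  fixes \<xi> y y' :: "'a::euclidean_space"
  assumes s: "s > 0"
  shows "(\<integral>\<^sup>+x. ennreal (exp (2 * (\<xi> \<bullet> x)) * (heat_kernel s (x - y) * heat_kernel s (x - y'))) \<partial>lborel)
    \<le> ennreal ((8 * pi * s) powr (- (real DIM('a) / 2)) * exp (2 * s * (norm \<xi>)\<^sup>2) * (exp (\<xi> \<bullet> y) * exp (\<xi> \<bullet> y')))"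
proof -
  let ?m = "(1/2) *\<^sub>R (y + y')"
  let ?c = "heat_kernel (2 * s) (y - y') * exp (2 * (\<xi> \<bullet> ?m))"
  have "exp (2 * (\<xi> \<bullet> x)) * (heat_kernel s (x - y) * heat_kernel s (x - y'))
     = ?c * (heat_kernel (s / 2) (x - ?m) * exp ((2 *\<^sub>R \<xi>) \<bullet> (x - ?m)))" for x
    unfolding heat_kernel_product[OF s]
    by (simp add: inner_diff_right exp_diff field_simps)
  then have "(\<integral>\<^sup>+x. ennreal (exp (2 * (\<xi> \<bullet> x)) * (heat_kernel s (x - y) * heat_kernel s (x - y'))) \<partial>lborel)
    = (\<integral>\<^sup>+x. ennreal ?c * ennreal (heat_kernel (s / 2) (x - ?m) * exp ((2 *\<^sub>R \<xi>) \<bullet> (x - ?m))) \<partial>lborel)"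
    by (simp add: ennreal_mult)
  also have "\<dots> = ennreal ?c * (\<integral>\<^sup>+x. ennreal (heat_kernel (s / 2) (x - ?m) * exp ((2 *\<^sub>R \<xi>) \<bullet> (x - ?m))) \<partial>lborel)"
    by (rule nn_integral_cmult) measurable
  also have "(\<integral>\<^sup>+x. ennreal (heat_kernel (s / 2) (x - ?m) * exp ((2 *\<^sub>R \<xi>) \<bullet> (x - ?m))) \<partial>lborel)
      = ennreal (exp (s / 2 * (norm (2 *\<^sub>R \<xi>))\<^sup>2))"
    by (subst nn_integral_translate[where f = "\<lambda>x. ennreal (heat_kernel (s / 2) x * exp ((2 *\<^sub>R \<xi>) \<bullet> x))"])
      (use nn_integral_heat_kernel_exp[of "s/2" "2 *\<^sub>R \<xi>"] s in auto)
  also have "ennreal ?c * \<dots> = ennreal (?c * exp (2 * s * (norm \<xi>)\<^sup>2))"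
    by (simp add: ennreal_mult power_mult_distrib mult_ac)
  also have "\<dots> \<le> ennreal ((8 * pi * s) powr (- (real DIM('a) / 2)) * exp (2 * s * (norm \<xi>)\<^sup>2) * (exp (\<xi> \<bullet> y) * exp (\<xi> \<bullet> y')))"
  proof (rule ennreal_leI)
    have "heat_kernel (2 * s) (y - y') \<le> (8 * pi * s) powr (- (real DIM('a) / 2))"
      using heat_kernel_le[of "2 * s" "y - y'"] s by (simp add: mult_ac)
    moreover have "exp (2 * (\<xi> \<bullet> ?m)) = exp (\<xi> \<bullet> y) * exp (\<xi> \<bullet> y')"
    proof -
      have "2 * (\<xi> \<bullet> ?m) = \<xi> \<bullet> y + \<xi> \<bullet> y'"
        by (simp add: inner_add_right)
      then show ?thesis by (simp only: exp_add)
    qed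
    ultimately show "?c * exp (2 * s * (norm \<xi>)\<^sup>2) \<le> (8 * pi * s) powr (- (real DIM('a) / 2)) * exp (2 * s * (norm \<xi>)\<^sup>2) * (exp (\<xi> \<bullet> y) * exp (\<xi> \<bullet> y'))"
      by (simp add: mult_ac mult_left_mono)
  qed
  finally show ?thesis .
qed

lemma nn_integral_convolution_le:
  fixes k :: "'a::euclidean_space \<Rightarrow> real" and a b :: "'a \<Rightarrow> real"
  assumes [measurable]: "k \<in> borel_measurable borel" "a \<in> borel_measurable borel" "b \<in> borel_measurable borel"
    and k: "\<And>z. 0 \<le> k z" "\<And>z. k (- z) = k z"
    and a: "\<And>x. 0 \<le> a x" and b: "\<And>x. 0 \<le> b x"
  shows "(\<integral>\<^sup>+x. \<integral>\<^sup>+y. ennreal (k (x - y) * (a x * b y)) \<partial>lborel \<partial>lborel)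
    \<le> ennreal (1/2) * (\<integral>\<^sup>+z. k z \<partial>lborel) * ((\<integral>\<^sup>+x. (a x)\<^sup>2 \<partial>lborel) + (\<integral>\<^sup>+x. (b x)\<^sup>2 \<partial>lborel))"
proof -
  let ?\<kappa> = "\<integral>\<^sup>+z. k z \<partial>lborel"
  have tr: "(\<integral>\<^sup>+y. k (y - x) \<partial>lborel) = ?\<kappa>" for x
    by (rule nn_integral_translate[where f = "\<lambda>x. ennreal (k x)"]) simp
  have tr': "(\<integral>\<^sup>+y. k (x - y) \<partial>lborel) = ?\<kappa>" for x
  proof -
    have "k (x - y) = k (y - x)" for y
      using k(2)[of "x - y"] by simp
    then show ?thesis using tr[of x] by (simp only:)
  qed
  have ptw: "ennreal (k (x - y) * (a x * b y)) \<le> ennreal (1/2) * (ennreal (k (x - y)) * ennreal ((a x)\<^sup>2) + ennreal (k (x - y)) * ennreal ((b y)\<^sup>2))" for x y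
  proof -
    have "0 \<le> (a x - b y)\<^sup>2" by simp
    then have "a x * b y \<le> 1/2 * ((a x)\<^sup>2 + (b y)\<^sup>2)"
      by (simp add: power2_eq_square algebra_simps)
    then have "k (x - y) * (a x * b y) \<le> k (x - y) * (1/2 * ((a x)\<^sup>2 + (b y)\<^sup>2))"
      using k by (intro mult_left_mono)
    then have "ennreal (k (x - y) * (a x * b y)) \<le> ennreal (1/2 * (k (x - y) * (a x)\<^sup>2 + k (x - y) * (b y)\<^sup>2))"
      by (intro ennreal_leI) (simp add: algebra_simps)
    also have "\<dots> = ennreal (1/2) * (ennreal (k (x - y)) * ennreal ((a x)\<^sup>2) + ennreal (k (x - y)) * ennreal ((b y)\<^sup>2))"
      using k by (subst ennreal_half_sum[symmetric]) (simp_all add: ennreal_mult)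
    finally show ?thesis .
  qed
  have "(\<integral>\<^sup>+x. \<integral>\<^sup>+y. ennreal (k (x - y) * (a x * b y)) \<partial>lborel \<partial>lborel)
    \<le> (\<integral>\<^sup>+x. \<integral>\<^sup>+y. ennreal (1/2) * (ennreal (k (x - y)) * ennreal ((a x)\<^sup>2) + ennreal (k (x - y)) * ennreal ((b y)\<^sup>2)) \<partial>lborel \<partial>lborel)"
    by (intro nn_integral_mono ptw)
  also have "\<dots> = ennreal (1/2) * ((\<integral>\<^sup>+x. \<integral>\<^sup>+y. ennreal (k (x - y)) * ennreal ((a x)\<^sup>2) \<partial>lborel \<partial>lborel)
      + (\<integral>\<^sup>+x. \<integral>\<^sup>+y. ennreal (k (x - y)) * ennreal ((b y)\<^sup>2) \<partial>lborel \<partial>lborel))"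
    by (simp add: nn_integral_cmult nn_integral_add)
  also have "(\<integral>\<^sup>+x. \<integral>\<^sup>+y. ennreal (k (x - y)) * ennreal ((a x)\<^sup>2) \<partial>lborel \<partial>lborel) = ?\<kappa> * (\<integral>\<^sup>+x. (a x)\<^sup>2 \<partial>lborel)"
    by (simp add: nn_integral_multc tr' nn_integral_cmult)
  also have "(\<integral>\<^sup>+x. \<integral>\<^sup>+y. ennreal (k (x - y)) * ennreal ((b y)\<^sup>2) \<partial>lborel \<partial>lborel)
     = (\<integral>\<^sup>+y. \<integral>\<^sup>+x. ennreal (k (x - y)) * ennreal ((b y)\<^sup>2) \<partial>lborel \<partial>lborel)"
    by (rule lborel_pair.Fubini') measurable
  also have "\<dots> = ?\<kappa> * (\<integral>\<^sup>+x. (b x)\<^sup>2 \<partial>lborel)"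
    by (simp add: nn_integral_multc tr nn_integral_cmult)
  finally show ?thesis by (simp add: algebra_simps)
qed

section \<open>Operators dominated by the heat semigroup are integral operators\<close>

lemma AE_lebesgue_iff: "(AE x in lebesgue. P x) \<longleftrightarrow> (AE x in lborel. P x)"
  by (rule AE_completion_iff)

lemma L2_measurable: "f \<in> L2 \<Omega> \<Longrightarrow> f \<in> borel_measurable lebesgue"
  and L2_integrable: "f \<in> L2 \<Omega> \<Longrightarrow> integrable lebesgue (\<lambda>x. (cmod (f x))\<^sup>2)"
  and L2_outside: "f \<in> L2 \<Omega> \<Longrightarrow> x \<notin> \<Omega> \<Longrightarrow> f x = 0"
  by (auto simp: L2_def)

lemma L2_mono: "\<Omega> \<subseteq> \<Omega>' \<Longrightarrow> L2 \<Omega> \<subseteq> L2 \<Omega>'"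
  by (auto simp: L2_def)

lemma L2_dominated:
  assumes g: "g \<in> L2 \<Omega>'" and f: "f \<in> borel_measurable lebesgue" "\<And>x. cmod (f x) \<le> C * cmod (g x)"
    "\<And>x. x \<notin> \<Omega> \<Longrightarrow> f x = 0"
  shows "f \<in> L2 \<Omega>"
proof -
  have [measurable]: "f \<in> borel_measurable lebesgue" by fact
  have "integrable lebesgue (\<lambda>x. (cmod (f x))\<^sup>2)"
  proof (rule Bochner_Integration.integrable_bound)
    show "integrable lebesgue (\<lambda>x. C\<^sup>2 * (cmod (g x))\<^sup>2)"
      using L2_integrable[OF g] by simp
    show "AE x in lebesgue. norm ((cmod (f x))\<^sup>2) \<le> norm (C\<^sup>2 * (cmod (g x))\<^sup>2)"
      using f(2) by (auto simp: power_mult_distrib[symmetric] intro!: power_mono)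
  qed measurable
  then show ?thesis
    using f by (auto simp: L2_def)
qed

lemma L2_add:
  assumes f: "f \<in> L2 \<Omega>" and g: "g \<in> L2 \<Omega>"
  shows "(\<lambda>x. f x + g x) \<in> L2 \<Omega>"
proof -
  note [measurable] = L2_measurable[OF f] L2_measurable[OF g]
  have "integrable lebesgue (\<lambda>x. (cmod (f x + g x))\<^sup>2)"
  proof (rule Bochner_Integration.integrable_bound)
    show "integrable lebesgue (\<lambda>x. 2 * (cmod (f x))\<^sup>2 + 2 * (cmod (g x))\<^sup>2)"
      using L2_integrable[OF f] L2_integrable[OF g] by simp
    show "AE x in lebesgue. norm ((cmod (f x + g x))\<^sup>2) \<le> norm (2 * (cmod (f x))\<^sup>2 + 2 * (cmod (g x))\<^sup>2)"
    proof (intro AE_I2)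
      fix x
      have "(cmod (f x + g x))\<^sup>2 \<le> (cmod (f x) + cmod (g x))\<^sup>2"
        by (intro power_mono norm_triangle_ineq) simp
      also have "\<dots> \<le> 2 * (cmod (f x))\<^sup>2 + 2 * (cmod (g x))\<^sup>2"
        using zero_le_power2[of "cmod (f x) - cmod (g x)"] by (simp add: power2_eq_square algebra_simps)
      finally show "norm ((cmod (f x + g x))\<^sup>2) \<le> norm (2 * (cmod (f x))\<^sup>2 + 2 * (cmod (g x))\<^sup>2)"
        by simp
    qed
  qed measurable
  then show ?thesis
    using L2_outside[OF f] L2_outside[OF g] by (auto simp: L2_def)
qed

lemma L2_scale: "f \<in> L2 \<Omega> \<Longrightarrow> (\<lambda>x. c * f x) \<in> L2 \<Omega>"
  by (rule L2_dominated[where C = "cmod c"]) (auto simp: norm_mult L2_outside dest: L2_measurable)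

lemma L2_zero: "(\<lambda>x. 0) \<in> L2 \<Omega>"
  by (simp add: L2_def)

lemma L2_diff: "f \<in> L2 \<Omega> \<Longrightarrow> g \<in> L2 \<Omega> \<Longrightarrow> (\<lambda>x. f x - g x) \<in> L2 \<Omega>"
  using L2_add[of f \<Omega> "\<lambda>x. - 1 * g x"] L2_scale[of g \<Omega> "- 1"] by simp

lemma L2_mult_integrable:
  assumes f: "f \<in> L2 \<Omega>" and g: "g \<in> L2 \<Omega>'"
  shows "integrable lebesgue (\<lambda>x. f x * g x)"
proof (rule Bochner_Integration.integrable_bound)
  show "integrable lebesgue (\<lambda>x. (cmod (f x))\<^sup>2 + (cmod (g x))\<^sup>2)"
    using L2_integrable[OF f] L2_integrable[OF g] by simp
  show "(\<lambda>x. f x * g x) \<in> borel_measurable lebesgue"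
    using L2_measurable[OF f] L2_measurable[OF g] by measurable
  show "AE x in lebesgue. norm (f x * g x) \<le> norm ((cmod (f x))\<^sup>2 + (cmod (g x))\<^sup>2)"
  proof (intro AE_I2)
    fix x
    have "cmod (f x) * cmod (g x) \<le> (cmod (f x))\<^sup>2 + (cmod (g x))\<^sup>2"
      using zero_le_power2[of "cmod (f x) - cmod (g x)"] zero_le_power2[of "cmod (f x)"] zero_le_power2[of "cmod (g x)"]
      unfolding power2_diff by linarith
    then show "norm (f x * g x) \<le> norm ((cmod (f x))\<^sup>2 + (cmod (g x))\<^sup>2)"
      by (simp add: norm_mult)
  qed
qed

lemma L2_cnj: "f \<in> L2 \<Omega> \<Longrightarrow> (\<lambda>x. cnj (f x)) \<in> L2 \<Omega>"
  by (rule L2_dominated[where C = 1]) (auto simp: L2_outside dest: L2_measurable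
    intro: measurable_compose[OF _ borel_measurable_continuous_onI[OF continuous_on_cnj[OF continuous_on_id]]])

lemma L2_borel_version:
  assumes "f \<in> borel_measurable lebesgue"
  obtains f' :: "'a::euclidean_space \<Rightarrow> complex" where "f' \<in> borel_measurable borel" "AE x in lborel. f x = f' x"
proof -
  have [measurable]: "f \<in> borel_measurable lebesgue" by fact
  have m: "(\<lambda>x. Re (f x)) \<in> borel_measurable lebesgue" "(\<lambda>x. Im (f x)) \<in> borel_measurable lebesgue"
    by measurable
  obtain u where [measurable]: "u \<in> borel_measurable lborel" and u: "AE x in lborel. Re (f x) = u x"
    using completion_ex_borel_measurable_real[OF m(1)] by auto
  obtain v where [measurable]: "v \<in> borel_measurable lborel" and v: "AE x in lborel. Im (f x) = v x"
    using completion_ex_borel_measurable_real[OF m(2)] by auto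
  show ?thesis
  proof
    have "(\<lambda>x. complex_of_real (u x) + \<i> * complex_of_real (v x)) \<in> borel_measurable lborel"
      by measurable
    then show "(\<lambda>x. complex_of_real (u x) + \<i> * complex_of_real (v x)) \<in> borel_measurable borel" by simp
    show "AE x in lborel. f x = complex_of_real (u x) + \<i> * complex_of_real (v x)"
      using u v by eventually_elim (simp add: complex_eq_iff)
  qed
qed

lemma L2_norm_nonneg: "0 \<le> L2_norm f"
  by (simp add: L2_norm_def)

lemma L2_norm_power2: "(L2_norm f)\<^sup>2 = (LINT x|lebesgue. (cmod (f x))\<^sup>2)"
  by (simp add: L2_norm_def)

lemma L2_norm_zero_iff:
  assumes "f \<in> L2 \<Omega>"
  shows "L2_norm f = 0 \<longleftrightarrow> L2_eq f (\<lambda>x. 0)"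
  using integral_nonneg_eq_0_iff_AE[OF L2_integrable[OF assms]]
  by (simp add: L2_norm_def L2_eq_def)

locale L2_operator =
  fixes \<Omega> :: "'a::euclidean_space set" and S :: "('a \<Rightarrow> complex) \<Rightarrow> 'a \<Rightarrow> complex"
  assumes op: "bounded_operator \<Omega> S"
begin

lemma S_in: "f \<in> L2 \<Omega> \<Longrightarrow> S f \<in> L2 \<Omega>"
  using op by (auto simp: bounded_operator_def)

lemma S_add: "f \<in> L2 \<Omega> \<Longrightarrow> g \<in> L2 \<Omega> \<Longrightarrow> AE x in lborel. S (\<lambda>x. f x + g x) x = S f x + S g x"
  using op by (auto simp: bounded_operator_def L2_eq_def AE_lebesgue_iff)

lemma S_scale: "f \<in> L2 \<Omega> \<Longrightarrow> AE x in lborel. S (\<lambda>x. c * f x) x = c * S f x"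
  using op by (auto simp: bounded_operator_def L2_eq_def AE_lebesgue_iff)

lemma S_bounded: "\<exists>C\<ge>0. \<forall>f\<in>L2 \<Omega>. L2_norm (S f) \<le> C * L2_norm f"
proof -
  obtain C where "\<forall>f\<in>L2 \<Omega>. L2_norm (S f) \<le> C * L2_norm f"
    using op by (auto simp: bounded_operator_def)
  moreover have "C * L2_norm f \<le> max 0 C * L2_norm f" for f :: "'a \<Rightarrow> complex"
    by (intro mult_right_mono) (auto simp: L2_norm_nonneg)
  ultimately show ?thesis
    by (intro exI[of _ "max 0 C"]) (auto intro: order_trans)
qed

lemma S_diff:
  assumes f: "f \<in> L2 \<Omega>" and g: "g \<in> L2 \<Omega>"
  shows "AE x in lborel. S (\<lambda>x. f x - g x) x = S f x - S g x"
  using S_add[OF f L2_scale[OF g, of "- 1"]] S_scale[OF g, of "- 1"]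
  by eventually_elim simp

lemma S_cong:
  assumes f: "f \<in> L2 \<Omega>" and g: "g \<in> L2 \<Omega>" and eq: "AE x in lborel. f x = g x"
  shows "AE x in lborel. S f x = S g x"
proof -
  let ?d = "\<lambda>x. f x - g x"
  have d: "?d \<in> L2 \<Omega>" using f g by (rule L2_diff)
  have "L2_norm ?d = 0"
    using eq by (subst L2_norm_zero_iff[OF d]) (auto simp: L2_eq_def AE_lebesgue_iff)
  moreover obtain C where "L2_norm (S ?d) \<le> C * L2_norm ?d"
    using S_bounded d by auto
  ultimately have "L2_norm (S ?d) = 0"
    using L2_norm_nonneg[of "S ?d"] by simp
  then have "AE x in lborel. S ?d x = 0"
    unfolding L2_norm_zero_iff[OF S_in[OF d]] by (simp add: L2_eq_def AE_lebesgue_iff)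
  then show ?thesis
    using S_diff[OF f g] by eventually_elim simp
qed

end

locale heat_dominated_operator = L2_operator \<Omega> S
  for \<Omega> :: "'a::euclidean_space set" and S +
  fixes t c :: real and \<Omega>' :: "'a set"
  assumes t: "t > 0"
    and c: "heat_kernel t (z :: 'a) \<le> c"
    and dom: "f \<in> L2 \<Omega> \<Longrightarrow> L2_le (\<lambda>x. 0) f \<Longrightarrow> L2_le (\<lambda>x. 0) (S f) \<and> L2_le (S f) (heat_semigroup t f)"
    and core: "\<Omega>' \<in> sets borel" and core_subset: "\<Omega>' \<subseteq> \<Omega>"
    and core_AE: "AE x in lborel. x \<in> \<Omega> \<longrightarrow> x \<in> \<Omega>'"
begin

lemma indicator_core [measurable]: "(indicator \<Omega>' :: 'a \<Rightarrow> real) \<in> borel_measurable borel"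
  by (rule borel_measurable_indicator[OF core])

text \<open>The weight makes the measure finite and \<open>w u\<close> square-integrable for bounded \<open>u\<close>.\<close>

abbreviation w :: "'a \<Rightarrow> real" where "w \<equiv> heat_kernel 1"

lemma c_nonneg: "0 \<le> c"
  using c[of 0] heat_kernel_nonneg[of t "0::'a"] by linarith

lemma w_integrable: "integrable lborel w"
  using nn_integral_heat_kernel[of 1, where 'a='a]
  by (intro integrableI_nonneg) auto

definition J :: "('a \<Rightarrow> real) \<Rightarrow> 'a \<Rightarrow> complex" where
  "J u x = complex_of_real (w x * u x * indicator \<Omega>' x)"

lemma J_measurable: "u \<in> borel_measurable borel \<Longrightarrow> J u \<in> borel_measurable borel"
  unfolding J_def[abs_def]
  by (rule measurable_compose[OF _ borel_measurable_of_real])  (intro borel_measurable_times indicator_core heat_kernel_measurable)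

lemma J_lebesgue_measurable: "u \<in> borel_measurable borel \<Longrightarrow> J u \<in> borel_measurable lebesgue"
  using J_measurable[of u] by (intro measurable_completion) simp

lemma J_outside: "x \<notin> \<Omega> \<Longrightarrow> J u x = 0"
  using core_subset by (auto simp: J_def indicator_def)

lemma J_bounded:
  assumes [measurable]: "u \<in> borel_measurable borel" and u: "\<And>x. \<bar>u x\<bar> \<le> C"
  shows "J u \<in> L2 \<Omega>"
proof -
  obtain D where D: "\<And>x. w x \<le> D" "D \<ge> 0"
    using heat_kernel_le[of 1, where 'a='a] by (metis powr_ge_zero zero_less_one)
  have "integrable lborel (\<lambda>x. (cmod (J u x))\<^sup>2)"
  proof (rule Bochner_Integration.integrable_bound)
    show "integrable lborel (\<lambda>x. D * C\<^sup>2 * w x)"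
      using w_integrable by simp
    show "AE x in lborel. norm ((cmod (J u x))\<^sup>2) \<le> norm (D * C\<^sup>2 * w x)"
    proof (intro AE_I2)
      fix x
      have "(cmod (J u x))\<^sup>2 \<le> w x * w x * \<bar>u x\<bar>\<^sup>2"
        by (cases "x \<in> \<Omega>'") (simp_all add: J_def norm_mult power_mult_distrib power2_eq_square[of "w x"])
      also have "\<dots> \<le> D * w x * C\<^sup>2"
        using u D by (intro mult_mono power_mono) auto
      finally show "norm ((cmod (J u x))\<^sup>2) \<le> norm (D * C\<^sup>2 * w x)"
        using D by (simp add: abs_mult mult_ac)
    qed
  qed (use J_measurable[OF assms(1)] in measurable)
  then have "integrable lebesgue (\<lambda>x. (cmod (J u x))\<^sup>2)"
    using J_measurable[OF assms(1)] by (subst integrable_completion) measurable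
  then show ?thesis
    using J_lebesgue_measurable[OF assms(1)] J_outside by (auto simp: L2_def)
qed

lemma J_dominated:
  assumes "J v \<in> L2 \<Omega>" and "u \<in> borel_measurable borel" "\<And>x. 0 \<le> u x" "\<And>x. u x \<le> v x"
  shows "J u \<in> L2 \<Omega>"
proof (rule L2_dominated[OF assms(1), where C = 1])
  fix x
  show "cmod (J u x) \<le> 1 * cmod (J v x)"
    using assms(3,4)[of x] by (auto simp: J_def norm_mult intro!: mult_mono split: split_indicator)
qed (use assms in \<open>auto simp: J_outside intro: J_lebesgue_measurable\<close>)

lemma J_add: "J (\<lambda>x. u x + v x) = (\<lambda>x. J u x + J v x)"
  by (auto simp: J_def fun_eq_iff algebra_simps)

lemma J_diff: "J (\<lambda>x. u x - v x) = (\<lambda>x. J u x - J v x)"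
  by (auto simp: J_def fun_eq_iff algebra_simps)

lemma J_scale: "J (\<lambda>x. r * u x) = (\<lambda>x. complex_of_real r * J u x)"
  by (auto simp: J_def fun_eq_iff algebra_simps)

lemma S_pos:
  assumes u: "u \<in> borel_measurable borel" "\<And>x. 0 \<le> u x" and L: "J u \<in> L2 \<Omega>"
  shows "AE x in lborel. 0 \<le> Re (S (J u) x) \<and> Im (S (J u) x) = 0 \<and>
    Re (S (J u) x) \<le> (LINT y|lborel. heat_kernel t (x - y) * (w y * u y * indicator \<Omega>' y))"
proof -
  have "L2_le (\<lambda>x. 0) (J u)"
    using u by (auto simp: L2_le_def J_def less_eq_complex_def)
  from dom[OF L this] have "AE x in lborel. 0 \<le> S (J u) x" "AE x in lborel. S (J u) x \<le> heat_semigroup t (J u) x"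
    by (auto simp: L2_le_def AE_lebesgue_iff)
  then show ?thesis
  proof eventually_elim
    case (elim x)
    have [measurable]: "u \<in> borel_measurable borel" by fact
    have "heat_semigroup t (J u) x = (LINT y|lebesgue. complex_of_real (heat_kernel t (x - y) * (w y * u y * indicator \<Omega>' y)))"
      using t by (simp add: heat_semigroup_def J_def)
    also have "\<dots> = complex_of_real (LINT y|lebesgue. heat_kernel t (x - y) * (w y * u y * indicator \<Omega>' y))"
      by (rule integral_complex_of_real)
    also have "(LINT y|lebesgue. heat_kernel t (x - y) * (w y * u y * indicator \<Omega>' y)) =
      (LINT y|lborel. heat_kernel t (x - y) * (w y * u y * indicator \<Omega>' y))"
      by (rule integral_completion) measurable
    finally show ?case
      using elim by (auto simp: less_eq_complex_def)
  qed
qed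

definition M :: "'a measure" where "M = density lborel (\<lambda>x. ennreal (w x))"

lemma sets_M [simp, measurable_cong]: "sets M = sets borel" and space_M [simp]: "space M = UNIV"
  by (auto simp: M_def)

lemma emeasure_M: "X \<in> sets borel \<Longrightarrow> emeasure M X = ennreal (LINT x|lborel. w x * indicator X x)"
proof -
  assume [measurable]: "X \<in> sets borel"
  have "emeasure M X = (\<integral>\<^sup>+x. ennreal (w x * indicator X x) \<partial>lborel)"
    unfolding M_def by (subst emeasure_density) (auto intro!: nn_integral_cong split: split_indicator)
  also have "\<dots> = ennreal (LINT x|lborel. w x * indicator X x)"
    using w_integrable by (intro nn_integral_eq_integral integrable_real_mult_indicator) auto
  finally show ?thesis .
qed

sublocale finite_measure M
  by (rule finite_measureI) (simp add: emeasure_M)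

lemma measure_M: "X \<in> sets borel \<Longrightarrow> measure M X = (LINT x|lborel. w x * indicator X x)"
  by (simp add: measure_def emeasure_M integral_nonneg_AE)

definition \<Phi> :: "'a set \<Rightarrow> 'a set \<Rightarrow> real" where
  "\<Phi> X Y = (LINT x|lebesgue. Re (S (J (indicator Y)) x) * (w x * indicator X x * indicator \<Omega>' x))"

lemma J_indicator: "Y \<in> sets borel \<Longrightarrow> J (indicator Y) \<in> L2 \<Omega>"
  by (rule J_bounded[where C = 1]) (auto split: split_indicator)

lemma \<Phi>_integrable:
  assumes "X \<in> sets borel" "f \<in> L2 \<Omega>"
  shows "integrable lebesgue (\<lambda>x. Re (f x) * (w x * indicator X x * indicator \<Omega>' x))"
proof -
  have "integrable lebesgue (\<lambda>x. Re (f x * J (indicator X) x))"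
    by (intro integrable_Re L2_mult_integrable[OF assms(2) J_indicator[OF assms(1)]])
  then show ?thesis by (simp add: J_def)
qed

lemma \<Phi>_pos_bound:
  assumes Y: "Y \<in> sets borel"
  shows "AE x in lborel. 0 \<le> Re (S (J (indicator Y)) x) \<and> Re (S (J (indicator Y)) x) \<le> c * measure M Y"
  using S_pos[OF _ _ J_indicator[OF Y]]
proof (rule AE_mp)
  note [measurable] = Y
  show "AE x in lborel. 0 \<le> Re (S (J (indicator Y)) x) \<and> Im (S (J (indicator Y)) x) = 0 \<and>
     Re (S (J (indicator Y)) x) \<le> (LINT y|lborel. heat_kernel t (x - y) * (w y * indicator Y y * indicator \<Omega>' y)) \<longrightarrow>
     0 \<le> Re (S (J (indicator Y)) x) \<and> Re (S (J (indicator Y)) x) \<le> c * measure M Y"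
  proof (intro AE_I2 impI conjI; elim conjE)
    fix x assume le: "Re (S (J (indicator Y)) x) \<le> (LINT y|lborel. heat_kernel t (x - y) * (w y * indicator Y y * indicator \<Omega>' y))"
    note le
    also have "\<dots> \<le> (LINT y|lborel. c * (w y * indicator Y y))"
    proof (rule integral_mono)
      show i: "integrable lborel (\<lambda>y. c * (w y * indicator Y y))"
        using w_integrable by (intro integrable_mult_right integrable_real_mult_indicator) auto
      show le: "heat_kernel t (x - y) * (w y * indicator Y y * indicator \<Omega>' y) \<le> c * (w y * indicator Y y)" for y
        using c[of "x - y"] c_nonneg by (auto split: split_indicator intro!: mult_right_mono)
      show "integrable lborel (\<lambda>y. heat_kernel t (x - y) * (w y * indicator Y y * indicator \<Omega>' y))"
        by (rule Bochner_Integration.integrable_bound[OF i]) (use le c_nonneg in \<open>auto intro!: AE_I2 simp: abs_mult\<close>)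
    qed
    also have "\<dots> = c * measure M Y" using Y by (simp add: measure_M)
    finally show "Re (S (J (indicator Y)) x) \<le> c * measure M Y" .
  qed
qed (use Y in auto)

sublocale bounded_bimeasure M \<Phi> c
proof
  show "0 \<le> c" by (rule c_nonneg)
  fix A B assume "A \<in> sets M" "B \<in> sets M"
  then have AB[measurable]: "A \<in> sets borel" "B \<in> sets borel" by auto
  show "0 \<le> \<Phi> A B"
    unfolding \<Phi>_def using \<Phi>_pos_bound[OF AB(2)]
    by (intro integral_nonneg_AE) (auto simp: AE_lebesgue_iff)
  have "\<Phi> A B \<le> (LINT x|lebesgue. (c * measure M B) * (w x * indicator A x))"
    unfolding \<Phi>_def
  proof (rule integral_mono_AE)
    show "integrable lebesgue (\<lambda>x. Re (S (J (indicator B)) x) * (w x * indicator A x * indicator \<Omega>' x))"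
      by (intro \<Phi>_integrable S_in J_indicator AB)
    have "integrable lborel (\<lambda>x. (c * measure M B) * (w x * indicator A x))"
      using w_integrable by (intro integrable_mult_right integrable_real_mult_indicator) auto
    then show "integrable lebesgue (\<lambda>x. (c * measure M B) * (w x * indicator A x))"
      by (subst integrable_completion) auto
    show "AE x in lebesgue. Re (S (J (indicator B)) x) * (w x * indicator A x * indicator \<Omega>' x) \<le> (c * measure M B) * (w x * indicator A x)"
      unfolding AE_lebesgue_iff using \<Phi>_pos_bound[OF AB(2)]
      by eventually_elim (auto split: split_indicator intro!: mult_right_mono)
  qed
  also have "\<dots> = c * (measure M A * measure M B)"
    by (subst integral_completion) (auto simp: measure_M[OF AB(1)])
  finally show "\<Phi> A B \<le> c * (measure M A * measure M B)" .
next
  fix A A' B assume "A \<in> sets M" "A' \<in> sets M" "B \<in> sets M" and d: "A \<inter> A' = {}"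
  then have s: "A \<in> sets borel" "A' \<in> sets borel" "B \<in> sets borel" by auto
  have "\<Phi> (A \<union> A') B = (LINT x|lebesgue. Re (S (J (indicator B)) x) * (w x * indicator A x * indicator \<Omega>' x)
    + Re (S (J (indicator B)) x) * (w x * indicator A' x * indicator \<Omega>' x))"
    unfolding \<Phi>_def using d by (intro Bochner_Integration.integral_cong refl) (auto split: split_indicator)
  also have "\<dots> = \<Phi> A B + \<Phi> A' B"
    unfolding \<Phi>_def by (intro Bochner_Integration.integral_add \<Phi>_integrable S_in J_indicator s)
  finally show "\<Phi> (A \<union> A') B = \<Phi> A B + \<Phi> A' B" .
next
  fix A B B' assume "A \<in> sets M" "B \<in> sets M" "B' \<in> sets M" and d: "B \<inter> B' = {}"
  then have s: "A \<in> sets borel" "B \<in> sets borel" "B' \<in> sets borel" "B \<union> B' \<in> sets borel" by auto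
  have "J (indicator (B \<union> B')) = (\<lambda>x. J (indicator B) x + J (indicator B') x)"
    using d by (auto simp: J_def fun_eq_iff split: split_indicator)
  then have eq: "AE x in lborel. S (J (indicator (B \<union> B'))) x = S (J (indicator B)) x + S (J (indicator B')) x"
    using S_add[OF J_indicator[OF s(2)] J_indicator[OF s(3)]] by simp
  have "\<Phi> A (B \<union> B') = (LINT x|lebesgue. Re (S (J (indicator B)) x) * (w x * indicator A x * indicator \<Omega>' x)
    + Re (S (J (indicator B')) x) * (w x * indicator A x * indicator \<Omega>' x))"
    unfolding \<Phi>_def
  proof (rule integral_cong_AE)
    show "AE x in lebesgue. Re (S (J (indicator (B \<union> B'))) x) * (w x * indicator A x * indicator \<Omega>' x) =
      Re (S (J (indicator B)) x) * (w x * indicator A x * indicator \<Omega>' x) + Re (S (J (indicator B')) x) * (w x * indicator A x * indicator \<Omega>' x)"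
      unfolding AE_lebesgue_iff using eq by eventually_elim (simp add: algebra_simps)
  qed (intro borel_measurable_integrable Bochner_Integration.integrable_add \<Phi>_integrable S_in J_indicator s)+
  also have "\<dots> = \<Phi> A B + \<Phi> A B'"
    unfolding \<Phi>_def by (intro Bochner_Integration.integral_add \<Phi>_integrable S_in J_indicator s)
  finally show "\<Phi> A (B \<union> B') = \<Phi> A B + \<Phi> A B'" .
qed

end

context heat_dominated_operator
begin

lemma Re_S_J_outside:
  assumes "J u \<in> L2 \<Omega>"
  shows "AE x in lborel. x \<notin> \<Omega>' \<longrightarrow> S (J u) x = 0"
  using core_AE by eventually_elim (use L2_outside[OF S_in[OF assms]] in auto)

lemma kernel_indicator:
  obtains q :: "'a \<times> 'a \<Rightarrow> real" where "q \<in> borel_measurable borel" "\<And>z. 0 \<le> q z" "\<And>z. q z \<le> c"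
    "\<And>x y. x \<notin> \<Omega>' \<or> y \<notin> \<Omega>' \<Longrightarrow> q (x, y) = 0"
    "\<And>Y. Y \<in> sets borel \<Longrightarrow> AE x in lborel.
       (\<integral>\<^sup>+y. ennreal (q (x, y) * (w y * indicator Y y)) \<partial>lborel) = ennreal (Re (S (J (indicator Y)) x))"
proof -
  obtain p where p: "p \<in> borel_measurable (M \<Otimes>\<^sub>M M)" "\<And>z. 0 \<le> p z" "\<And>z. p z \<le> c"
    and p\<Phi>: "\<And>A B. A \<in> sets M \<Longrightarrow> B \<in> sets M \<Longrightarrow> \<Phi> A B = (\<integral>z. indicator (A \<times> B) z * p z \<partial>(M \<Otimes>\<^sub>M M))"
    by (rule density_exists) blast
  have "finite_measure M"
    by (rule finite_measureI) (simp add: emeasure_M)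
  then have sf: "sigma_finite_measure M"
    by (rule finite_measure.axioms)
  have "sets (M \<Otimes>\<^sub>M M) = sets (borel \<Otimes>\<^sub>M borel)"
    by (intro sets_pair_measure_cong) simp_all
  then have pp[measurable]: "p \<in> borel_measurable (borel \<Otimes>\<^sub>M borel)"
    using p(1) measurable_cong_sets by blast
  define q where "q z = p z * (indicator \<Omega>' (fst z) * indicator \<Omega>' (snd z))" for z
  have qp[measurable]: "q \<in> borel_measurable (borel \<Otimes>\<^sub>M borel)"
    unfolding q_def[abs_def]
    by (intro borel_measurable_times pp measurable_compose[OF measurable_fst indicator_core] measurable_compose[OF measurable_snd indicator_core])
  have q0: "0 \<le> q z" for z using p by (simp add: q_def)
  have rect: "ennreal (\<Phi> X Y) = (\<integral>\<^sup>+x. ennreal (w x * indicator X x) * (\<integral>\<^sup>+y. ennreal (q (x, y) * (w y * indicator Y y)) \<partial>lborel) \<partial>lborel)"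
    if X[measurable]: "X \<in> sets borel" and Y[measurable]: "Y \<in> sets borel" for X Y
  proof -
    let ?X = "X \<inter> \<Omega>'" and ?Y = "Y \<inter> \<Omega>'"
    note [measurable] = p(1)
    have XY[measurable]: "?X \<in> sets M" "?Y \<in> sets M" using core X Y by auto
    have XY'[measurable]: "?X \<in> sets borel" "?Y \<in> sets borel" using core X Y by auto
    have "J (indicator ?Y) = J (indicator Y)"
      by (auto simp: J_def fun_eq_iff split: split_indicator)
    moreover have "w x * indicator ?X x * indicator \<Omega>' x = w x * indicator X x * indicator \<Omega>' x" for x
      by (auto split: split_indicator)
    ultimately have "\<Phi> X Y = \<Phi> ?X ?Y"
      unfolding \<Phi>_def by (simp only:)
    also have "\<dots> = (\<integral>z. indicator (?X \<times> ?Y) z * p z \<partial>(M \<Otimes>\<^sub>M M))"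
      by (rule p\<Phi>[OF XY])
    also have "ennreal \<dots> = (\<integral>\<^sup>+z. ennreal (indicator (?X \<times> ?Y) z * p z) \<partial>(M \<Otimes>\<^sub>M M))"
      using p c_nonneg XY
      by (intro nn_integral_eq_integral[symmetric] integrable_bounded[where C = c]) (auto split: split_indicator)
    also have "\<dots> = (\<integral>\<^sup>+x. \<integral>\<^sup>+y. ennreal (indicator (?X \<times> ?Y) (x, y) * p (x, y)) \<partial>M \<partial>M)"
      by (rule sigma_finite_measure.nn_integral_fst[OF sf, symmetric]) (use XY in measurable)
    also have "\<dots> = (\<integral>\<^sup>+x. \<integral>\<^sup>+y. ennreal (w y) * ennreal (indicator ?X x * indicator ?Y y * p (x, y)) \<partial>lborel \<partial>M)"
    proof (intro nn_integral_cong)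
      fix x
      show "(\<integral>\<^sup>+y. ennreal (indicator (?X \<times> ?Y) (x, y) * p (x, y)) \<partial>M) = (\<integral>\<^sup>+y. ennreal (w y) * ennreal (indicator ?X x * indicator ?Y y * p (x, y)) \<partial>lborel)"
        unfolding M_def indicator_times by (subst nn_integral_density) auto
    qed
    also have "\<dots> = (\<integral>\<^sup>+x. ennreal (w x) * (\<integral>\<^sup>+y. ennreal (w y) * ennreal (indicator ?X x * indicator ?Y y * p (x, y)) \<partial>lborel) \<partial>lborel)"
      unfolding M_def by (subst nn_integral_density) auto
    also have "\<dots> = (\<integral>\<^sup>+x. ennreal (w x * indicator X x) * (\<integral>\<^sup>+y. ennreal (q (x, y) * (w y * indicator Y y)) \<partial>lborel) \<partial>lborel)"
    proof (intro nn_integral_cong)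
      fix x
      have "ennreal (w y) * ennreal (indicator ?X x * indicator ?Y y * p (x, y)) = ennreal (indicator X x) * ennreal (q (x, y) * (w y * indicator Y y))" for y
        using p by (auto simp: q_def mult_ac simp flip: ennreal_mult split: split_indicator)
      then have "ennreal (w x) * (\<integral>\<^sup>+y. ennreal (w y) * ennreal (indicator ?X x * indicator ?Y y * p (x, y)) \<partial>lborel)
        = ennreal (w x) * (\<integral>\<^sup>+y. ennreal (indicator X x) * ennreal (q (x, y) * (w y * indicator Y y)) \<partial>lborel)"
        by simp
      also have "\<dots> = ennreal (w x) * (ennreal (indicator X x) * (\<integral>\<^sup>+y. ennreal (q (x, y) * (w y * indicator Y y)) \<partial>lborel))"
        by (subst nn_integral_cmult) auto
      also have "\<dots> = ennreal (w x * indicator X x) * (\<integral>\<^sup>+y. ennreal (q (x, y) * (w y * indicator Y y)) \<partial>lborel)"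
        by (simp add: ennreal_mult mult.assoc)
      finally show "ennreal (w x) * (\<integral>\<^sup>+y. ennreal (w y) * ennreal (indicator ?X x * indicator ?Y y * p (x, y)) \<partial>lborel)
        = ennreal (w x * indicator X x) * (\<integral>\<^sup>+y. ennreal (q (x, y) * (w y * indicator Y y)) \<partial>lborel)" .
    qed
    finally show ?thesis .
  qed
  show ?thesis
  proof
    show "q \<in> borel_measurable borel" using qp by (simp add: borel_prod)
    show "q z \<le> c" for z
      using p(2,3)[of z] c_nonneg by (auto simp: q_def indicator_def)
    show "x \<notin> \<Omega>' \<or> y \<notin> \<Omega>' \<Longrightarrow> q (x, y) = 0" for x y
      by (auto simp: q_def)
    fix Y :: "'a set" assume Y[measurable]: "Y \<in> sets borel"
    let ?SJ = "S (J (indicator Y))"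
    obtain F where [measurable]: "F \<in> borel_measurable borel" and F: "AE x in lborel. ?SJ x = F x"
      using L2_borel_version[OF L2_measurable[OF S_in[OF J_indicator[OF Y]]]] .
    let ?I = "\<lambda>x. \<integral>\<^sup>+y. ennreal (q (x, y) * (w y * indicator Y y)) \<partial>lborel"
    have wi: "(\<lambda>x. Re (F x) * (w x * indicator \<Omega>' x)) \<in> borel_measurable borel"
      by (intro borel_measurable_times indicator_core) measurable
    have "AE x in lborel. ennreal (Re (F x) * (w x * indicator \<Omega>' x)) = ennreal (w x) * ?I x"
    proof (rule sigma_finite_measure.density_unique2[OF sigma_finite_lborel])
      show "(\<lambda>x. ennreal (Re (F x) * (w x * indicator \<Omega>' x))) \<in> borel_measurable lborel"
        using wi by simp
      show "(\<lambda>x. ennreal (w x) * ?I x) \<in> borel_measurable lborel" by measurable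
      fix X :: "'a set" assume "X \<in> sets lborel"
      then have X[measurable]: "X \<in> sets borel" by simp
      have "(\<integral>\<^sup>+x. ennreal (Re (F x) * (w x * indicator \<Omega>' x)) * indicator X x \<partial>lborel)
        = (\<integral>\<^sup>+x. ennreal (Re (?SJ x) * (w x * indicator X x * indicator \<Omega>' x)) \<partial>lborel)"
        by (rule nn_integral_cong_AE) (use F in \<open>eventually_elim, auto split: split_indicator\<close>)
      also have "\<dots> = (\<integral>\<^sup>+x. ennreal (Re (?SJ x) * (w x * indicator X x * indicator \<Omega>' x)) \<partial>lebesgue)"
        by (rule nn_integral_completion[symmetric])
      also have "\<dots> = ennreal (\<Phi> X Y)"
        unfolding \<Phi>_def
      proof (rule nn_integral_eq_integral)
        show "AE x in lebesgue. 0 \<le> Re (?SJ x) * (w x * indicator X x * indicator \<Omega>' x)"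
          unfolding AE_lebesgue_iff using \<Phi>_pos_bound[OF Y] by eventually_elim auto
      qed (intro \<Phi>_integrable S_in J_indicator X Y)
      also have "\<dots> = (\<integral>\<^sup>+x. ennreal (w x) * ?I x * indicator X x \<partial>lborel)"
        unfolding rect[OF X Y] by (intro nn_integral_cong) (auto split: split_indicator)
      finally show "(\<integral>\<^sup>+x. ennreal (Re (F x) * (w x * indicator \<Omega>' x)) * indicator X x \<partial>lborel) = (\<integral>\<^sup>+x. ennreal (w x) * ?I x * indicator X x \<partial>lborel)" .
    qed
    then show "AE x in lborel. ?I x = ennreal (Re (?SJ x))"
      using F Re_S_J_outside[OF J_indicator[OF Y]] \<Phi>_pos_bound[OF Y]
    proof eventually_elim
      case (elim x)
      show ?case
      proof (cases "x \<in> \<Omega>'")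
        case True
        then have "ennreal (w x) * ?I x = ennreal (w x) * ennreal (Re (?SJ x))"
          using elim by (simp add: mult.commute flip: ennreal_mult)
        then show ?thesis
          using heat_kernel_pos[of 1 x] by (auto simp: ennreal_mult_cancel_left)
      next
        case False
        then show ?thesis using elim by (simp add: q_def)
      qed
    qed
  qed (rule q0)
qed

lemma kernel_nonneg:
  fixes q :: "'a \<times> 'a \<Rightarrow> real"
  assumes q[measurable]: "q \<in> borel_measurable borel" and q0: "\<And>z. 0 \<le> q z"
    and base: "\<And>Y. Y \<in> sets borel \<Longrightarrow> AE x in lborel.
       (\<integral>\<^sup>+y. ennreal (q (x, y) * (w y * indicator Y y)) \<partial>lborel) = ennreal (Re (S (J (indicator Y)) x))"
    and u: "u \<in> borel_measurable borel" "\<And>x. 0 \<le> u x" "J u \<in> L2 \<Omega>"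
  shows "AE x in lborel. (\<integral>\<^sup>+y. ennreal (q (x, y) * (w y * u y)) \<partial>lborel) = ennreal (Re (S (J u) x))"
  using u
proof (induction u rule: borel_measurable_induct_real)
  case (set A)
  then show ?case using base by simp
next
  case (mult u r)
  have [measurable]: "q \<in> borel_measurable (borel \<Otimes>\<^sub>M borel)" by (simp add: borel_prod)
  note [measurable] = mult.hyps(2)
  show ?case
  proof (cases "r = 0")
    case True
    have "AE x in lborel. S (\<lambda>x. 0) x = 0"
      using S_scale[OF L2_zero, of 0] by eventually_elim simp
    then show ?thesis
    proof eventually_elim
      case (elim x)
      have "J (\<lambda>x. r * u x) = (\<lambda>x. 0)" using True by (simp add: J_def[abs_def])
      then show ?case using elim True by simp
    qed
  next
    case False
    have "J u = (\<lambda>x. complex_of_real (1 / r) * J (\<lambda>x. r * u x) x)"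
      using False by (auto simp: J_def fun_eq_iff)
    then have L: "J u \<in> L2 \<Omega>" using L2_scale[OF mult.prems] by metis
    show ?thesis
      using mult.IH[OF L] S_scale[OF L, of "complex_of_real r"]
    proof eventually_elim
      case (elim x)
      have "(\<integral>\<^sup>+y. ennreal (q (x, y) * (w y * (r * u y))) \<partial>lborel) = (\<integral>\<^sup>+y. ennreal r * ennreal (q (x, y) * (w y * u y)) \<partial>lborel)"
        using mult.hyps q0 by (intro nn_integral_cong) (simp add: mult_ac flip: ennreal_mult)
      also have "\<dots> = ennreal r * ennreal (Re (S (J u) x))"
        using elim(1) by (subst nn_integral_cmult) auto
      also have "\<dots> = ennreal (r * Re (S (J u) x))"
        using mult.hyps(1) by (simp add: ennreal_mult')
      finally show ?case
        using elim(2) by (simp add: J_scale)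
    qed
  qed
next
  case (add u v)
  have [measurable]: "q \<in> borel_measurable (borel \<Otimes>\<^sub>M borel)" by (simp add: borel_prod)
  note [measurable] = add.hyps(1) add.hyps(3)
  have L: "J u \<in> L2 \<Omega>" "J v \<in> L2 \<Omega>"
    using add.hyps by (auto intro!: J_dominated[OF add.prems])
  show ?case
    using add.IH(1)[OF L(1)] add.IH(2)[OF L(2)] S_add[OF L(2) L(1)] S_pos[OF add.hyps(1,2) L(1)] S_pos[OF add.hyps(3,4) L(2)]
  proof eventually_elim
    case (elim x)
    have "(\<integral>\<^sup>+y. ennreal (q (x, y) * (w y * (v y + u y))) \<partial>lborel)
      = (\<integral>\<^sup>+y. ennreal (q (x, y) * (w y * v y)) + ennreal (q (x, y) * (w y * u y)) \<partial>lborel)"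
      using add.hyps q0 by (intro nn_integral_cong) (simp add: algebra_simps flip: ennreal_plus)
    also have "\<dots> = ennreal (Re (S (J v) x)) + ennreal (Re (S (J u) x))"
      using elim(1,2) by (subst nn_integral_add) auto
    finally show ?case
      using elim(3-5) by (simp add: J_add)
  qed
next
  case (seq U)
  have qp[measurable]: "q \<in> borel_measurable (borel \<Otimes>\<^sub>M borel)" by (simp add: borel_prod)
  note U_meas[measurable] = seq.hyps(1)
  have u_meas[measurable]: "u \<in> borel_measurable borel"
    by (rule borel_measurable_LIMSEQ_real[OF _ seq.hyps(1)]) (use seq.hyps(4) in simp)
  have lim: "(\<lambda>i. U i x) \<longlonglongrightarrow> u x" for x using seq.hyps(4) by simp
  have mono: "incseq (\<lambda>i. U i x)" for x
    using seq.hyps(3) by (auto simp: incseq_def le_fun_def)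
  have U_le: "U i x \<le> u x" for i x by (rule incseq_le[OF mono lim])
  have u0: "0 \<le> u x" for x using seq.hyps(2)[of 0 x] U_le[of 0 x] by linarith
  have LU: "J (U i) \<in> L2 \<Omega>" for i
    by (rule J_dominated[OF seq.prems seq.hyps(1,2) U_le])
  define d where "d i x = u x - U i x" for i x
  have d_meas[measurable]: "d i \<in> borel_measurable borel" for i unfolding d_def[abs_def] by measurable
  have d0: "0 \<le> d i x" for i x using U_le by (simp add: d_def)
  have Ld: "J (d i) \<in> L2 \<Omega>" for i
    by (rule J_dominated[OF seq.prems d_meas d0]) (simp add: d_def seq.hyps(2))
  have SD: "AE x in lborel. S (J (d i)) x = S (J u) x - S (J (U i)) x" for i
    using S_diff[OF seq.prems LU[of i]] unfolding d_def J_diff .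
  let ?a = "\<lambda>x. \<integral>\<^sup>+y. ennreal (q (x, y) * (w y * u y)) \<partial>lborel"
  let ?ai = "\<lambda>i x. \<integral>\<^sup>+y. ennreal (q (x, y) * (w y * U i y)) \<partial>lborel"
  have sup: "?a x = (SUP i. ?ai i x)" for x
  proof -
    have "?a x = (\<integral>\<^sup>+y. (SUP i. ennreal (q (x, y) * (w y * U i y))) \<partial>lborel)"
    proof (intro nn_integral_cong)
      fix y
      have "(\<lambda>i. ennreal (q (x, y) * (w y * U i y))) \<longlonglongrightarrow> ennreal (q (x, y) * (w y * u y))"
        by (intro tendsto_ennrealI tendsto_intros lim)
      moreover have "incseq (\<lambda>i. ennreal (q (x, y) * (w y * U i y)))"
        using mono[of y] q0 by (auto simp: incseq_def intro!: ennreal_leI mult_left_mono)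
      ultimately show "ennreal (q (x, y) * (w y * u y)) = (SUP i. ennreal (q (x, y) * (w y * U i y)))"
        using LIMSEQ_SUP LIMSEQ_unique by blast
    qed
    also have "\<dots> = (SUP i. ?ai i x)"
    proof (rule nn_integral_monotone_convergence_SUP)
      show "incseq (\<lambda>i y. ennreal (q (x, y) * (w y * U i y)))"
        using mono q0 by (auto simp: incseq_def le_fun_def intro!: ennreal_leI mult_left_mono)
    qed measurable
    finally show ?thesis .
  qed
  let ?D = "\<lambda>i x. Re (S (J (d i)) x)"
  have IH: "AE x in lborel. \<forall>i. ?ai i x = ennreal (Re (S (J (U i)) x)) \<and> 0 \<le> Re (S (J (U i)) x) \<and>
      S (J (d i)) x = S (J u) x - S (J (U i)) x \<and> 0 \<le> ?D i x"
    unfolding AE_all_countable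
  proof
    fix i
    show "AE x in lborel. ?ai i x = ennreal (Re (S (J (U i)) x)) \<and> 0 \<le> Re (S (J (U i)) x) \<and>
      S (J (d i)) x = S (J u) x - S (J (U i)) x \<and> 0 \<le> ?D i x"
      using seq.IH[OF LU[of i]] SD[of i] S_pos[OF seq.hyps(1,2) LU[of i]] S_pos[OF d_meas d0 Ld[of i]]
      by eventually_elim blast
  qed
  define b where "b x = Re (S (J u) x)" for x
  have ab: "AE x in lborel. ?a x \<le> ennreal (b x) \<and> 0 \<le> b x \<and> (\<forall>i. b x - enn2real (?a x) \<le> ?D i x)"
    using IH
  proof eventually_elim
    case (elim x)
    have le: "?ai i x \<le> ennreal (b x)" for i
      using elim[rule_format, of i] unfolding b_def by (auto intro!: ennreal_leI)
    then have le': "?a x \<le> ennreal (b x)" unfolding sup by (rule SUP_least)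
    moreover have b0: "0 \<le> b x" using elim[rule_format, of 0] by (auto simp: b_def)
    moreover have "b x - enn2real (?a x) \<le> ?D i x" for i
    proof -
      have "?ai i x \<le> ?a x" unfolding sup by (rule SUP_upper) simp
      then have "enn2real (?ai i x) \<le> enn2real (?a x)"
        using le' by (intro enn2real_mono) (auto simp: le_less_trans)
      then show ?thesis
        using elim[rule_format, of i] by (auto simp: b_def)
    qed
    ultimately show ?case by blast
  qed
  obtain C where C: "C \<ge> 0" "\<And>f. f \<in> L2 \<Omega> \<Longrightarrow> L2_norm (S f) \<le> C * L2_norm f"
    using S_bounded by auto
  have Dint: "(\<integral>\<^sup>+x. ennreal ((b x - enn2real (?a x))\<^sup>2) \<partial>lborel) \<le> ennreal (C\<^sup>2 * (L2_norm (J (d i)))\<^sup>2)" for i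
  proof -
    have "(\<integral>\<^sup>+x. ennreal ((b x - enn2real (?a x))\<^sup>2) \<partial>lborel) \<le> (\<integral>\<^sup>+x. ennreal ((cmod (S (J (d i)) x))\<^sup>2) \<partial>lborel)"
    proof (rule nn_integral_mono_AE)
      show "AE x in lborel. ennreal ((b x - enn2real (?a x))\<^sup>2) \<le> ennreal ((cmod (S (J (d i)) x))\<^sup>2)"
        using ab
      proof eventually_elim
        case (elim x)
        have "enn2real (?a x) \<le> b x"
          using elim enn2real_mono[of "?a x" "ennreal (b x)"] by auto
        moreover have "b x - enn2real (?a x) \<le> cmod (S (J (d i)) x)"
          using elim complex_Re_le_cmod[of "S (J (d i)) x"] by (meson order_trans)
        ultimately show ?case by (intro ennreal_leI power_mono) auto
      qed
    qed
    also have "\<dots> = (\<integral>\<^sup>+x. ennreal ((cmod (S (J (d i)) x))\<^sup>2) \<partial>lebesgue)"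
      by (rule nn_integral_completion[symmetric])
    also have "\<dots> = ennreal ((L2_norm (S (J (d i))))\<^sup>2)"
      unfolding L2_norm_power2 by (intro nn_integral_eq_integral L2_integrable[OF S_in[OF Ld]]) simp
    also have "\<dots> \<le> ennreal (C\<^sup>2 * (L2_norm (J (d i)))\<^sup>2)"
      unfolding power_mult_distrib[symmetric] using C(2)[OF Ld[of i]] by (intro ennreal_leI power_mono) (auto simp: L2_norm_nonneg)
    finally show ?thesis .
  qed
  have "(\<lambda>i. (L2_norm (J (d i)))\<^sup>2) \<longlonglongrightarrow> (LINT x|(lebesgue :: 'a measure). (0::real))"
    unfolding L2_norm_power2
  proof (rule integral_dominated_convergence[where f = "\<lambda>x. 0" and s = "\<lambda>i x. (cmod (J (d i) x))\<^sup>2" and w = "\<lambda>x. (cmod (J u x))\<^sup>2"])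
    show "integrable lebesgue (\<lambda>x. (cmod (J u x))\<^sup>2)" by (rule L2_integrable[OF seq.prems])
    show "(\<lambda>x. (cmod (J (d i) x))\<^sup>2) \<in> borel_measurable lebesgue" for i
      using L2_integrable[OF Ld] by (rule borel_measurable_integrable)
    show "AE x in lebesgue. (\<lambda>i. (cmod (J (d i) x))\<^sup>2) \<longlonglongrightarrow> 0"
    proof (intro AE_I2)
      fix x
      have "(\<lambda>i. (cmod (complex_of_real (w x * (u x - U i x) * indicator \<Omega>' x)))\<^sup>2) \<longlonglongrightarrow> (cmod (complex_of_real (w x * (u x - u x) * indicator \<Omega>' x)))\<^sup>2"
        by (intro tendsto_intros lim)
      then show "(\<lambda>i. (cmod (J (d i) x))\<^sup>2) \<longlonglongrightarrow> 0" by (simp add: J_def d_def)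
    qed
    show "AE x in lebesgue. norm ((cmod (J (d i) x))\<^sup>2) \<le> (cmod (J u x))\<^sup>2" for i
    proof (intro AE_I2)
      fix x
      have "\<bar>d i x\<bar> \<le> \<bar>u x\<bar>" using d0[of i x] seq.hyps(2)[of i x] by (simp add: d_def)
      then have "cmod (J (d i) x) \<le> cmod (J u x)"
        by (simp add: J_def norm_mult mult_right_mono mult_left_mono)
      then show "norm ((cmod (J (d i) x))\<^sup>2) \<le> (cmod (J u x))\<^sup>2"
        by (simp add: power_mono)
    qed
  qed simp
  then have "(\<lambda>i. ennreal (C\<^sup>2 * (L2_norm (J (d i)))\<^sup>2)) \<longlonglongrightarrow> ennreal (C\<^sup>2 * 0)"
    by (intro tendsto_ennrealI tendsto_intros) simp
  then have "(\<integral>\<^sup>+x. ennreal ((b x - enn2real (?a x))\<^sup>2) \<partial>lborel) \<le> ennreal (C\<^sup>2 * 0)"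
    by (rule LIMSEQ_le_const) (use Dint in blast)
  then have zero: "(\<integral>\<^sup>+x. ennreal ((b x - enn2real (?a x))\<^sup>2) \<partial>lborel) = 0" by simp
  obtain b' where b'[measurable]: "b' \<in> borel_measurable borel" and bb: "AE x in lborel. b x = b' x"
  proof -
    obtain F where [measurable]: "F \<in> borel_measurable borel" and F: "AE x in lborel. S (J u) x = F x"
      using L2_borel_version[OF L2_measurable[OF S_in[OF seq.prems]]] .
    show ?thesis
      by (rule that[of "\<lambda>x. Re (F x)"]) (measurable, use F in \<open>eventually_elim, simp add: b_def\<close>)
  qed
  have "(\<integral>\<^sup>+x. ennreal ((b' x - enn2real (?a x))\<^sup>2) \<partial>lborel) = 0"
    unfolding zero[symmetric] by (rule nn_integral_cong_AE) (use bb in \<open>eventually_elim, simp\<close>)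
  then have "AE x in lborel. ennreal ((b' x - enn2real (?a x))\<^sup>2) = 0"
    by (subst (asm) nn_integral_0_iff_AE) auto
  then show ?case
    using bb ab
  proof eventually_elim
    case (elim x)
    then have "b x = enn2real (?a x)" by (simp add: ennreal_eq_0_iff)
    moreover have "?a x \<le> ennreal (b x)" using elim by blast
    then have "?a x < top" using ennreal_less_top le_less_trans by blast
    ultimately have "?a x = ennreal (b x)" by (simp only: ennreal_enn2real)
    then show ?case by (simp only: b_def)
  qed
qed

end

lemma ennreal_integral_le_nn_integral:
  assumes "\<And>x. 0 \<le> f x"
  shows "ennreal (LINT x|M. f x) \<le> (\<integral>\<^sup>+x. ennreal (f x) \<partial>M)"
proof (cases "integrable M f")
  case True
  then show ?thesis using assms by (simp add: nn_integral_eq_integral)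
next
  case False
  then show ?thesis by (simp add: not_integrable_integral_eq)
qed

context heat_dominated_operator
begin

lemma indicator_L2:
  assumes B: "B \<in> sets borel" "bounded B"
  shows "J (\<lambda>x. indicator B x / w x) = (\<lambda>x. complex_of_real (indicator (B \<inter> \<Omega>') x))"
    "J (\<lambda>x. indicator B x / w x) \<in> L2 \<Omega>"
proof -
  have w: "w x \<noteq> 0" for x using heat_kernel_pos[of 1 x] by simp
  show eq: "J (\<lambda>x. indicator B x / w x) = (\<lambda>x. complex_of_real (indicator (B \<inter> \<Omega>') x))"
    using w by (auto simp: J_def fun_eq_iff split: split_indicator)
  have s: "B \<inter> \<Omega>' \<in> sets borel" using B core by auto
  have "emeasure lborel (B \<inter> \<Omega>') < \<infinity>"
    using B by (intro emeasure_bounded_finite) (auto intro: bounded_subset)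
  then have "integrable lborel (indicator (B \<inter> \<Omega>') :: 'a \<Rightarrow> real)"
    using s by (simp add: integrable_indicator_iff)
  then have "integrable lborel (\<lambda>x. (cmod (complex_of_real (indicator (B \<inter> \<Omega>') x)))\<^sup>2)"
    by (rule Bochner_Integration.integrable_cong[THEN iffD1, rotated 2]) (auto split: split_indicator)
  then have "integrable lebesgue (\<lambda>x. (cmod (complex_of_real (indicator (B \<inter> \<Omega>') x)))\<^sup>2)"
    using s by (subst integrable_completion) auto
  moreover have "(\<lambda>x. complex_of_real (indicator (B \<inter> \<Omega>') x)) \<in> borel_measurable lebesgue"
    using s by (intro measurable_completion) auto
  ultimately show "J (\<lambda>x. indicator B x / w x) \<in> L2 \<Omega>"
    unfolding eq using core_subset by (auto simp: L2_def indicator_def)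
qed

lemma kernel_complex:
  obtains q :: "'a \<times> 'a \<Rightarrow> real" where "q \<in> borel_measurable borel" "\<And>z. 0 \<le> q z"
    "\<And>x y. x \<notin> \<Omega>' \<or> y \<notin> \<Omega>' \<Longrightarrow> q (x, y) = 0"
    "AE z in lborel. q z \<le> heat_kernel t (fst z - snd z)"
    "\<And>f. f \<in> L2 \<Omega> \<Longrightarrow> AE x in lborel. integrable lebesgue (\<lambda>y. complex_of_real (q (x, y)) * f y) \<and>
       S f x = (LINT y|lebesgue. complex_of_real (q (x, y)) * f y)"
proof -
  obtain q :: "'a \<times> 'a \<Rightarrow> real" where q[measurable]: "q \<in> borel_measurable borel" and q0: "\<And>z. 0 \<le> q z" and qc: "\<And>z. q z \<le> c"
    and q_out: "\<And>x y. x \<notin> \<Omega>' \<or> y \<notin> \<Omega>' \<Longrightarrow> q (x, y) = 0"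
    and base: "\<And>Y. Y \<in> sets borel \<Longrightarrow> AE x in lborel.
       (\<integral>\<^sup>+y. ennreal (q (x, y) * (w y * indicator Y y)) \<partial>lborel) = ennreal (Re (S (J (indicator Y)) x))"
    by (rule kernel_indicator) (rule that)
  have kern: "AE x in lborel. (\<integral>\<^sup>+y. ennreal (q (x, y) * (w y * u y)) \<partial>lborel) = ennreal (Re (S (J u) x))"
    if "u \<in> borel_measurable borel" "\<And>x. 0 \<le> u x" "J u \<in> L2 \<Omega>" for u
    by (rule kernel_nonneg[OF q q0 _ that]) (rule base)
  have qp[measurable]: "q \<in> borel_measurable (borel \<Otimes>\<^sub>M borel)" by (simp add: borel_prod)
  have w: "w x \<noteq> 0" "0 < w x" for x using heat_kernel_pos[of 1 x] by simp_all
  show ?thesis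
  proof
    have "(\<lambda>z::'a \<times> 'a. heat_kernel t (fst z - snd z)) \<in> borel_measurable (borel \<Otimes>\<^sub>M borel)" by measurable
    then have hm: "(\<lambda>z::'a \<times> 'a. heat_kernel t (fst z - snd z)) \<in> borel_measurable borel"
      by (simp add: borel_prod)
    show "AE z in lborel. q z \<le> heat_kernel t (fst z - snd z)"
    proof (rule AE_le_of_rectangles[OF q hm q0 qc])
      fix A B :: "'a set" assume A[measurable]: "A \<in> sets borel" and B[measurable]: "B \<in> sets borel" and "bounded A" and Bb: "bounded B"
      let ?u = "\<lambda>x. indicator B x / w x"
      have u: "?u \<in> borel_measurable borel" "\<And>x. 0 \<le> ?u x" by auto
      have "AE x in lborel. (\<integral>\<^sup>+y. ennreal (q (x, y) * (indicator A x * indicator B y)) \<partial>lborel)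
          \<le> (\<integral>\<^sup>+y. ennreal (heat_kernel t (fst (x, y) - snd (x, y)) * (indicator A x * indicator B y)) \<partial>lborel)"
        using kern[OF u indicator_L2(2)[OF B Bb]] S_pos[OF u indicator_L2(2)[OF B Bb]]
      proof eventually_elim
        case (elim x)
        have "(\<integral>\<^sup>+y. ennreal (q (x, y) * (indicator A x * indicator B y)) \<partial>lborel) = (\<integral>\<^sup>+y. ennreal (indicator A x) * ennreal (q (x, y) * (w y * ?u y)) \<partial>lborel)"
          using q0 w by (intro nn_integral_cong) (auto split: split_indicator)
        also have "\<dots> = ennreal (indicator A x) * ennreal (Re (S (J ?u) x))"
          unfolding elim(1)[symmetric] by (intro nn_integral_cmult) measurable
        also have "\<dots> \<le> ennreal (indicator A x) * ennreal (LINT y|lborel. heat_kernel t (x - y) * (w y * ?u y * indicator \<Omega>' y))"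
          using elim(2) by (intro mult_left_mono ennreal_leI) auto
        also have "\<dots> \<le> ennreal (indicator A x) * (\<integral>\<^sup>+y. ennreal (heat_kernel t (x - y) * (w y * ?u y * indicator \<Omega>' y)) \<partial>lborel)"
          by (intro mult_left_mono ennreal_integral_le_nn_integral) auto
        also have "\<dots> \<le> ennreal (indicator A x) * (\<integral>\<^sup>+y. ennreal (heat_kernel t (x - y) * indicator B y) \<partial>lborel)"
          using w by (intro mult_left_mono nn_integral_mono ennreal_leI) (auto split: split_indicator)
        also have "\<dots> = (\<integral>\<^sup>+y. ennreal (heat_kernel t (fst (x, y) - snd (x, y)) * (indicator A x * indicator B y)) \<partial>lborel)"
          by (subst nn_integral_cmult[symmetric]) (auto intro!: nn_integral_cong split: split_indicator)
        finally show ?case .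
      qed
      then show "(\<integral>\<^sup>+x. \<integral>\<^sup>+y. ennreal (q (x, y) * (indicator A x * indicator B y)) \<partial>lborel \<partial>lborel)
          \<le> (\<integral>\<^sup>+x. \<integral>\<^sup>+y. ennreal (heat_kernel t (fst (x, y) - snd (x, y)) * (indicator A x * indicator B y)) \<partial>lborel \<partial>lborel)"
        by (rule nn_integral_mono_AE)
    qed (use c in \<open>auto intro!: exI[of _ c]\<close>)
  next
    fix f assume f: "f \<in> L2 \<Omega>"
    obtain f0 where f0[measurable]: "f0 \<in> borel_measurable borel" and ff0: "AE x in lborel. f x = f0 x"
      using L2_borel_version[OF L2_measurable[OF f]] .
    define f' where "f' x = complex_of_real (indicator \<Omega>' x) * f0 x" for x
    have f'm[measurable]: "f' \<in> borel_measurable borel"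
      unfolding f'_def[abs_def]
      by (intro borel_measurable_times f0 measurable_compose[OF indicator_core borel_measurable_of_real])
    have ff': "AE x in lborel. f x = f' x"
      using ff0 core_AE
    proof eventually_elim
      case (elim x)
      then show ?case using L2_outside[OF f, of x] by (cases "x \<in> \<Omega>'") (auto simp: f'_def)
    qed
    have f'L: "f' \<in> L2 \<Omega>"
    proof -
      have "f' \<in> borel_measurable lebesgue" by (rule measurable_completion) simp
      moreover from this have "integrable lebesgue (\<lambda>x. (cmod (f' x))\<^sup>2)"
        using L2_integrable[OF f] ff' L2_measurable[OF f]
        by (subst integrable_cong_AE[where g = "\<lambda>x. (cmod (f x))\<^sup>2"]) (auto simp: AE_lebesgue_iff)
      ultimately show ?thesis
        using core_subset by (auto simp: L2_def f'_def indicator_def)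
    qed
    define u where "u g x = max 0 (g (f' x)) / w x" for g :: "complex \<Rightarrow> real" and x
    have u: "u g \<in> borel_measurable borel" "\<And>x. 0 \<le> u g x" "J (u g) \<in> L2 \<Omega>"
      if g: "g \<in> borel_measurable borel" "\<And>z. \<bar>g z\<bar> \<le> cmod z" for g
    proof -
      show um: "u g \<in> borel_measurable borel"
        unfolding u_def[abs_def] using g(1) by measurable
      show "0 \<le> u g x" for x by (simp add: u_def)
      show "J (u g) \<in> L2 \<Omega>"
      proof (rule L2_dominated[OF f'L, where C = 1])
        fix x
        show "cmod (J (u g) x) \<le> 1 * cmod (f' x)"
          using g(2)[of "f' x"] w[of x] by (auto simp: J_def u_def norm_mult split: split_indicator)
      qed (auto simp: J_lebesgue_measurable um J_outside)
    qed
    define I where "I g x = (LINT y|lborel. q (x, y) * (w y * u g y))" for g x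
    have part: "AE x in lborel. integrable lborel (\<lambda>y. q (x, y) * (w y * u g y)) \<and> S (J (u g)) x = complex_of_real (I g x)"
      if g: "g \<in> borel_measurable borel" "\<And>z. \<bar>g z\<bar> \<le> cmod z" for g
      using kern[OF u[OF g]] S_pos[OF u[OF g]]
    proof eventually_elim
      case (elim x)
      note [measurable] = u(1)[OF g]
      have "integrable lborel (\<lambda>y. q (x, y) * (w y * u g y)) \<and> (LINT y|lborel. q (x, y) * (w y * u g y)) = Re (S (J (u g)) x)"
        using elim q0 u(2)[OF g] by (subst nn_integral_eq_integrable[symmetric]) auto
      then show ?case using elim(2) by (auto simp: I_def complex_eq_iff)
    qed
    let ?g1 = Re and ?g2 = "\<lambda>z. - Re z" and ?g3 = Im and ?g4 = "\<lambda>z. - Im z"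
    have g: "?g1 \<in> borel_measurable borel" "\<And>z. \<bar>?g1 z\<bar> \<le> cmod z" "?g2 \<in> borel_measurable borel" "\<And>z. \<bar>?g2 z\<bar> \<le> cmod z"
      "?g3 \<in> borel_measurable borel" "\<And>z. \<bar>?g3 z\<bar> \<le> cmod z" "?g4 \<in> borel_measurable borel" "\<And>z. \<bar>?g4 z\<bar> \<le> cmod z"
      by (auto simp: abs_Re_le_cmod abs_Im_le_cmod)
    note L = u(3)[OF g(1,2)] u(3)[OF g(3,4)] u(3)[OF g(5,6)] u(3)[OF g(7,8)]
    have dec: "f' = (\<lambda>x. (J (u ?g1) x - J (u ?g2) x) + \<i> * (J (u ?g3) x - J (u ?g4) x))"
    proof
      fix x
      show "f' x = (J (u ?g1) x - J (u ?g2) x) + \<i> * (J (u ?g3) x - J (u ?g4) x)"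
        using w[of x] by (cases "x \<in> \<Omega>'") (auto simp: J_def u_def f'_def complex_eq_iff max_def)
    qed
    have Sdec: "AE x in lborel. S f' x = (S (J (u ?g1)) x - S (J (u ?g2)) x) + \<i> * (S (J (u ?g3)) x - S (J (u ?g4)) x)"
      using S_add[OF L2_diff[OF L(1,2)] L2_scale[OF L2_diff[OF L(3,4)], of \<i>]] S_diff[OF L(1,2)]
        S_scale[OF L2_diff[OF L(3,4)], of \<i>] S_diff[OF L(3,4)]
      unfolding dec[symmetric] by eventually_elim simp
    show "AE x in lborel. integrable lebesgue (\<lambda>y. complex_of_real (q (x, y)) * f y) \<and>
       S f x = (LINT y|lebesgue. complex_of_real (q (x, y)) * f y)"
      using S_cong[OF f f'L ff'] Sdec part[OF g(1,2)] part[OF g(3,4)] part[OF g(5,6)] part[OF g(7,8)]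
    proof eventually_elim
      case (elim x)
      let ?h = "\<lambda>g y. complex_of_real (q (x, y) * (w y * u g y))"
      have h: "integrable lborel (?h ?g1)" "integrable lborel (?h ?g2)" "integrable lborel (?h ?g3)" "integrable lborel (?h ?g4)"
        using elim(3-6) by (auto intro!: integrable_of_real simp del: of_real_mult)
      have hI: "(LINT y|lborel. ?h g y) = complex_of_real (I g x)" for g
        unfolding I_def by (rule integral_complex_of_real)
      have eq: "complex_of_real (q (x, y)) * f' y = (?h ?g1 y - ?h ?g2 y) + \<i> * (?h ?g3 y - ?h ?g4 y)" for y
        using w[of y] q_out[of x y] by (cases "y \<in> \<Omega>'") (auto simp: u_def f'_def complex_eq_iff max_def algebra_simps)
      have i': "integrable lborel (\<lambda>y. complex_of_real (q (x, y)) * f' y)"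
        unfolding eq by (intro Bochner_Integration.integrable_add Bochner_Integration.integrable_diff integrable_mult_right h)
      have "(LINT y|lborel. complex_of_real (q (x, y)) * f' y) = (complex_of_real (I ?g1 x) - complex_of_real (I ?g2 x)) + \<i> * (complex_of_real (I ?g3 x) - complex_of_real (I ?g4 x))"
        unfolding eq hI[symmetric] using h by simp
      also have "\<dots> = S f x" using elim by simp
      finally have v': "(LINT y|lborel. complex_of_real (q (x, y)) * f' y) = S f x" .
      have qf': "(\<lambda>y. complex_of_real (q (x, y)) * f' y) \<in> borel_measurable lborel" by measurable
      have qf'l: "(\<lambda>y. complex_of_real (q (x, y)) * f' y) \<in> borel_measurable lebesgue"
        by (rule measurable_completion[OF qf'])
      have qfl: "(\<lambda>y. complex_of_real (q (x, y)) * f y) \<in> borel_measurable lebesgue"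
      proof (rule borel_measurable_times[OF _ L2_measurable[OF f]])
        have "(\<lambda>y. complex_of_real (q (x, y))) \<in> borel_measurable lborel" by measurable
        then show "(\<lambda>y. complex_of_real (q (x, y))) \<in> borel_measurable lebesgue" by (rule measurable_completion)
      qed
      have ae: "AE y in lebesgue. complex_of_real (q (x, y)) * f y = complex_of_real (q (x, y)) * f' y"
        unfolding AE_lebesgue_iff using ff' by eventually_elim simp
      have "integrable lebesgue (\<lambda>y. complex_of_real (q (x, y)) * f y)"
        using integrable_cong_AE[OF qfl qf'l ae] integrable_completion[OF qf'] i' by simp
      moreover have "(LINT y|lebesgue. complex_of_real (q (x, y)) * f y) = S f x"
        using integral_cong_AE[OF qfl qf'l ae] integral_completion[OF qf'] v' by simp
      ultimately show ?case by simp
    qed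
  qed (use q q0 q_out in auto)
qed

end

theorem heat_dominated_kernel:
  fixes \<Omega> :: "'a::euclidean_space set"
  assumes \<Omega>: "\<Omega> \<in> sets lebesgue" and S: "bounded_operator \<Omega> S" and t: "t > 0"
    and dom: "\<And>f. f \<in> L2 \<Omega> \<Longrightarrow> L2_le (\<lambda>x. 0) f \<Longrightarrow> L2_le (\<lambda>x. 0) (S f) \<and> L2_le (S f) (heat_semigroup t f)"
  obtains q :: "'a \<times> 'a \<Rightarrow> real" where "q \<in> borel_measurable borel" "\<And>z. 0 \<le> q z"
    "\<And>x y. x \<notin> \<Omega> \<or> y \<notin> \<Omega> \<Longrightarrow> q (x, y) = 0"
    "AE z in lborel. q z \<le> heat_kernel t (fst z - snd z)"
    "\<And>f. f \<in> L2 \<Omega> \<Longrightarrow> AE x in lborel. integrable lebesgue (\<lambda>y. complex_of_real (q (x, y)) * f y) \<and>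
       S f x = (LINT y|lebesgue. complex_of_real (q (x, y)) * f y)"
proof -
  obtain O' N N' where O': "\<Omega> = O' \<union> N" "N \<subseteq> N'" "N' \<in> null_sets lborel" "O' \<in> sets lborel"
    using \<Omega> by (auto elim: sets_completionE)
  have "AE x in lborel. x \<notin> N'" by (rule AE_not_in[OF O'(3)])
  then have ae: "AE x in lborel. x \<in> \<Omega> \<longrightarrow> x \<in> O'"
    by eventually_elim (use O' in auto)
  interpret heat_dominated_operator \<Omega> S t "(4 * pi * t) powr (- (real DIM('a) / 2))" O'
    by unfold_locales (use S t dom ae O' heat_kernel_le[OF t] in auto)
  obtain q :: "'a \<times> 'a \<Rightarrow> real" where q: "q \<in> borel_measurable borel" "\<And>z. 0 \<le> q z"
    and out: "\<And>x y. x \<notin> O' \<or> y \<notin> O' \<Longrightarrow> q (x, y) = 0"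
    and q': "AE z in lborel. q z \<le> heat_kernel t (fst z - snd z)"
    "\<And>f. f \<in> L2 \<Omega> \<Longrightarrow> AE x in lborel. integrable lebesgue (\<lambda>y. complex_of_real (q (x, y)) * f y) \<and>
       S f x = (LINT y|lebesgue. complex_of_real (q (x, y)) * f y)"
    by (rule kernel_complex) (rule that)
  have "q (x, y) = 0" if "x \<notin> \<Omega> \<or> y \<notin> \<Omega>" for x y
    using out[of x y] that O'(1) by blast
  from that[OF q this q'] show ?thesis .
qed

section \<open>$L_2$ as a real Hilbert space\<close>

lemma L2_norm_sq_nn_integral:
  assumes "f \<in> L2 \<Omega>"
  shows "(\<integral>\<^sup>+x. ennreal ((cmod (f x))\<^sup>2) \<partial>lebesgue) = ennreal ((L2_norm f)\<^sup>2)"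
  unfolding L2_norm_power2 by (intro nn_integral_eq_integral L2_integrable[OF assms]) simp

lemma L2_eq_equiv: "L2_eq f f" "L2_eq f g \<Longrightarrow> L2_eq g f" "L2_eq f g \<Longrightarrow> L2_eq g h \<Longrightarrow> L2_eq f h"
  unfolding L2_eq_def by (auto elim: eventually_mono eventually_elim2)

lemma L2_eq_add: "L2_eq f f' \<Longrightarrow> L2_eq g g' \<Longrightarrow> L2_eq (\<lambda>x. f x + g x) (\<lambda>x. f' x + g' x)"
  and L2_eq_diff: "L2_eq f f' \<Longrightarrow> L2_eq g g' \<Longrightarrow> L2_eq (\<lambda>x. f x - g x) (\<lambda>x. f' x - g' x)"
  unfolding L2_eq_def by (erule (1) eventually_elim2, simp)+

lemma L2_eq_scale: "L2_eq f g \<Longrightarrow> L2_eq (\<lambda>x. c * f x) (\<lambda>x. c * g x)"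
  unfolding L2_eq_def by (erule eventually_mono) simp

text \<open>The class of real Hilbert spaces is what the library offers, so only the real structure of
  the complex space $L_2$ is recorded: scalars are real and the inner product is the real part of the
  complex one.\<close>

quotient_type (overloaded) 'a l2 = "'a::euclidean_space \<Rightarrow> complex" / partial:
  "\<lambda>f g. f \<in> L2 UNIV \<and> g \<in> L2 UNIV \<and> L2_eq f g"
proof (rule part_equivpI)
  show "\<exists>f::'a \<Rightarrow> complex. f \<in> L2 UNIV \<and> f \<in> L2 UNIV \<and> L2_eq f f"
    using L2_zero L2_eq_equiv(1) by blast
  show "symp (\<lambda>f g::'a \<Rightarrow> complex. f \<in> L2 UNIV \<and> g \<in> L2 UNIV \<and> L2_eq f g)"
    by (auto intro!: sympI L2_eq_equiv(2))
  show "transp (\<lambda>f g::'a \<Rightarrow> complex. f \<in> L2 UNIV \<and> g \<in> L2 UNIV \<and> L2_eq f g)"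
    by (auto intro!: transpI intro: L2_eq_equiv(3))
qed

lemma L2_inner_cong:
  assumes "f \<in> L2 UNIV \<and> f' \<in> L2 UNIV \<and> L2_eq f f'" "g \<in> L2 UNIV \<and> g' \<in> L2 UNIV \<and> L2_eq g g'"
  shows "L2_inner f g = L2_inner f' g'"
  unfolding L2_inner_def
proof (rule integral_cong_AE)
  show "(\<lambda>x. f x * cnj (g x)) \<in> borel_measurable lebesgue" "(\<lambda>x. f' x * cnj (g' x)) \<in> borel_measurable lebesgue"
    using assms by (auto intro!: borel_measurable_integrable L2_mult_integrable L2_cnj)
  have "AE x in lebesgue. f x = f' x" "AE x in lebesgue. g x = g' x"
    using assms by (auto simp: L2_eq_def)
  then show "AE x in lebesgue. f x * cnj (g x) = f' x * cnj (g' x)"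
    by eventually_elim simp
qed

instantiation l2 :: (euclidean_space) real_vector
begin

lift_definition zero_l2 :: "'a l2" is "\<lambda>x. 0"
  by (simp add: L2_zero L2_eq_equiv)

lift_definition plus_l2 :: "'a l2 \<Rightarrow> 'a l2 \<Rightarrow> 'a l2" is "\<lambda>f g x. f x + g x"
  by (simp add: L2_add L2_eq_add)

lift_definition minus_l2 :: "'a l2 \<Rightarrow> 'a l2 \<Rightarrow> 'a l2" is "\<lambda>f g x. f x - g x"
  by (simp add: L2_diff L2_eq_diff)

lift_definition uminus_l2 :: "'a l2 \<Rightarrow> 'a l2" is "\<lambda>f x. - 1 * f x"
  by (intro conjI L2_scale L2_eq_scale) auto

lift_definition scaleR_l2 :: "real \<Rightarrow> 'a l2 \<Rightarrow> 'a l2" is "\<lambda>r f x. complex_of_real r * f x"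
  by (intro conjI L2_scale L2_eq_scale) auto

instance
proof
  fix F G K :: "'a l2" and r s :: real
  show "F + G + K = F + (G + K)"
    by transfer (simp add: add.assoc add.left_commute L2_eq_equiv(1) L2_add L2_diff L2_scale)
  show "F + G = G + F"
    by transfer (simp add: add.commute L2_eq_equiv(1) L2_add L2_diff L2_scale)
  show "0 + F = F"
    by transfer (simp add: algebra_simps L2_eq_equiv(1) L2_add L2_diff L2_scale)
  show "F - G = F + - G"
    by transfer (simp add: algebra_simps L2_eq_equiv(1) L2_add L2_diff L2_scale)
  show "r *\<^sub>R (F + G) = r *\<^sub>R F + r *\<^sub>R G"
    by transfer (simp add: distrib_left L2_eq_equiv(1) L2_add L2_diff L2_scale)
  show "(r + s) *\<^sub>R F = r *\<^sub>R F + s *\<^sub>R F"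
    by transfer (simp add: distrib_right L2_eq_equiv(1) L2_add L2_diff L2_scale)
  show "r *\<^sub>R s *\<^sub>R F = (r * s) *\<^sub>R F"
    by transfer (simp add: mult.assoc L2_eq_equiv(1) L2_add L2_diff L2_scale)
  show "1 *\<^sub>R F = F"
    by transfer (simp add: mult.assoc L2_eq_equiv(1) L2_add L2_diff L2_scale)
  show "- F + F = 0"
    by transfer (simp add: L2_eq_equiv(1) L2_zero)
qed

end

instantiation l2 :: (euclidean_space) real_inner
begin

lift_definition inner_l2 :: "'a l2 \<Rightarrow> 'a l2 \<Rightarrow> real" is "\<lambda>f g. Re (L2_inner f g)"
  using L2_inner_cong by metis

definition norm_l2 :: "'a l2 \<Rightarrow> real" where "norm_l2 F = sqrt (F \<bullet> F)"
definition dist_l2 :: "'a l2 \<Rightarrow> 'a l2 \<Rightarrow> real" where "dist_l2 F G = norm (F - G)"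
definition sgn_l2 :: "'a l2 \<Rightarrow> 'a l2" where "sgn_l2 F = F /\<^sub>R norm F"
definition uniformity_l2 :: "('a l2 \<times> 'a l2) filter" where
  "uniformity_l2 = (INF e\<in>{0 <..}. principal {(x, y). dist x y < e})"
definition open_l2 :: "'a l2 set \<Rightarrow> bool" where
  "open_l2 U \<longleftrightarrow> (\<forall>x\<in>U. eventually (\<lambda>(x', y). x' = x \<longrightarrow> y \<in> U) uniformity)"

instance
proof
  fix F G K :: "'a l2" and r :: real
  show "dist F G = norm (F - G)" by (rule dist_l2_def)
  show "sgn F = F /\<^sub>R norm F" by (rule sgn_l2_def)
  show "uniformity = (INF e\<in>{0 <..}. principal {(x :: 'a l2, y). dist x y < e})" by (rule uniformity_l2_def)
  show "open U \<longleftrightarrow> (\<forall>x\<in>U. eventually (\<lambda>(x', y). x' = x \<longrightarrow> y \<in> U) uniformity)" for U :: "'a l2 set"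
    by (rule open_l2_def)
  show "norm F = sqrt (F \<bullet> F)" by (rule norm_l2_def)
  show "F \<bullet> G = G \<bullet> F"
  proof transfer
    fix f g :: "'a \<Rightarrow> complex"
    assume "f \<in> L2 UNIV \<and> f \<in> L2 UNIV \<and> L2_eq f f" "g \<in> L2 UNIV \<and> g \<in> L2 UNIV \<and> L2_eq g g"
    then have i: "integrable lebesgue (\<lambda>x. f x * cnj (g x))" "integrable lebesgue (\<lambda>x. g x * cnj (f x))"
      by (auto intro!: L2_mult_integrable L2_cnj)
    show "Re (L2_inner f g) = Re (L2_inner g f)"
      unfolding L2_inner_def using i by (simp flip: integral_Re add: mult.commute)
  qed
  show "(F + G) \<bullet> K = F \<bullet> K + G \<bullet> K"
  proof transfer
    fix f g k :: "'a \<Rightarrow> complex"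
    assume "f \<in> L2 UNIV \<and> f \<in> L2 UNIV \<and> L2_eq f f" "g \<in> L2 UNIV \<and> g \<in> L2 UNIV \<and> L2_eq g g"
      "k \<in> L2 UNIV \<and> k \<in> L2 UNIV \<and> L2_eq k k"
    then have i: "integrable lebesgue (\<lambda>x. f x * cnj (k x))" "integrable lebesgue (\<lambda>x. g x * cnj (k x))"
      by (auto intro!: L2_mult_integrable L2_cnj)
    then show "Re (L2_inner (\<lambda>x. f x + g x) k) = Re (L2_inner f k) + Re (L2_inner g k)"
      unfolding L2_inner_def by (simp add: distrib_right)
  qed
  show "(r *\<^sub>R F) \<bullet> G = r * (F \<bullet> G)"
    by transfer (simp add: L2_inner_def mult.assoc)
  have self: "Re (L2_inner f f) = (LINT x|lebesgue. (cmod (f x))\<^sup>2)" for f :: "'a \<Rightarrow> complex"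
    by (simp add: L2_inner_def complex_norm_square[symmetric] integral_complex_of_real del: of_real_power)
  show "0 \<le> F \<bullet> F"
    by transfer (simp add: self)
  show "F \<bullet> F = 0 \<longleftrightarrow> F = 0"
  proof transfer
    fix f :: "'a \<Rightarrow> complex"
    assume "f \<in> L2 UNIV \<and> f \<in> L2 UNIV \<and> L2_eq f f"
    then have "f \<in> L2 UNIV" by simp
    from integral_nonneg_eq_0_iff_AE[OF L2_integrable[OF this]] this
    show "(Re (L2_inner f f) = 0) = (f \<in> L2 UNIV \<and> (\<lambda>x. 0) \<in> L2 UNIV \<and> L2_eq f (\<lambda>x. 0))"
      by (simp add: self L2_eq_def L2_zero)
  qed
qed

end

lemma rep_l2_L2: "rep_l2 F \<in> L2 UNIV"
  and abs_rep_l2: "abs_l2 (rep_l2 F) = F"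
  using Quotient_rep_reflp[OF Quotient_l2, of F] Quotient_abs_rep[OF Quotient_l2, of F] by auto

lemma abs_l2_eq_iff: "f \<in> L2 UNIV \<Longrightarrow> g \<in> L2 UNIV \<Longrightarrow> abs_l2 f = abs_l2 g \<longleftrightarrow> L2_eq f g"
  using Quotient_rel_abs2[OF Quotient_l2] Quotient_rel[OF Quotient_l2, of f g] by (auto simp: L2_eq_equiv(1))

lemma rep_abs_l2: "f \<in> L2 UNIV \<Longrightarrow> L2_eq (rep_l2 (abs_l2 f)) f"
  by (subst abs_l2_eq_iff[symmetric]) (simp_all add: rep_l2_L2 abs_rep_l2)

lemma abs_l2_add: "f \<in> L2 UNIV \<Longrightarrow> g \<in> L2 UNIV \<Longrightarrow> abs_l2 f + abs_l2 g = abs_l2 (\<lambda>x. f x + g x)"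
  and abs_l2_diff: "f \<in> L2 UNIV \<Longrightarrow> g \<in> L2 UNIV \<Longrightarrow> abs_l2 f - abs_l2 g = abs_l2 (\<lambda>x. f x - g x)"
  and abs_l2_scaleR: "f \<in> L2 UNIV \<Longrightarrow> r *\<^sub>R abs_l2 f = abs_l2 (\<lambda>x. complex_of_real r * f x)"
  and abs_l2_inner: "f \<in> L2 UNIV \<Longrightarrow> g \<in> L2 UNIV \<Longrightarrow> abs_l2 f \<bullet> abs_l2 g = Re (L2_inner f g)"
  by (simp_all add: plus_l2.abs_eq minus_l2.abs_eq scaleR_l2.abs_eq inner_l2.abs_eq L2_eq_equiv(1))

lemma abs_l2_zero: "abs_l2 (\<lambda>x. 0) = 0"
  by (simp add: zero_l2.abs_eq)

lemma abs_l2_norm: "f \<in> L2 UNIV \<Longrightarrow> norm (abs_l2 f) = L2_norm f"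
  by (simp add: norm_l2_def abs_l2_inner L2_inner_def complex_norm_square[symmetric] integral_complex_of_real L2_norm_def
      del: of_real_power)

instance l2 :: (euclidean_space) banach
proof
  fix X :: "nat \<Rightarrow> 'a l2" assume X: "Cauchy X"
  let ?f = "\<lambda>n. rep_l2 (X n)"
  have nn: "(\<integral>\<^sup>+x. ennreal ((cmod (?f m x - g x))\<^sup>2) \<partial>lebesgue) = ennreal ((norm (X m - abs_l2 g))\<^sup>2)"
    if "g \<in> L2 UNIV" for m g
  proof -
    have "X m - abs_l2 g = abs_l2 (\<lambda>x. ?f m x - g x)"
      by (subst abs_l2_diff[symmetric]) (simp_all add: rep_l2_L2 abs_rep_l2 that)
    then show ?thesis
      using L2_norm_sq_nn_integral[OF L2_diff[OF rep_l2_L2[of "X m"] that]]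
      by (simp add: abs_l2_norm L2_diff rep_l2_L2 that)
  qed
  obtain g where g[measurable]: "g \<in> borel_measurable lebesgue"
    and lim: "\<And>e. e > 0 \<Longrightarrow> \<exists>N. \<forall>n\<ge>N. (\<integral>\<^sup>+x. ennreal ((norm (?f n x - g x))\<^sup>2) \<partial>lebesgue) \<le> ennreal e"
  proof (rule L2_complete[of ?f lebesgue])
    show "?f n \<in> borel_measurable lebesgue" for n by (rule L2_measurable[OF rep_l2_L2])
    fix e :: real assume e: "e > 0"
    then obtain N where N: "\<And>m n. m \<ge> N \<Longrightarrow> n \<ge> N \<Longrightarrow> dist (X m) (X n) < sqrt e"
      using X unfolding Cauchy_def by (meson real_sqrt_gt_zero)
    show "\<exists>N. \<forall>m\<ge>N. \<forall>n\<ge>N. (\<integral>\<^sup>+x. ennreal ((norm (?f m x - ?f n x))\<^sup>2) \<partial>lebesgue) \<le> ennreal e"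
    proof (intro exI allI impI)
      fix m n assume "N \<le> m" "N \<le> n"
      then have "(norm (X m - X n))\<^sup>2 \<le> (sqrt e)\<^sup>2"
        using N[of m n] by (intro power_mono) (auto simp: dist_norm)
      then show "(\<integral>\<^sup>+x. ennreal ((norm (?f m x - ?f n x))\<^sup>2) \<partial>lebesgue) \<le> ennreal e"
        using e by (simp add: nn[OF rep_l2_L2] abs_rep_l2 ennreal_leI)
    qed
  qed (rule that)
  obtain n0 where n0: "(\<integral>\<^sup>+x. ennreal ((norm (?f n0 x - g x))\<^sup>2) \<partial>lebesgue) \<le> ennreal 1"
    using lim[of 1] by auto
  have "(\<lambda>x. ?f n0 x - g x) \<in> L2 UNIV"
  proof -
    note [measurable] = L2_measurable[OF rep_l2_L2[of "X n0"]]
    have "integrable lebesgue (\<lambda>x. (cmod (?f n0 x - g x))\<^sup>2)"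
      using n0 by (intro integrableI_nonneg) (auto intro: le_less_trans)
    then show ?thesis by (auto simp: L2_def)
  qed
  from L2_diff[OF rep_l2_L2[of "X n0"] this] have gL: "g \<in> L2 UNIV" by simp
  have "X \<longlonglongrightarrow> abs_l2 g"
  proof (rule metric_LIMSEQ_I)
    fix e :: real assume e: "e > 0"
    then obtain N where N: "\<And>n. n \<ge> N \<Longrightarrow> (\<integral>\<^sup>+x. ennreal ((norm (?f n x - g x))\<^sup>2) \<partial>lebesgue) \<le> ennreal ((e/2)\<^sup>2)"
      using lim[of "(e/2)\<^sup>2"] by auto
    have "dist (X n) (abs_l2 g) < e" if "n \<ge> N" for n
    proof -
      have "(norm (X n - abs_l2 g))\<^sup>2 \<le> (e/2)\<^sup>2"
        using N[OF that] e unfolding nn[OF gL] by (subst (asm) ennreal_le_iff) auto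
      then have "norm (X n - abs_l2 g) \<le> e/2"
        by (rule power2_le_imp_le) (use e in simp)
      then show ?thesis using e by (simp add: dist_norm)
    qed
    then show "\<exists>no. \<forall>n\<ge>no. dist (X n) (abs_l2 g) < e" by blast
  qed
  then show "convergent X" by (rule convergentI)
qed

section \<open>The semigroup on $L_2$\<close>

lemma AE_lborel_pair: "AE z in (lborel :: ('a::euclidean_space \<times> 'a) measure). P z \<Longrightarrow> AE x in lborel. AE y in lborel. P (x, y)"
  by (rule lborel_pair.AE_pair) (subst lborel_prod)

lemma schur_pairing:
  fixes u v h :: "'a::euclidean_space \<Rightarrow> complex" and k :: "'a \<Rightarrow> real"
  assumes u: "u \<in> L2 UNIV" and v: "v \<in> L2 UNIV" and h: "integrable lebesgue h"
    and k: "k \<in> borel_measurable borel" "\<And>z. 0 \<le> k z" "\<And>z. k (- z) = k z"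
    and \<kappa>: "(\<integral>\<^sup>+z. k z \<partial>lborel) = ennreal \<kappa>" "0 \<le> \<kappa>"
    and le: "AE x in lborel. ennreal (cmod (h x)) \<le> (\<integral>\<^sup>+y. ennreal (k (x - y) * (cmod (v x) * cmod (u y))) \<partial>lborel)"
  shows "cmod (LINT x|lebesgue. h x) \<le> \<kappa> / 2 * ((L2_norm v)\<^sup>2 + (L2_norm u)\<^sup>2)"
proof -
  obtain u' where [measurable]: "u' \<in> borel_measurable borel" and u': "AE x in lborel. u x = u' x"
    using L2_borel_version[OF L2_measurable[OF u]] .
  obtain v' where [measurable]: "v' \<in> borel_measurable borel" and v': "AE x in lborel. v x = v' x"
    using L2_borel_version[OF L2_measurable[OF v]] .
  have nrm: "(\<integral>\<^sup>+x. ennreal ((cmod (f' x))\<^sup>2) \<partial>lborel) = ennreal ((L2_norm f)\<^sup>2)"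
    if "f \<in> L2 UNIV" "AE x in lborel. f x = f' x" for f f' :: "'a \<Rightarrow> complex"
  proof -
    have "(\<integral>\<^sup>+x. ennreal ((cmod (f' x))\<^sup>2) \<partial>lborel) = (\<integral>\<^sup>+x. ennreal ((cmod (f x))\<^sup>2) \<partial>lborel)"
      by (rule nn_integral_cong_AE) (use that(2) in \<open>eventually_elim, simp\<close>)
    then show ?thesis
      using L2_norm_sq_nn_integral[OF that(1)] by (simp add: nn_integral_completion)
  qed
  have "ennreal (cmod (LINT x|lebesgue. h x)) \<le> (\<integral>\<^sup>+x. ennreal (cmod (h x)) \<partial>lebesgue)"
    by (rule integral_norm_bound_ennreal[OF h])
  also have "\<dots> = (\<integral>\<^sup>+x. ennreal (cmod (h x)) \<partial>lborel)"
    by (rule nn_integral_completion)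
  also have "\<dots> \<le> (\<integral>\<^sup>+x. \<integral>\<^sup>+y. ennreal (k (x - y) * (cmod (v' x) * cmod (u' y))) \<partial>lborel \<partial>lborel)"
  proof (rule nn_integral_mono_AE)
    show "AE x in lborel. ennreal (cmod (h x)) \<le> (\<integral>\<^sup>+y. ennreal (k (x - y) * (cmod (v' x) * cmod (u' y))) \<partial>lborel)"
      using le v'
    proof eventually_elim
      case (elim x)
      have "(\<integral>\<^sup>+y. ennreal (k (x - y) * (cmod (v x) * cmod (u y))) \<partial>lborel) = (\<integral>\<^sup>+y. ennreal (k (x - y) * (cmod (v' x) * cmod (u' y))) \<partial>lborel)"
        by (rule nn_integral_cong_AE) (use u' in \<open>eventually_elim, simp add: elim\<close>)
      then show ?case using elim by simp
    qed
  qed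
  also have "\<dots> \<le> ennreal (1/2) * (\<integral>\<^sup>+z. k z \<partial>lborel) * ((\<integral>\<^sup>+x. (cmod (v' x))\<^sup>2 \<partial>lborel) + (\<integral>\<^sup>+x. (cmod (u' x))\<^sup>2 \<partial>lborel))"
    by (rule nn_integral_convolution_le) (use k in auto)
  also have "\<dots> = ennreal (\<kappa> / 2 * ((L2_norm v)\<^sup>2 + (L2_norm u)\<^sup>2))"
  proof -
    have "ennreal (1/2) * ennreal \<kappa> = ennreal (\<kappa> / 2)"
      using \<kappa>(2) by (subst ennreal_mult[symmetric]) auto
    moreover have "ennreal (\<kappa> / 2 * (a + b)) = ennreal (\<kappa> / 2) * (ennreal a + ennreal b)" if "0 \<le> a" "0 \<le> b" for a b
      using that \<kappa>(2) by (subst ennreal_mult) (auto simp: ennreal_plus)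
    ultimately show ?thesis
      unfolding nrm[OF u u'] nrm[OF v v'] \<kappa>(1) by simp
  qed
  finally show ?thesis
    using \<kappa>(2) by (subst (asm) ennreal_le_iff) auto
qed

lemma kernel_action_bound:
  fixes q :: "'a::euclidean_space \<times> 'a \<Rightarrow> real"
  assumes q: "\<And>z. 0 \<le> q z" "AE z in lborel. q z \<le> heat_kernel t (fst z - snd z)"
  shows "AE x in lborel. \<forall>m u. (\<forall>y. cmod (m y) \<le> b x y) \<longrightarrow> integrable lebesgue (\<lambda>y. complex_of_real (q (x, y)) * (m y * u y)) \<longrightarrow>
     ennreal (cmod (LINT y|lebesgue. complex_of_real (q (x, y)) * (m y * u y))) \<le>
       (\<integral>\<^sup>+y. ennreal (heat_kernel t (x - y) * b x y * cmod (u y)) \<partial>lborel)"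
  using AE_lborel_pair[OF q(2)]
proof eventually_elim
  case (elim x)
  show ?case
  proof (intro allI impI)
    fix m u :: "'a \<Rightarrow> complex"
    assume m: "\<forall>y. cmod (m y) \<le> b x y" and i: "integrable lebesgue (\<lambda>y. complex_of_real (q (x, y)) * (m y * u y))"
    have "ennreal (cmod (LINT y|lebesgue. complex_of_real (q (x, y)) * (m y * u y))) \<le> (\<integral>\<^sup>+y. ennreal (cmod (complex_of_real (q (x, y)) * (m y * u y))) \<partial>lebesgue)"
      by (rule integral_norm_bound_ennreal[OF i])
    also have "\<dots> = (\<integral>\<^sup>+y. ennreal (cmod (complex_of_real (q (x, y)) * (m y * u y))) \<partial>lborel)"
      by (rule nn_integral_completion)
    also have "\<dots> \<le> (\<integral>\<^sup>+y. ennreal (heat_kernel t (x - y) * b x y * cmod (u y)) \<partial>lborel)"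
    proof (rule nn_integral_mono_AE)
      show "AE y in lborel. ennreal (cmod (complex_of_real (q (x, y)) * (m y * u y))) \<le> ennreal (heat_kernel t (x - y) * b x y * cmod (u y))"
        using elim
      proof eventually_elim
        case (elim y)
        have "q (x, y) * cmod (m y) \<le> heat_kernel t (x - y) * b x y"
          using elim q(1) m by (intro mult_mono) auto
        then show ?case
          using q(1)[of "(x, y)"] by (intro ennreal_leI) (simp add: norm_mult mult_right_mono flip: mult.assoc)
      qed
    qed
    finally show "ennreal (cmod (LINT y|lebesgue. complex_of_real (q (x, y)) * (m y * u y))) \<le>
       (\<integral>\<^sup>+y. ennreal (heat_kernel t (x - y) * b x y * cmod (u y)) \<partial>lborel)" .
  qed
qed

locale dominated_semigroup =
  fixes \<Omega> :: "'a::euclidean_space set" and T :: "real \<Rightarrow> ('a \<Rightarrow> complex) \<Rightarrow> 'a \<Rightarrow> complex"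
  assumes \<Omega>: "\<Omega> \<in> sets lebesgue"
    and C0: "C0_semigroup \<Omega> T"
    and sa: "selfadjoint_semigroup \<Omega> T"
    and dom: "dominated_by_heat_semigroup \<Omega> T"
begin

lemma T_op: "t \<ge> 0 \<Longrightarrow> bounded_operator \<Omega> (T t)"
  using C0 by (auto simp: C0_semigroup_def)

lemma T_in: "t \<ge> 0 \<Longrightarrow> f \<in> L2 \<Omega> \<Longrightarrow> T t f \<in> L2 \<Omega>"
  using L2_operator.S_in[OF L2_operator.intro[OF T_op]] .

lemma L2_UNIV: "f \<in> L2 \<Omega> \<Longrightarrow> f \<in> L2 UNIV"
  using L2_mono[of \<Omega> UNIV] by auto

lemma kernel:
  assumes "t > 0"
  obtains q :: "'a \<times> 'a \<Rightarrow> real" where "q \<in> borel_measurable borel" "\<And>z. 0 \<le> q z"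
    "\<And>x y. x \<notin> \<Omega> \<or> y \<notin> \<Omega> \<Longrightarrow> q (x, y) = 0"
    "AE z in lborel. q z \<le> heat_kernel t (fst z - snd z)"
    "\<And>f. f \<in> L2 \<Omega> \<Longrightarrow> AE x in lborel. integrable lebesgue (\<lambda>y. complex_of_real (q (x, y)) * f y) \<and>
       T t f x = (LINT y|lebesgue. complex_of_real (q (x, y)) * f y)"
proof (rule heat_dominated_kernel[OF \<Omega> T_op assms])
  show "0 \<le> t" using assms by simp
  show "L2_le (\<lambda>x. 0) (T t f) \<and> L2_le (T t f) (heat_semigroup t f)" if "f \<in> L2 \<Omega>" "L2_le (\<lambda>x. 0) f" for f
    using dom assms that by (auto simp: dominated_by_heat_semigroup_def)
qed (rule that)

lemma T_contraction:
  assumes t: "t > 0" and f: "f \<in> L2 \<Omega>"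
  shows "L2_norm (T t f) \<le> L2_norm f"
proof -
  obtain q :: "'a \<times> 'a \<Rightarrow> real" where "q \<in> borel_measurable borel" and q0: "\<And>z. 0 \<le> q z"
    and "\<And>x y. x \<notin> \<Omega> \<or> y \<notin> \<Omega> \<Longrightarrow> q (x, y) = 0"
    and q1: "AE z in lborel. q z \<le> heat_kernel t (fst z - snd z)"
    and K: "\<And>f. f \<in> L2 \<Omega> \<Longrightarrow> AE x in lborel. integrable lebesgue (\<lambda>y. complex_of_real (q (x, y)) * f y) \<and>
       T t f x = (LINT y|lebesgue. complex_of_real (q (x, y)) * f y)"
    by (rule kernel[OF t]) (rule that)
  note q = q0 q1 and qf = K[OF f]
  let ?g = "T t f"
  have g: "?g \<in> L2 \<Omega>" using T_in t f by simp
  have "cmod (LINT x|lebesgue. ?g x * cnj (?g x)) \<le> 1 / 2 * ((L2_norm ?g)\<^sup>2 + (L2_norm f)\<^sup>2)"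
  proof (rule schur_pairing[where k = "heat_kernel t"])
    show "integrable lebesgue (\<lambda>x. ?g x * cnj (?g x))"
      by (intro L2_mult_integrable[OF g L2_cnj[OF g]])
    show "AE x in lborel. ennreal (cmod (?g x * cnj (?g x))) \<le> (\<integral>\<^sup>+y. ennreal (heat_kernel t (x - y) * (cmod (?g x) * cmod (f y))) \<partial>lborel)"
      using kernel_action_bound[OF q, of "\<lambda>x y. cmod (?g x)"] qf
    proof eventually_elim
      case (elim x)
      have "cnj (?g x) * (LINT y|lebesgue. complex_of_real (q (x, y)) * f y) = (LINT y|lebesgue. complex_of_real (q (x, y)) * (cnj (?g x) * f y))"
        by (subst integral_mult_right_zero[symmetric]) (simp add: mult_ac)
      then have "?g x * cnj (?g x) = (LINT y|lebesgue. complex_of_real (q (x, y)) * (cnj (?g x) * f y))"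
        using elim(2) by (simp add: mult.commute)
      moreover have "integrable lebesgue (\<lambda>y. complex_of_real (q (x, y)) * (cnj (?g x) * f y))"
        using integrable_mult_right[of "cnj (?g x)" lebesgue "\<lambda>y. complex_of_real (q (x, y)) * f y"] elim(2) by (simp add: mult_ac)
      ultimately have "ennreal (cmod (?g x * cnj (?g x))) \<le> (\<integral>\<^sup>+y. ennreal (heat_kernel t (x - y) * cmod (?g x) * cmod (f y)) \<partial>lborel)"
        using elim(1)[rule_format, of "\<lambda>y. cnj (?g x)" f] by (simp only: complex_mod_cnj order_refl)
      then show ?case by (simp add: mult.assoc)
    qed
  qed (use nn_integral_heat_kernel[OF t] f g in \<open>auto intro: L2_UNIV simp: heat_kernel_minus\<close>)
  moreover have "(LINT x|lebesgue. ?g x * cnj (?g x)) = complex_of_real ((L2_norm ?g)\<^sup>2)"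
    unfolding L2_norm_power2 complex_norm_square[symmetric] of_real_power[symmetric] by (rule integral_complex_of_real)
  ultimately have "(L2_norm ?g)\<^sup>2 \<le> (L2_norm f)\<^sup>2"
    by (simp add: power2_abs norm_power L2_norm_nonneg)
  then show ?thesis by (rule power2_le_imp_le) (rule L2_norm_nonneg)
qed

end

definition mul :: "('a::euclidean_space \<Rightarrow> real) \<Rightarrow> 'a l2 \<Rightarrow> 'a l2" where
  "mul m F = abs_l2 (\<lambda>x. complex_of_real (m x) * rep_l2 F x)"

definition bounded_multiplier :: "real \<Rightarrow> ('a::euclidean_space \<Rightarrow> real) \<Rightarrow> bool" where
  "bounded_multiplier C m \<longleftrightarrow> m \<in> borel_measurable lebesgue \<and> (\<forall>x. \<bar>m x\<bar> \<le> C)"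

lemma bounded_multiplier_L2:
  assumes m: "bounded_multiplier C m" and f: "f \<in> L2 \<Omega>"
  shows "(\<lambda>x. complex_of_real (m x) * f x) \<in> L2 \<Omega>"
proof (rule L2_dominated[OF f, where C = C])
  have [measurable]: "m \<in> borel_measurable lebesgue" "f \<in> borel_measurable lebesgue"
    using m L2_measurable[OF f] by (auto simp: bounded_multiplier_def)
  show "(\<lambda>x. complex_of_real (m x) * f x) \<in> borel_measurable lebesgue" by measurable
qed (use m L2_outside[OF f] in \<open>auto simp: bounded_multiplier_def norm_mult intro: mult_right_mono\<close>)

lemma mul_abs:
  assumes m: "bounded_multiplier C m" and f: "f \<in> L2 UNIV"
  shows "mul m (abs_l2 f) = abs_l2 (\<lambda>x. complex_of_real (m x) * f x)"
  unfolding mul_def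
proof (subst abs_l2_eq_iff)
  show "L2_eq (\<lambda>x. complex_of_real (m x) * rep_l2 (abs_l2 f) x) (\<lambda>x. complex_of_real (m x) * f x)"
    using rep_abs_l2[OF f] by (auto simp: L2_eq_def elim: eventually_mono)
qed (intro bounded_multiplier_L2[OF m] f rep_l2_L2)+

lemma l2_cases:
  obtains f where "f \<in> L2 UNIV" "F = abs_l2 f"
  using abs_rep_l2[of F] rep_l2_L2[of F] by metis

lemma mul_mul:
  assumes m: "bounded_multiplier C m" and m': "bounded_multiplier C' m'"
  shows "mul m (mul m' F) = mul (\<lambda>x. m x * m' x) F"
proof (cases F rule: l2_cases)
  case (1 f)
  have "bounded_multiplier (C * C') (\<lambda>x. m x * m' x)"
    using m m' unfolding bounded_multiplier_def
    by (auto simp: abs_mult intro!: mult_mono)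
  then show ?thesis
    using 1 by (simp add: mul_abs[OF m'] mul_abs[OF m] mul_abs bounded_multiplier_L2[OF m'] mult.assoc)
qed

lemma mul_bounded_linear:
  assumes m: "bounded_multiplier C m"
  shows "norm (mul m F) \<le> C * norm F" "bounded_linear (mul m)"
proof -
  have C: "0 \<le> C" using m unfolding bounded_multiplier_def by (meson abs_ge_zero order_trans)
  have b: "norm (mul m F) \<le> C * norm F" for F
  proof (cases F rule: l2_cases)
    case (1 f)
    have L: "(\<lambda>x. complex_of_real (m x) * f x) \<in> L2 UNIV" by (intro bounded_multiplier_L2[OF m] 1)
    have "(L2_norm (\<lambda>x. complex_of_real (m x) * f x))\<^sup>2 \<le> (C * L2_norm f)\<^sup>2"
      unfolding power_mult_distrib L2_norm_power2 integral_mult_right_zero[symmetric]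
    proof (rule integral_mono)
      show "integrable lebesgue (\<lambda>x. C\<^sup>2 * (cmod (f x))\<^sup>2)" using L2_integrable[OF 1(1)] by simp
      show "(cmod (complex_of_real (m x) * f x))\<^sup>2 \<le> C\<^sup>2 * (cmod (f x))\<^sup>2" for x
        unfolding power_mult_distrib[symmetric] norm_mult
        using m by (intro power_mono mult_right_mono) (auto simp: bounded_multiplier_def)
    qed (rule L2_integrable[OF L])
    then show ?thesis
      using 1 C L by (simp add: mul_abs[OF m] abs_l2_norm) (erule power2_le_imp_le, simp add: L2_norm_nonneg)
  qed
  show "norm (mul m F) \<le> C * norm F" by (rule b)
  show "bounded_linear (mul m)"
  proof (rule bounded_linear_intro)
    show "mul m (F + G) = mul m F + mul m G" for F G
    proof (cases F rule: l2_cases)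
      case (1 f)
      show ?thesis
      proof (cases G rule: l2_cases)
        case g: (1 g)
        then show ?thesis
          using 1 by (simp add: abs_l2_add L2_add mul_abs[OF m] bounded_multiplier_L2[OF m] distrib_left)
      qed
    qed
    show "mul m (r *\<^sub>R F) = r *\<^sub>R mul m F" for r F
      by (cases F rule: l2_cases)
        (simp add: abs_l2_scaleR L2_scale mul_abs[OF m] bounded_multiplier_L2[OF m] mult.left_commute)
    show "norm (mul m F) \<le> norm F * C" for F using b[of F] by (simp add: mult.commute)
  qed
qed

lemma mul_sym:
  assumes m: "bounded_multiplier C m"
  shows "mul m F \<bullet> G = F \<bullet> mul m G"
proof (cases F rule: l2_cases)
  case (1 f)
  show ?thesis
  proof (cases G rule: l2_cases)
    case g: (1 g)
    have "L2_inner (\<lambda>x. complex_of_real (m x) * f x) g = L2_inner f (\<lambda>x. complex_of_real (m x) * g x)"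
      by (simp add: L2_inner_def mult_ac)
    then show ?thesis
      using 1 g by (simp add: mul_abs[OF m] abs_l2_inner bounded_multiplier_L2[OF m])
  qed
qed

context dominated_semigroup
begin

abbreviation ind :: "'a \<Rightarrow> real" where "ind \<equiv> indicator \<Omega>"

lemma ind: "bounded_multiplier 1 ind"
  using \<Omega> by (auto simp: bounded_multiplier_def indicator_def intro!: borel_measurable_indicator)

definition cut :: "'a l2 \<Rightarrow> 'a \<Rightarrow> complex" where
  "cut F x = complex_of_real (ind x) * rep_l2 F x"

lemma cut_L2: "cut F \<in> L2 \<Omega>"
proof -
  have "cut F \<in> L2 UNIV"
    unfolding cut_def[abs_def] by (rule bounded_multiplier_L2[OF ind rep_l2_L2])
  then show ?thesis by (auto simp: L2_def cut_def)
qed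

lemma cut_abs: "f \<in> L2 \<Omega> \<Longrightarrow> L2_eq (cut (abs_l2 f)) f"
proof -
  assume f: "f \<in> L2 \<Omega>"
  then have "L2_eq (rep_l2 (abs_l2 f)) f" by (intro rep_abs_l2 L2_UNIV)
  then show ?thesis
    unfolding L2_eq_def
  proof eventually_elim
    case (elim x)
    then show ?case using L2_outside[OF f, of x] by (cases "x \<in> \<Omega>") (auto simp: cut_def)
  qed
qed

lemma abs_cut: "abs_l2 (cut F) = mul ind F"
  by (simp add: mul_def cut_def[abs_def])

text \<open>Cutting off extends \<open>T t\<close> by 0 from $L_2(\Omega)$ to $L_2(\mathbb{R}^d)$.\<close>

definition U :: "real \<Rightarrow> 'a l2 \<Rightarrow> 'a l2" where
  "U t F = abs_l2 (T t (cut F))"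

lemma T_cong: "t \<ge> 0 \<Longrightarrow> f \<in> L2 \<Omega> \<Longrightarrow> g \<in> L2 \<Omega> \<Longrightarrow> L2_eq f g \<Longrightarrow> L2_eq (T t f) (T t g)"
  using L2_operator.S_cong[OF L2_operator.intro[OF T_op]] by (auto simp: L2_eq_def AE_lebesgue_iff)

lemma U_abs:
  assumes "t \<ge> 0" "f \<in> L2 \<Omega>"
  shows "U t (abs_l2 f) = abs_l2 (T t f)"
  unfolding U_def using assms
  by (subst abs_l2_eq_iff) (auto intro!: T_cong cut_abs cut_L2 L2_UNIV T_in)

lemma U_mul_ind: "t \<ge> 0 \<Longrightarrow> U t F = U t (mul ind F)"
  by (simp add: abs_cut[symmetric] U_abs cut_L2) (simp add: U_def)

lemma U_zero: "U 0 F = mul ind F"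
proof -
  have "L2_eq (T 0 (cut F)) (cut F)"
    using C0 cut_L2 by (auto simp: C0_semigroup_def)
  then have "abs_l2 (T 0 (cut F)) = abs_l2 (cut F)"
    by (subst abs_l2_eq_iff) (auto intro!: L2_UNIV T_in cut_L2)
  then show ?thesis by (simp add: U_def abs_cut)
qed

lemma ind_cases:
  obtains f where "f \<in> L2 \<Omega>" "mul ind F = abs_l2 f"
  using abs_cut cut_L2 by metis

lemma mul_ind_fixed: "f \<in> L2 \<Omega> \<Longrightarrow> mul ind (abs_l2 f) = abs_l2 f"
  using U_zero[of "abs_l2 f"] cut_abs[of f] by (simp add: abs_cut[symmetric] abs_l2_eq_iff L2_UNIV cut_L2)

lemma U_contraction: "t \<ge> 0 \<Longrightarrow> norm (U t F) \<le> norm F"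
proof -
  assume t: "t \<ge> 0"
  have "norm (U t (mul ind F)) \<le> norm (mul ind F)"
  proof (cases "t = 0")
    case True
    then show ?thesis using mul_bounded_linear(1)[OF ind, of "mul ind F"] by (simp add: U_zero)
  next
    case False
    then have "t > 0" using t by simp
    show ?thesis
      by (cases rule: ind_cases[of F]) (use T_contraction[OF \<open>t > 0\<close>] t in \<open>simp add: U_abs abs_l2_norm L2_UNIV T_in\<close>)
  qed
  also have "norm (mul ind F) \<le> norm F"
    using mul_bounded_linear(1)[OF ind, of F] by simp
  finally show ?thesis using U_mul_ind[OF t, of F] by simp
qed

lemma U_bounded_linear: "t \<ge> 0 \<Longrightarrow> bounded_linear (U t)"
proof (rule bounded_linear_intro[where K = 1])
  assume t: "t \<ge> 0"
  interpret S: L2_operator \<Omega> "T t" by (rule L2_operator.intro[OF T_op[OF t]])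
  show "norm (U t F) \<le> norm F * 1" for F using U_contraction[OF t] by simp
  have i: "mul ind (F + G) = mul ind F + mul ind G" "mul ind (r *\<^sub>R F) = r *\<^sub>R mul ind F" for F G r
    using mul_bounded_linear(2)[OF ind] by (simp_all add: linear_add linear_scale bounded_linear.linear)
  show "U t (F + G) = U t F + U t G" for F G
  proof -
    obtain f where f: "f \<in> L2 \<Omega>" "mul ind F = abs_l2 f" by (rule ind_cases)
    obtain g where g: "g \<in> L2 \<Omega>" "mul ind G = abs_l2 g" by (rule ind_cases)
    have "abs_l2 (T t (\<lambda>x. f x + g x)) = abs_l2 (\<lambda>x. T t f x + T t g x)"
      using S.S_add[OF f(1) g(1)] f g t by (subst abs_l2_eq_iff) (auto simp: L2_eq_def AE_lebesgue_iff intro!: L2_UNIV T_in L2_add)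
    then have "U t (mul ind F + mul ind G) = U t (mul ind F) + U t (mul ind G)"
      using f g t by (simp add: abs_l2_add U_abs L2_UNIV T_in L2_add)
    then show ?thesis using U_mul_ind[OF t] i(1) by metis
  qed
  show "U t (r *\<^sub>R F) = r *\<^sub>R U t F" for r F
  proof -
    obtain f where f: "f \<in> L2 \<Omega>" "mul ind F = abs_l2 f" by (rule ind_cases)
    have "abs_l2 (T t (\<lambda>x. complex_of_real r * f x)) = abs_l2 (\<lambda>x. complex_of_real r * T t f x)"
      using S.S_scale[OF f(1)] f t by (subst abs_l2_eq_iff) (auto simp: L2_eq_def AE_lebesgue_iff intro!: L2_UNIV T_in L2_scale)
    then have "U t (r *\<^sub>R mul ind F) = r *\<^sub>R U t (mul ind F)"
      using f t by (simp add: abs_l2_scaleR U_abs L2_UNIV T_in L2_scale)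
    then show ?thesis using U_mul_ind[OF t] i(2) by metis
  qed
qed

lemma U_add: "s \<ge> 0 \<Longrightarrow> t \<ge> 0 \<Longrightarrow> U (s + t) F = U s (U t F)"
proof -
  assume st: "s \<ge> 0" "t \<ge> 0"
  have "L2_eq (T (s + t) (cut F)) (T s (T t (cut F)))"
    using C0 st cut_L2 by (auto simp: C0_semigroup_def)
  then have "abs_l2 (T (s + t) (cut F)) = abs_l2 (T s (T t (cut F)))"
    using st by (subst abs_l2_eq_iff) (auto intro!: L2_UNIV T_in cut_L2)
  then show ?thesis
    using st by (simp add: U_def[of "s+t"] U_def[of t] U_abs T_in cut_L2)
qed

lemma U_strong: "((\<lambda>t. U t F) \<longlongrightarrow> U 0 F) (at_right 0)"
proof -
  have "((\<lambda>t. L2_norm (\<lambda>x. T t (cut F) x - cut F x)) \<longlongrightarrow> 0) (at_right 0)"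
    using C0 cut_L2 by (auto simp: C0_semigroup_def)
  then have "((\<lambda>t. norm (U t F - U 0 F)) \<longlongrightarrow> 0) (at_right 0)"
  proof (rule Lim_transform_eventually)
    show "\<forall>\<^sub>F t in at_right 0. L2_norm (\<lambda>x. T t (cut F) x - cut F x) = norm (U t F - U 0 F)"
      using eventually_at_right_less[of 0]
    proof eventually_elim
      case (elim t)
      then show ?case
        by (simp add: U_def[of t] U_zero abs_cut[symmetric] abs_l2_diff abs_l2_norm L2_diff L2_UNIV T_in cut_L2)
    qed
  qed
  then show ?thesis by (subst Lim_null) (rule tendsto_norm_zero_cancel)
qed

lemma U_inner_ind: "t \<ge> 0 \<Longrightarrow> U t F \<bullet> G = U t (mul ind F) \<bullet> mul ind G"
proof -
  assume t: "t \<ge> 0"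
  have "U t F = mul ind (U t F)"
    using U_add[of 0 t F] t by (simp add: U_zero)
  then have "U t F \<bullet> G = U t F \<bullet> mul ind G"
    using mul_sym[OF ind] by metis
  then show ?thesis using U_mul_ind[OF t, of F] by simp
qed

lemma U_sym: "t \<ge> 0 \<Longrightarrow> U t F \<bullet> G = F \<bullet> U t G"
proof -
  assume t: "t \<ge> 0"
  obtain f where f: "f \<in> L2 \<Omega>" "mul ind F = abs_l2 f" by (rule ind_cases)
  obtain g where g: "g \<in> L2 \<Omega>" "mul ind G = abs_l2 g" by (rule ind_cases)
  have "L2_inner (T t f) g = L2_inner f (T t g)"
    using sa f g t by (auto simp: selfadjoint_semigroup_def)
  then have "U t (mul ind F) \<bullet> mul ind G = mul ind F \<bullet> U t (mul ind G)"
    using f g t by (simp add: U_abs abs_l2_inner L2_UNIV T_in)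
  then show ?thesis
    using U_inner_ind[OF t, of F G] U_inner_ind[OF t, of G F] by (simp add: inner_commute)
qed

sublocale U: selfadjoint_contraction_semigroup U
  by (intro selfadjoint_contraction_semigroup.intro bounded_semigroup.intro selfadjoint_contraction_semigroup_axioms.intro
      U_bounded_linear U_add U_strong U_sym) (simp_all add: U_contraction)

lemma gen_iff:
  assumes f: "f \<in> L2 \<Omega>" and g: "g \<in> L2 \<Omega>"
  shows "(f, g) \<in> generator \<Omega> T \<longleftrightarrow> U.gen (abs_l2 f) (abs_l2 g)"
proof -
  have "((\<lambda>t. L2_norm (\<lambda>x. (T t f x - f x) / complex_of_real t - g x)) \<longlongrightarrow> 0) (at_right 0)
    \<longleftrightarrow> ((\<lambda>h. norm ((U h (abs_l2 f) - abs_l2 f) /\<^sub>R h - abs_l2 g)) \<longlongrightarrow> 0) (at_right 0)"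
  proof (rule tendsto_cong)
    show "\<forall>\<^sub>F t in at_right 0. L2_norm (\<lambda>x. (T t f x - f x) / complex_of_real t - g x) = norm ((U t (abs_l2 f) - abs_l2 f) /\<^sub>R t - abs_l2 g)"
      using eventually_at_right_less[of 0]
    proof eventually_elim
      case (elim t)
      have "(U t (abs_l2 f) - abs_l2 f) /\<^sub>R t - abs_l2 g = abs_l2 (\<lambda>x. complex_of_real (inverse t) * (T t f x - f x) - g x)"
        using elim f g
        by (simp add: U_abs abs_l2_diff abs_l2_scaleR L2_diff L2_scale L2_UNIV T_in)
      moreover have "(\<lambda>x. complex_of_real (inverse t) * (T t f x - f x) - g x) \<in> L2 UNIV"
        using elim f g by (intro L2_diff L2_scale L2_UNIV T_in) auto
      ultimately show ?case
        by (simp add: abs_l2_norm divide_inverse mult.commute)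
    qed
  qed
  also have "\<dots> \<longleftrightarrow> ((\<lambda>h. (U h (abs_l2 f) - abs_l2 f) /\<^sub>R h) \<longlongrightarrow> abs_l2 g) (at_right 0)"
    unfolding tendsto_norm_zero_iff by (rule Lim_null[symmetric])
  finally show ?thesis
    using f g by (simp add: generator_def U.gen_def U_zero mul_ind_fixed)
qed

lemma gen_cases:
  assumes "U.gen F G"
  obtains f g where "f \<in> L2 \<Omega>" "g \<in> L2 \<Omega>" "F = abs_l2 f" "G = abs_l2 g" "(f, g) \<in> generator \<Omega> T"
proof -
  have "mul ind F = F" "mul ind G = G" using assms by (auto simp: U.gen_def U_zero)
  then obtain f g where fg: "f \<in> L2 \<Omega>" "F = abs_l2 f" "g \<in> L2 \<Omega>" "G = abs_l2 g"
    by (metis ind_cases)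
  then show ?thesis using that gen_iff assms by metis
qed

lemma L2_eq_lincomb:
  assumes "f \<in> L2 \<Omega>" "g \<in> L2 \<Omega>"
  shows "r *\<^sub>R abs_l2 f + abs_l2 g = abs_l2 (\<lambda>x. complex_of_real r * f x - (- g x))"
    "(\<lambda>x. complex_of_real r * f x - (- g x)) \<in> L2 \<Omega>"
  using assms by (simp_all add: abs_l2_scaleR abs_l2_add L2_UNIV L2_scale L2_add)

lemma regular_iff: "complex_of_real r \<in> resolvent_set \<Omega> (neg_operator (generator \<Omega> T)) \<longleftrightarrow> U.regular r"
proof -
  let ?z = "complex_of_real r"
  let ?A = "generator \<Omega> T"
  have gl: "f \<in> L2 \<Omega>" "g \<in> L2 \<Omega>" if "(f, g) \<in> ?A" for f g
    using that by (auto simp: generator_def)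
  have res: "?z \<in> resolvent_set \<Omega> (neg_operator ?A) \<longleftrightarrow>
     (\<forall>f g. (f, g) \<in> ?A \<longrightarrow> L2_eq (\<lambda>x. ?z * f x - (- g x)) (\<lambda>x. 0) \<longrightarrow> L2_eq f (\<lambda>x. 0)) \<and>
     (\<forall>h\<in>L2 \<Omega>. \<exists>f g. (f, g) \<in> ?A \<and> L2_eq (\<lambda>x. ?z * f x - (- g x)) h) \<and>
     (\<exists>C. \<forall>f g. (f, g) \<in> ?A \<longrightarrow> L2_norm f \<le> C * L2_norm (\<lambda>x. ?z * f x - (- g x)))"
  proof -
    have "(\<forall>(f, g)\<in>neg_operator ?A. P f g) \<longleftrightarrow> (\<forall>f g. (f, g) \<in> ?A \<longrightarrow> P f (\<lambda>x. - g x))"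
      "(\<exists>(f, g)\<in>neg_operator ?A. P f g) \<longleftrightarrow> (\<exists>f g. (f, g) \<in> ?A \<and> P f (\<lambda>x. - g x))" for P
      by (auto simp: neg_operator_def)
    then show ?thesis
      unfolding resolvent_set_def by (simp only: mem_Collect_eq)
  qed
  have all: "(\<forall>f g. (f, g) \<in> ?A \<longrightarrow> Q (abs_l2 f) (abs_l2 g)) \<longleftrightarrow> (\<forall>F G. U.gen F G \<longrightarrow> Q F G)" for Q
  proof (intro iffI allI impI)
    fix F G assume Q: "\<forall>f g. (f, g) \<in> ?A \<longrightarrow> Q (abs_l2 f) (abs_l2 g)" and "U.gen F G"
    from this(2) show "Q F G" by (rule gen_cases) (use Q in auto)
  next
    fix f g assume Q: "\<forall>F G. U.gen F G \<longrightarrow> Q F G" and fg: "(f, g) \<in> ?A"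
    show "Q (abs_l2 f) (abs_l2 g)"
      using gen_iff[OF gl[OF fg]] fg Q by blast
  qed
  have ex: "(\<exists>f g. (f, g) \<in> ?A \<and> Q (abs_l2 f) (abs_l2 g)) \<longleftrightarrow> (\<exists>F G. U.gen F G \<and> Q F G)" for Q
    using all[of "\<lambda>F G. \<not> Q F G"] by blast
  have comb: "L2_eq (\<lambda>x. ?z * f x - (- g x)) h \<longleftrightarrow> r *\<^sub>R abs_l2 f + abs_l2 g = abs_l2 h"
    if "(f, g) \<in> ?A" "h \<in> L2 \<Omega>" for f g h
    using gl[OF that(1)] that(2) L2_eq_lincomb[of f g r] by (simp add: abs_l2_eq_iff L2_UNIV)
  have zero: "L2_eq f (\<lambda>x. 0) \<longleftrightarrow> abs_l2 f = 0" if "(f, g) \<in> ?A" for f g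
    using gl[OF that] abs_l2_eq_iff[of f "\<lambda>x. 0"] by (simp add: abs_l2_zero L2_UNIV L2_zero)
  have "(\<forall>f g. (f, g) \<in> ?A \<longrightarrow> L2_eq (\<lambda>x. ?z * f x - (- g x)) (\<lambda>x. 0) \<longrightarrow> L2_eq f (\<lambda>x. 0))
    \<longleftrightarrow> (\<forall>F G. U.gen F G \<longrightarrow> r *\<^sub>R F + G = 0 \<longrightarrow> F = 0)"
    unfolding all[of "\<lambda>F G. r *\<^sub>R F + G = 0 \<longrightarrow> F = 0", symmetric]
    using comb[OF _ L2_zero] zero unfolding abs_l2_zero by blast
  moreover have "(\<forall>h\<in>L2 \<Omega>. \<exists>f g. (f, g) \<in> ?A \<and> L2_eq (\<lambda>x. ?z * f x - (- g x)) h)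
    \<longleftrightarrow> (\<forall>H. U 0 H = H \<longrightarrow> (\<exists>F G. U.gen F G \<and> r *\<^sub>R F + G = H))"
  proof -
    have fixed: "(\<forall>h\<in>L2 \<Omega>. Q (abs_l2 h)) \<longleftrightarrow> (\<forall>H. U 0 H = H \<longrightarrow> Q H)" for Q
    proof (intro iffI allI impI ballI)
      fix H assume Q: "\<forall>h\<in>L2 \<Omega>. Q (abs_l2 h)" and H: "U 0 H = H"
      obtain h where "h \<in> L2 \<Omega>" "mul ind H = abs_l2 h" by (rule ind_cases)
      moreover from this have "H = abs_l2 h" using H by (simp only: U_zero)
      ultimately show "Q H" using Q by simp
    qed (simp add: U_zero mul_ind_fixed)
    have "(\<exists>f g. (f, g) \<in> ?A \<and> L2_eq (\<lambda>x. ?z * f x - (- g x)) h) \<longleftrightarrow> (\<exists>F G. U.gen F G \<and> r *\<^sub>R F + G = abs_l2 h)"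
      if "h \<in> L2 \<Omega>" for h
      unfolding ex[of "\<lambda>F G. r *\<^sub>R F + G = abs_l2 h", symmetric] using comb[OF _ that] by blast
    then show ?thesis
      unfolding fixed[symmetric] by blast
  qed
  moreover have "(\<forall>f g. (f, g) \<in> ?A \<longrightarrow> L2_norm f \<le> C * L2_norm (\<lambda>x. ?z * f x - (- g x)))
    \<longleftrightarrow> (\<forall>F G. U.gen F G \<longrightarrow> norm F \<le> C * norm (r *\<^sub>R F + G))" for C
  proof -
    have "L2_norm f = norm (abs_l2 f)" "L2_norm (\<lambda>x. ?z * f x - (- g x)) = norm (r *\<^sub>R abs_l2 f + abs_l2 g)"
      if "(f, g) \<in> ?A" for f g
      using gl[OF that] L2_eq_lincomb[of f g r] by (simp_all add: abs_l2_norm L2_UNIV)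
    then show ?thesis
      unfolding all[of "\<lambda>F G. norm F \<le> C * norm (r *\<^sub>R F + G)", symmetric] by auto
  qed
  ultimately show ?thesis
    unfolding res U.regular_def by simp
qed

lemma U_spectral_bound:
  assumes "E = Inf {r. complex_of_real r \<in> spectrum \<Omega> (neg_operator (generator \<Omega> T))}" and "t \<ge> 0"
  shows "norm (U t F) \<le> exp (- E * t) * norm F"
  using assms by (intro U.spectral_bound) (simp_all add: spectrum_def regular_iff)

end

section \<open>Exponentially weighted semigroups\<close>

definition clamp_inner :: "'a::euclidean_space \<Rightarrow> real \<Rightarrow> 'a \<Rightarrow> real" where
  "clamp_inner \<xi> R x = max (- R) (min R (\<xi> \<bullet> x))"

lemma clamp_inner_bounds: "R \<ge> 0 \<Longrightarrow> \<bar>clamp_inner \<xi> R x\<bar> \<le> R"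
  by (auto simp: clamp_inner_def)

lemma clamp_inner_lipschitz: "\<bar>clamp_inner \<xi> R x - clamp_inner \<xi> R y\<bar> \<le> \<bar>\<xi> \<bullet> (x - y)\<bar>"
  by (auto simp: clamp_inner_def inner_diff_right)

lemma clamp_inner_minus: "R \<ge> 0 \<Longrightarrow> clamp_inner (- \<xi>) R x = - clamp_inner \<xi> R x"
  by (auto simp: clamp_inner_def)

lemma clamp_inner_measurable [measurable]: "clamp_inner \<xi> R \<in> borel_measurable borel"
  unfolding clamp_inner_def[abs_def] by measurable

definition expw :: "'a::euclidean_space \<Rightarrow> real \<Rightarrow> 'a \<Rightarrow> real" where
  "expw \<xi> R x = exp (clamp_inner \<xi> R x)"

lemma expw_bounded_multiplier: "R \<ge> 0 \<Longrightarrow> bounded_multiplier (exp R) (expw \<xi> R)"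
proof -
  assume R: "R \<ge> 0"
  have "expw \<xi> R \<in> borel_measurable lborel"
    unfolding expw_def[abs_def] by measurable
  then have "expw \<xi> R \<in> borel_measurable lebesgue" by (rule measurable_completion)
  then show ?thesis
    using clamp_inner_bounds[OF R, of \<xi>] by (auto simp: bounded_multiplier_def expw_def abs_le_iff)
qed

lemma mul_one: "mul (\<lambda>x. 1) F = F"
  by (simp add: mul_def abs_rep_l2)

lemma mul_expw_inverse:
  assumes R: "R \<ge> 0"
  shows "mul (expw \<xi> R) (mul (expw (- \<xi>) R) F) = F"
  using mul_mul[OF expw_bounded_multiplier[OF R] expw_bounded_multiplier[OF R], of \<xi> "- \<xi>" F]
  by (simp add: expw_def clamp_inner_minus[OF R] mult_exp_exp mul_one)

lemma mul_commute:
  assumes "bounded_multiplier C m" "bounded_multiplier C' m'"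
  shows "mul m (mul m' F) = mul m' (mul m F)"
  using mul_mul[OF assms, of F] mul_mul[OF assms(2,1), of F] by (simp add: mult.commute)

context dominated_semigroup
begin

definition W :: "'a \<Rightarrow> real \<Rightarrow> real \<Rightarrow> 'a l2 \<Rightarrow> 'a l2" where
  "W \<xi> R t F = mul (expw \<xi> R) (U t (mul (expw (- \<xi>) R) F))"

text \<open>By selfadjointness only the symmetric part of the weight matters, and its excess over 1,
  \<open>cosh (\<xi> \<bullet> (x - y)) - 1\<close>, is nonnegative, so that domination by the free kernel can be used.\<close>

lemma weighted_numerical_range:
  assumes h: "h > 0" and R: "R \<ge> 0"
  shows "W \<xi> R h F \<bullet> F \<le> U h F \<bullet> F + (exp (h * (norm \<xi>)\<^sup>2) - 1) * (norm F)\<^sup>2"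
proof -
  let ?p = "expw \<xi> R" and ?m = "expw (- \<xi>) R"
  note bp = expw_bounded_multiplier[OF R, of \<xi>] and bm = expw_bounded_multiplier[OF R, of "- \<xi>"]
  obtain f where f: "f \<in> L2 \<Omega>" "mul ind F = abs_l2 f" by (rule ind_cases)
  let ?pf = "\<lambda>x. complex_of_real (?p x) * f x" and ?mf = "\<lambda>x. complex_of_real (?m x) * f x"
  have pf: "?pf \<in> L2 \<Omega>" "mul ind (mul ?p F) = abs_l2 ?pf"
    using bounded_multiplier_L2[OF bp f(1)] f mul_commute[OF ind bp, of F] mul_abs[OF bp L2_UNIV[OF f(1)]] by auto
  have mf: "?mf \<in> L2 \<Omega>" "mul ind (mul ?m F) = abs_l2 ?mf"
    using bounded_multiplier_L2[OF bm f(1)] f mul_commute[OF ind bm, of F] mul_abs[OF bm L2_UNIV[OF f(1)]] by auto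
  have UU: "U h X \<bullet> Y = Re (L2_inner (T h a) b)" if "a \<in> L2 \<Omega>" "mul ind X = abs_l2 a" "b \<in> L2 \<Omega>" "mul ind Y = abs_l2 b" for X Y a b
    using U_inner_ind[of h X Y] h that by (simp add: U_abs abs_l2_inner L2_UNIV T_in)
  have W1: "W \<xi> R h F \<bullet> F = Re (L2_inner (T h ?mf) ?pf)"
    unfolding W_def mul_sym[OF bp] using UU[OF mf pf] .
  also have "\<dots> = U h (mul ?m F) \<bullet> mul ?p F" using UU[OF mf pf] by simp
  also have "\<dots> = U h (mul ?p F) \<bullet> mul ?m F"
    using U_sym[of h "mul ?m F" "mul ?p F"] h by (simp add: inner_commute)
  also have "\<dots> = Re (L2_inner (T h ?pf) ?mf)" using UU[OF pf mf] .
  finally have W2: "W \<xi> R h F \<bullet> F = Re (L2_inner (T h ?pf) ?mf)" .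
  have U0: "U h F \<bullet> F = Re (L2_inner (T h f) f)" using UU[OF f f] .
  have Th: "T h f \<in> L2 \<Omega>" "T h ?pf \<in> L2 \<Omega>" "T h ?mf \<in> L2 \<Omega>"
    using T_in[of h] h f pf mf by auto
  define H where "H x = (complex_of_real (?p x) * T h ?mf x + complex_of_real (?m x) * T h ?pf x - 2 * T h f x) * cnj (f x)" for x
  have i1: "integrable lebesgue (\<lambda>x. T h ?mf x * cnj (?pf x))"
    and i2: "integrable lebesgue (\<lambda>x. T h ?pf x * cnj (?mf x))"
    and i3: "integrable lebesgue (\<lambda>x. T h f x * cnj (f x))"
    using Th f(1) pf(1) mf(1) by (auto intro!: L2_mult_integrable L2_cnj simp del: complex_cnj_mult)
  have H_eq: "H = (\<lambda>x. T h ?mf x * cnj (?pf x) + T h ?pf x * cnj (?mf x) - 2 * (T h f x * cnj (f x)))"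
    by (auto simp: H_def fun_eq_iff algebra_simps)
  have H_int: "integrable lebesgue H"
    unfolding H_eq using i1 i2 i3 by (intro Bochner_Integration.integrable_diff Bochner_Integration.integrable_add integrable_mult_right)
  have "(LINT x|lebesgue. H x) = L2_inner (T h ?mf) ?pf + L2_inner (T h ?pf) ?mf - 2 * L2_inner (T h f) f"
    unfolding H_eq L2_inner_def using i1 i2 i3 by (simp del: complex_cnj_mult)
  then have ReH: "Re (LINT x|lebesgue. H x) = 2 * (W \<xi> R h F \<bullet> F) - 2 * (U h F \<bullet> F)"
    using W1 W2 U0 by simp
  obtain q :: "'a \<times> 'a \<Rightarrow> real" where "q \<in> borel_measurable borel" and q0: "\<And>z. 0 \<le> q z"
    and "\<And>x y. x \<notin> \<Omega> \<or> y \<notin> \<Omega> \<Longrightarrow> q (x, y) = 0"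
    and q1: "AE z in lborel. q z \<le> heat_kernel h (fst z - snd z)"
    and K: "\<And>f. f \<in> L2 \<Omega> \<Longrightarrow> AE x in lborel. integrable lebesgue (\<lambda>y. complex_of_real (q (x, y)) * f y) \<and>
       T h f x = (LINT y|lebesgue. complex_of_real (q (x, y)) * f y)"
    by (rule kernel[OF h]) (rule that)
  let ?\<kappa> = "2 * (exp (h * (norm \<xi>)\<^sup>2) - 1)"
  let ?k = "\<lambda>z. 2 * (heat_kernel h z * (cosh (\<xi> \<bullet> z) - 1))"
  have c1: "1 \<le> cosh r" for r :: real by (rule cosh_real_ge_1)
  have k0: "0 \<le> heat_kernel h z * (cosh (\<xi> \<bullet> z) - 1)" for z
    using c1[of "\<xi> \<bullet> z"] by simp
  have km: "(\<lambda>z. heat_kernel h z * (cosh (\<xi> \<bullet> z) - 1)) \<in> borel_measurable borel"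
    unfolding cosh_def by measurable
  have "cmod (LINT x|lebesgue. H x) \<le> ?\<kappa> / 2 * ((L2_norm f)\<^sup>2 + (L2_norm f)\<^sup>2)"
  proof (rule schur_pairing[where k = ?k])
    have "(\<integral>\<^sup>+z. ennreal (?k z) \<partial>lborel) = 2 * (\<integral>\<^sup>+z. ennreal (heat_kernel h z * (cosh (\<xi> \<bullet> z) - 1)) \<partial>lborel)"
      using k0 km by (subst nn_integral_cmult[symmetric]) (auto simp: ennreal_mult)
    also have "\<dots> = ennreal ?\<kappa>"
      unfolding nn_integral_heat_kernel_cosh[OF h] using h by (subst ennreal_mult) auto
    finally show "(\<integral>\<^sup>+z. ennreal (?k z) \<partial>lborel) = ennreal ?\<kappa>" .
    show "AE x in lborel. ennreal (cmod (H x)) \<le> (\<integral>\<^sup>+y. ennreal (?k (x - y) * (cmod (f x) * cmod (f y))) \<partial>lborel)"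
      using kernel_action_bound[OF q0 q1, of "\<lambda>x y. cmod (f x) * (2 * (cosh (\<xi> \<bullet> (x - y)) - 1))"] K[OF f(1)] K[OF pf(1)] K[OF mf(1)]
    proof eventually_elim
      case (elim x)
      let ?mm = "\<lambda>y. cnj (f x) * complex_of_real (?p x * ?m y + ?m x * ?p y - 2)"
      let ?Q = "\<lambda>y. complex_of_real (q (x, y))"
      have ii: "integrable lebesgue (\<lambda>y. cnj (f x) * complex_of_real (?p x) * (?Q y * ?mf y))"
        "integrable lebesgue (\<lambda>y. cnj (f x) * complex_of_real (?m x) * (?Q y * ?pf y))"
        "integrable lebesgue (\<lambda>y. cnj (f x) * 2 * (?Q y * f y))"
        using elim by (auto intro!: integrable_mult_right)
      have eq: "?Q y * (?mm y * f y) = cnj (f x) * complex_of_real (?p x) * (?Q y * ?mf y) + cnj (f x) * complex_of_real (?m x) * (?Q y * ?pf y) - cnj (f x) * 2 * (?Q y * f y)" for y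
        by (simp add: algebra_simps)
      have "(LINT y|lebesgue. ?Q y * (?mm y * f y)) = cnj (f x) * complex_of_real (?p x) * T h ?mf x + cnj (f x) * complex_of_real (?m x) * T h ?pf x - cnj (f x) * 2 * T h f x"
        unfolding eq using ii elim(2-4)
        by (simp only: Bochner_Integration.integral_diff Bochner_Integration.integral_add Bochner_Integration.integrable_add integral_mult_right_zero)
      then have "H x = (LINT y|lebesgue. ?Q y * (?mm y * f y))"
        by (simp add: H_def algebra_simps)
      moreover have "integrable lebesgue (\<lambda>y. ?Q y * (?mm y * f y))"
        unfolding eq by (intro Bochner_Integration.integrable_diff Bochner_Integration.integrable_add ii)
      moreover have "cmod (?mm y) \<le> cmod (f x) * (2 * (cosh (\<xi> \<bullet> (x - y)) - 1))" for y
      proof -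
        let ?d = "clamp_inner \<xi> R x - clamp_inner \<xi> R y"
        have "?p x * ?m y + ?m x * ?p y = 2 * cosh ?d"
          by (simp add: expw_def clamp_inner_minus[OF R] cosh_def mult_exp_exp)
        moreover have "cosh ?d \<le> cosh (\<xi> \<bullet> (x - y))"
          using cosh_real_nonneg_le_iff[of "\<bar>?d\<bar>" "\<bar>\<xi> \<bullet> (x - y)\<bar>"] clamp_inner_lipschitz[of \<xi> R x y] by simp
        ultimately have "\<bar>?p x * ?m y + ?m x * ?p y - 2\<bar> \<le> 2 * (cosh (\<xi> \<bullet> (x - y)) - 1)"
          using c1[of ?d] by simp
        then show ?thesis
          unfolding norm_mult complex_mod_cnj norm_of_real by (rule mult_left_mono) simp
      qed
      ultimately have "ennreal (cmod (H x)) \<le> (\<integral>\<^sup>+y. ennreal (heat_kernel h (x - y) * (cmod (f x) * (2 * (cosh (\<xi> \<bullet> (x - y)) - 1))) * cmod (f y)) \<partial>lborel)"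
        using elim(1)[rule_format, of ?mm f] by simp
      then show ?case by (simp only: mult_ac)
    qed
  qed (use f(1) H_int k0 km h in \<open>auto intro: L2_UNIV simp: heat_kernel_minus\<close>)
  then have "2 * (W \<xi> R h F \<bullet> F) - 2 * (U h F \<bullet> F) \<le> ?\<kappa> * (L2_norm f)\<^sup>2"
    using complex_Re_le_cmod[of "LINT x|lebesgue. H x"] ReH by simp
  moreover have "(L2_norm f)\<^sup>2 \<le> (norm F)\<^sup>2"
  proof (rule power_mono)
    show "L2_norm f \<le> norm F"
      using mul_bounded_linear(1)[OF ind, of F] f by (simp add: abs_l2_norm L2_UNIV)
  qed (rule L2_norm_nonneg)
  then have "?\<kappa> * (L2_norm f)\<^sup>2 \<le> ?\<kappa> * (norm F)\<^sup>2"
    using h by (intro mult_left_mono) auto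
  ultimately have "2 * (W \<xi> R h F \<bullet> F) \<le> 2 * (U h F \<bullet> F) + ?\<kappa> * (norm F)\<^sup>2" by linarith
  then show ?thesis by (simp only: mult.assoc)
qed

lemma W_bounded_semigroup:
  assumes R: "R \<ge> 0"
  shows "bounded_semigroup (W \<xi> R) (exp R * exp R)"
proof (rule bounded_semigroup.intro)
  note bp = expw_bounded_multiplier[OF R, of \<xi>] and bm = expw_bounded_multiplier[OF R, of "- \<xi>"]
  show "bounded_linear (W \<xi> R t)" if "t \<ge> 0" for t
    unfolding W_def[abs_def]
    by (intro bounded_linear_compose[OF mul_bounded_linear(2)[OF bp]] bounded_linear_compose[OF U_bounded_linear[OF that]] mul_bounded_linear(2)[OF bm])
  show "W \<xi> R (s + t) F = W \<xi> R s (W \<xi> R t F)" if "s \<ge> 0" "t \<ge> 0" for s t F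
    using mul_expw_inverse[OF R, of "- \<xi>"] by (simp add: W_def U_add[OF that])
  show "norm (W \<xi> R t F) \<le> exp R * exp R * norm F" if "t \<ge> 0" for t F
  proof -
    have "norm (W \<xi> R t F) \<le> exp R * norm (U t (mul (expw (- \<xi>) R) F))"
      unfolding W_def by (rule mul_bounded_linear(1)[OF bp])
    also have "\<dots> \<le> exp R * (exp R * norm F)"
      using U_contraction[OF that] mul_bounded_linear(1)[OF bm, of F] by (intro mult_left_mono) (auto intro: order_trans)
    finally show ?thesis by (simp add: mult.assoc)
  qed
  show "((\<lambda>t. W \<xi> R t F) \<longlongrightarrow> W \<xi> R 0 F) (at_right 0)" for F
    unfolding W_def by (intro bounded_linear.tendsto[OF mul_bounded_linear(2)[OF bp]] U_strong)
qed

lemma weighted_growth: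
  assumes E: "\<And>h F. h \<ge> 0 \<Longrightarrow> norm (U h F) \<le> exp (- E * h) * norm F"
    and R: "R \<ge> 0" and t: "t \<ge> 0" and F: "W \<xi> R 0 F = F"
  shows "norm (W \<xi> R t F) \<le> exp (((norm \<xi>)\<^sup>2 - E) * t) * norm F"
proof (rule bounded_semigroup.growth_bound[OF W_bounded_semigroup[OF R] _ _ F t])
  let ?\<beta> = "\<lambda>h. exp (- E * h) + (exp (h * (norm \<xi>)\<^sup>2) - 1)"
  show "W \<xi> R h u \<bullet> u \<le> ?\<beta> h * (norm u)\<^sup>2" if h: "h > 0" for h u
  proof -
    have "U h u \<bullet> u \<le> norm (U h u) * norm u" by (rule norm_cauchy_schwarz)
    also have "\<dots> \<le> (exp (- E * h) * norm u) * norm u"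
      using E[of h u] h by (intro mult_right_mono) auto
    finally have "U h u \<bullet> u \<le> exp (- E * h) * (norm u)\<^sup>2"
      by (simp add: power2_eq_square mult.assoc)
    then show ?thesis
      using weighted_numerical_range[OF h R, of \<xi> u] by (simp add: algebra_simps)
  qed
  have "(?\<beta> has_real_derivative (norm \<xi>)\<^sup>2 - E) (at 0)"
    by (auto intro!: derivative_eq_intros)
  then have "((\<lambda>h. (?\<beta> h - ?\<beta> 0) / (h - 0)) \<longlongrightarrow> (norm \<xi>)\<^sup>2 - E) (at 0)"
    by (simp only: has_field_derivative_iff)
  then have "((\<lambda>h. (?\<beta> h - ?\<beta> 0) / (h - 0)) \<longlongrightarrow> (norm \<xi>)\<^sup>2 - E) (at_right 0)"
    by (rule tendsto_within_subset) simp
  then show "((\<lambda>h. (?\<beta> h - 1) / h) \<longlongrightarrow> (norm \<xi>)\<^sup>2 - E) (at_right 0)" by simp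
qed

definition core_indicator :: "'a set \<Rightarrow> 'a \<Rightarrow> complex" where
  "core_indicator A x = complex_of_real (indicator A x * ind x)"

lemma core_indicator_L2:
  assumes A: "A \<in> sets borel" "bounded A"
  shows "core_indicator A \<in> L2 \<Omega>"
proof -
  have A': "A \<in> sets lebesgue" using A(1) by (metis sets_completionI_sets sets_lborel)
  then have s: "A \<inter> \<Omega> \<in> sets lebesgue" using \<Omega> by auto
  have "emeasure lebesgue (A \<inter> \<Omega>) \<le> emeasure lebesgue A"
    using A' by (intro emeasure_mono) auto
  also have "\<dots> = emeasure lborel A" using A(1) by simp
  also have "\<dots> < \<infinity>" using A(2) by (rule emeasure_bounded_finite)
  finally have fin: "emeasure lebesgue (A \<inter> \<Omega>) < \<infinity>" .
  have eq: "core_indicator A = (\<lambda>x. complex_of_real (indicator (A \<inter> \<Omega>) x))"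
    by (auto simp: core_indicator_def fun_eq_iff indicator_def)
  have "integrable lebesgue (indicator (A \<inter> \<Omega>) :: 'a \<Rightarrow> real)"
    using s fin by (subst integrable_indicator_iff) (auto simp: inf.absorb1)
  then have "integrable lebesgue (\<lambda>x. (cmod (complex_of_real (indicator (A \<inter> \<Omega>) x)))\<^sup>2)"
    by (rule Bochner_Integration.integrable_cong[THEN iffD1, rotated 2]) (auto split: split_indicator)
  moreover have "(\<lambda>x. complex_of_real (indicator (A \<inter> \<Omega>) x)) \<in> borel_measurable lebesgue"
    using s by (intro measurable_compose[OF _ borel_measurable_of_real] borel_measurable_indicator)
  ultimately show ?thesis
    unfolding eq by (auto simp: L2_def indicator_def)
qed

definition exp_mass :: "'a \<Rightarrow> 'a set \<Rightarrow> ennreal" where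
  "exp_mass \<xi> A = (\<integral>\<^sup>+y. ennreal (exp (\<xi> \<bullet> y) * indicator A y) \<partial>lborel)"

lemma exp_mass_finite:
  assumes A: "A \<in> sets borel" "bounded A"
  shows "exp_mass \<xi> A < \<infinity>"
proof -
  obtain r where r: "\<And>y. y \<in> A \<Longrightarrow> norm y \<le> r" using A(2) by (auto simp: bounded_iff)
  have "exp_mass \<xi> A \<le> (\<integral>\<^sup>+y. ennreal (exp (norm \<xi> * r)) * indicator A y \<partial>lborel)"
    unfolding exp_mass_def
  proof (intro nn_integral_mono)
    fix y
    have "\<xi> \<bullet> y \<le> norm \<xi> * r" if "y \<in> A"
      using norm_cauchy_schwarz[of \<xi> y] mult_left_mono[OF r[OF that], of "norm \<xi>"] by simp
    then show "ennreal (exp (\<xi> \<bullet> y) * indicator A y) \<le> ennreal (exp (norm \<xi> * r)) * indicator A y"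
      by (auto split: split_indicator intro!: ennreal_leI)
  qed
  also have "\<dots> = ennreal (exp (norm \<xi> * r)) * emeasure lborel A"
    using A by (subst nn_integral_cmult_indicator) auto
  also have "\<dots> < \<infinity>"
    using emeasure_bounded_finite[OF A(2)] by (simp add: ennreal_mult_less_top)
  finally show ?thesis .
qed

abbreviation cs :: "real \<Rightarrow> 'a \<Rightarrow> real" where
  "cs s \<xi> \<equiv> (8 * pi * s) powr (- (real DIM('a) / 2)) * exp (2 * s * (norm \<xi>)\<^sup>2)"

lemma T_core_indicator_le:
  assumes s: "s > 0" and A: "A \<in> sets borel" "bounded A"
  shows "AE x in lborel. ennreal (cmod (T s (core_indicator A) x)) \<le> (\<integral>\<^sup>+y. ennreal (heat_kernel s (x - y) * indicator A y) \<partial>lborel)"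
proof -
  obtain q :: "'a \<times> 'a \<Rightarrow> real" where "q \<in> borel_measurable borel" and q0: "\<And>z. 0 \<le> q z"
    and "\<And>x y. x \<notin> \<Omega> \<or> y \<notin> \<Omega> \<Longrightarrow> q (x, y) = 0"
    and q1: "AE z in lborel. q z \<le> heat_kernel s (fst z - snd z)"
    and K: "\<And>f. f \<in> L2 \<Omega> \<Longrightarrow> AE x in lborel. integrable lebesgue (\<lambda>y. complex_of_real (q (x, y)) * f y) \<and>
       T s f x = (LINT y|lebesgue. complex_of_real (q (x, y)) * f y)"
    by (rule kernel[OF s]) (rule that)
  show ?thesis
    using kernel_action_bound[OF q0 q1, of "\<lambda>_ _. 1"] K[OF core_indicator_L2[OF A]]
  proof eventually_elim
    case (elim x)
    have "ennreal (cmod (T s (core_indicator A) x)) \<le> (\<integral>\<^sup>+y. ennreal (heat_kernel s (x - y) * 1 * cmod (core_indicator A y)) \<partial>lborel)"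
      using elim(1)[rule_format, of "\<lambda>_. 1" "core_indicator A"] elim(2) by simp
    also have "\<dots> \<le> (\<integral>\<^sup>+y. ennreal (heat_kernel s (x - y) * indicator A y) \<partial>lborel)"
      by (intro nn_integral_mono ennreal_leI mult_mono) (auto simp: core_indicator_def norm_mult split: split_indicator)
    finally show ?case .
  qed
qed

lemma heat_weighted_mass:
  assumes s: "s > 0" and A[measurable]: "A \<in> sets borel"
  shows "(\<integral>\<^sup>+x. ennreal (exp (2 * (\<xi> \<bullet> x))) * (\<integral>\<^sup>+y. ennreal (heat_kernel s (x - y) * indicator A y) \<partial>lborel)\<^sup>2 \<partial>lborel)
    \<le> ennreal (cs s \<xi>) * (exp_mass \<xi> A)\<^sup>2"
proof -
  let ?g = "\<lambda>x y. ennreal (heat_kernel s (x - y) * indicator A y)"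
  let ?e = "\<lambda>x. ennreal (exp (2 * (\<xi> \<bullet> x)))"
  have "(\<integral>\<^sup>+x. ?e x * (\<integral>\<^sup>+y. ?g x y \<partial>lborel)\<^sup>2 \<partial>lborel) = (\<integral>\<^sup>+x. \<integral>\<^sup>+y. \<integral>\<^sup>+y'. ?e x * (?g x y * ?g x y') \<partial>lborel \<partial>lborel \<partial>lborel)"
    by (simp add: nn_integral_cmult nn_integral_multc power2_eq_square)
  also have "\<dots> = (\<integral>\<^sup>+y. \<integral>\<^sup>+x. \<integral>\<^sup>+y'. ?e x * (?g x y * ?g x y') \<partial>lborel \<partial>lborel \<partial>lborel)"
    by (rule lborel_pair.Fubini') measurable
  also have "\<dots> = (\<integral>\<^sup>+y. \<integral>\<^sup>+y'. \<integral>\<^sup>+x. ?e x * (?g x y * ?g x y') \<partial>lborel \<partial>lborel \<partial>lborel)"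
    by (intro nn_integral_cong lborel_pair.Fubini') measurable
  also have "\<dots> \<le> (\<integral>\<^sup>+y. \<integral>\<^sup>+y'. ennreal (cs s \<xi>) * (ennreal (exp (\<xi> \<bullet> y) * indicator A y) * ennreal (exp (\<xi> \<bullet> y') * indicator A y')) \<partial>lborel \<partial>lborel)"
  proof (intro nn_integral_mono)
    fix y y'
    have "(\<integral>\<^sup>+x. ?e x * (?g x y * ?g x y') \<partial>lborel) = (\<integral>\<^sup>+x. ennreal (exp (2 * (\<xi> \<bullet> x)) * (heat_kernel s (x - y) * heat_kernel s (x - y'))) * ennreal (indicator A y * indicator A y') \<partial>lborel)"
      by (intro nn_integral_cong) (auto simp: ennreal_mult[symmetric] split: split_indicator)
    also have "\<dots> = (\<integral>\<^sup>+x. ennreal (exp (2 * (\<xi> \<bullet> x)) * (heat_kernel s (x - y) * heat_kernel s (x - y'))) \<partial>lborel) * ennreal (indicator A y * indicator A y')"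
      by (rule nn_integral_multc) measurable
    also have "\<dots> \<le> ennreal (cs s \<xi> * (exp (\<xi> \<bullet> y) * exp (\<xi> \<bullet> y'))) * ennreal (indicator A y * indicator A y')"
      by (intro mult_right_mono nn_integral_heat_kernel_product_le s) simp
    also have "\<dots> = ennreal (cs s \<xi>) * (ennreal (exp (\<xi> \<bullet> y) * indicator A y) * ennreal (exp (\<xi> \<bullet> y') * indicator A y'))"
      by (auto simp: ennreal_mult[symmetric] mult_ac split: split_indicator)
    finally show "(\<integral>\<^sup>+x. ?e x * (?g x y * ?g x y') \<partial>lborel) \<le> ennreal (cs s \<xi>) * (ennreal (exp (\<xi> \<bullet> y) * indicator A y) * ennreal (exp (\<xi> \<bullet> y') * indicator A y'))" .
  qed
  also have "\<dots> = ennreal (cs s \<xi>) * (exp_mass \<xi> A)\<^sup>2"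
    by (simp add: nn_integral_cmult nn_integral_multc power2_eq_square exp_mass_def)
  finally show ?thesis .
qed

lemma weighted_norm_bound:
  assumes s: "s > 0" and R: "R \<ge> 0" and A: "A \<in> sets borel" "bounded A"
  shows "(norm (mul (expw \<xi> R) (U s (abs_l2 (core_indicator A)))))\<^sup>2
    \<le> exp (- 2 * R) * (norm (abs_l2 (core_indicator A)))\<^sup>2 + cs s \<xi> * (enn2real (exp_mass \<xi> A))\<^sup>2"
proof -
  note bp = expw_bounded_multiplier[OF R, of \<xi>]
  let ?f = "core_indicator A"
  let ?T = "T s ?f"
  have f: "?f \<in> L2 \<Omega>" by (rule core_indicator_L2[OF A])
  have Tf: "?T \<in> L2 \<Omega>" using T_in[of s] s f by simp
  let ?v = "\<lambda>x. \<integral>\<^sup>+y. ennreal (heat_kernel s (x - y) * indicator A y) \<partial>lborel"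
  note [measurable] = A(1)
  have L: "(\<lambda>x. complex_of_real (expw \<xi> R x) * ?T x) \<in> L2 UNIV"
    by (intro bounded_multiplier_L2[OF bp] L2_UNIV Tf)
  obtain T' where [measurable]: "T' \<in> borel_measurable borel" and T': "AE x in lborel. ?T x = T' x"
    using L2_borel_version[OF L2_measurable[OF Tf]] .
  have e2: "(expw \<xi> R x)\<^sup>2 \<le> exp (- 2 * R) + exp (2 * (\<xi> \<bullet> x))" for x
  proof -
    have "(expw \<xi> R x)\<^sup>2 = exp (2 * clamp_inner \<xi> R x)" by (simp add: expw_def exp_double)
    also have "\<dots> \<le> max (exp (- 2 * R)) (exp (2 * (\<xi> \<bullet> x)))"
      using R by (auto simp: clamp_inner_def max_def min_def)
    also have "\<dots> \<le> exp (- 2 * R) + exp (2 * (\<xi> \<bullet> x))" by (simp add: max_def)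
    finally show ?thesis .
  qed
  have "ennreal ((norm (mul (expw \<xi> R) (U s (abs_l2 ?f))))\<^sup>2) = (\<integral>\<^sup>+x. ennreal ((cmod (complex_of_real (expw \<xi> R x) * ?T x))\<^sup>2) \<partial>lebesgue)"
    using s f L by (simp add: U_abs mul_abs[OF bp] L2_UNIV Tf abs_l2_norm L2_norm_sq_nn_integral)
  also have "\<dots> = (\<integral>\<^sup>+x. ennreal ((cmod (complex_of_real (expw \<xi> R x) * ?T x))\<^sup>2) \<partial>lborel)"
    by (rule nn_integral_completion)
  also have "\<dots> \<le> (\<integral>\<^sup>+x. ennreal (exp (- 2 * R)) * ennreal ((cmod (T' x))\<^sup>2) + ennreal (exp (2 * (\<xi> \<bullet> x))) * (?v x)\<^sup>2 \<partial>lborel)"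
  proof (rule nn_integral_mono_AE)
    show "AE x in lborel. ennreal ((cmod (complex_of_real (expw \<xi> R x) * ?T x))\<^sup>2)
       \<le> ennreal (exp (- 2 * R)) * ennreal ((cmod (T' x))\<^sup>2) + ennreal (exp (2 * (\<xi> \<bullet> x))) * (?v x)\<^sup>2"
      using T_core_indicator_le[OF s A] T'
    proof eventually_elim
      case (elim x)
      have "(cmod (complex_of_real (expw \<xi> R x) * ?T x))\<^sup>2 \<le> (exp (- 2 * R) + exp (2 * (\<xi> \<bullet> x))) * (cmod (?T x))\<^sup>2"
        unfolding norm_mult power_mult_distrib norm_of_real power2_abs by (intro mult_right_mono e2) simp
      then have "ennreal ((cmod (complex_of_real (expw \<xi> R x) * ?T x))\<^sup>2) \<le> ennreal (exp (- 2 * R)) * ennreal ((cmod (?T x))\<^sup>2) + ennreal (exp (2 * (\<xi> \<bullet> x))) * ennreal ((cmod (?T x))\<^sup>2)"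
        by (subst ennreal_mult[symmetric], simp, simp)+ (subst ennreal_plus[symmetric], simp, simp, intro ennreal_leI, simp add: distrib_right)
      also have "ennreal ((cmod (?T x))\<^sup>2) = (ennreal (cmod (?T x)))\<^sup>2" by (simp add: ennreal_power)
      also have "ennreal (exp (2 * (\<xi> \<bullet> x))) * (ennreal (cmod (?T x)))\<^sup>2 \<le> ennreal (exp (2 * (\<xi> \<bullet> x))) * (?v x)\<^sup>2"
        using elim(1) by (intro mult_left_mono power_mono) auto
      finally show ?case using elim(2) by (simp add: ennreal_power add_left_mono)
    qed
  qed
  also have "\<dots> = ennreal (exp (- 2 * R)) * (\<integral>\<^sup>+x. ennreal ((cmod (T' x))\<^sup>2) \<partial>lborel) + (\<integral>\<^sup>+x. ennreal (exp (2 * (\<xi> \<bullet> x))) * (?v x)\<^sup>2 \<partial>lborel)"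
    by (subst nn_integral_add) (auto simp: nn_integral_cmult)
  also have "\<dots> \<le> ennreal (exp (- 2 * R)) * ennreal ((norm (abs_l2 ?f))\<^sup>2) + ennreal (cs s \<xi>) * (exp_mass \<xi> A)\<^sup>2"
  proof (intro add_mono mult_left_mono heat_weighted_mass s A(1))
    have "(\<integral>\<^sup>+x. ennreal ((cmod (T' x))\<^sup>2) \<partial>lborel) = (\<integral>\<^sup>+x. ennreal ((cmod (?T x))\<^sup>2) \<partial>lborel)"
      by (rule nn_integral_cong_AE) (use T' in \<open>eventually_elim, simp\<close>)
    also have "\<dots> = ennreal ((L2_norm ?T)\<^sup>2)"
      using L2_norm_sq_nn_integral[OF Tf] by (simp add: nn_integral_completion)
    also have "\<dots> \<le> ennreal ((norm (abs_l2 ?f))\<^sup>2)"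
      using T_contraction[OF s f] f by (intro ennreal_leI power_mono) (auto simp: abs_l2_norm L2_UNIV L2_norm_nonneg)
    finally show "(\<integral>\<^sup>+x. ennreal ((cmod (T' x))\<^sup>2) \<partial>lborel) \<le> ennreal ((norm (abs_l2 ?f))\<^sup>2)" .
  qed auto
  also have "\<dots> = ennreal (exp (- 2 * R) * (norm (abs_l2 ?f))\<^sup>2 + cs s \<xi> * (enn2real (exp_mass \<xi> A))\<^sup>2)"
  proof -
    have "exp_mass \<xi> A = ennreal (enn2real (exp_mass \<xi> A))"
      using exp_mass_finite[OF A] by simp
    then have "(exp_mass \<xi> A)\<^sup>2 = ennreal ((enn2real (exp_mass \<xi> A))\<^sup>2)"
      by (metis ennreal_power enn2real_nonneg)
    then show ?thesis
      by (simp only:) ((subst ennreal_mult[symmetric], simp, simp)+, subst ennreal_plus, simp_all)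
  qed
  finally show ?thesis
    by (subst (asm) ennreal_le_iff) auto
qed

lemma rectangle_bound:
  assumes E: "\<And>h F. h \<ge> 0 \<Longrightarrow> norm (U h F) \<le> exp (- E * h) * norm F"
    and s: "s > 0" and t: "t \<ge> 2 * s" and A: "A \<in> sets borel" "bounded A" and B: "B \<in> sets borel" "bounded B"
  shows "U t (abs_l2 (core_indicator A)) \<bullet> abs_l2 (core_indicator B) \<le>
    exp (((norm \<xi>)\<^sup>2 - E) * (t - 2 * s)) * cs s \<xi> * (enn2real (exp_mass \<xi> A) * enn2real (exp_mass (- \<xi>) B))"
proof -
  let ?F = "abs_l2 (core_indicator A)" and ?G = "abs_l2 (core_indicator B)"
  let ?\<tau> = "t - 2 * s"
  let ?e = "exp (((norm \<xi>)\<^sup>2 - E) * ?\<tau>)"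
  let ?a = "\<lambda>R. exp (- 2 * R) * (norm ?F)\<^sup>2 + cs s \<xi> * (enn2real (exp_mass \<xi> A))\<^sup>2"
  let ?b = "\<lambda>R. exp (- 2 * R) * (norm ?G)\<^sup>2 + cs s (- \<xi>) * (enn2real (exp_mass (- \<xi>) B))\<^sup>2"
  have fin: "U t ?F \<bullet> ?G \<le> ?e * (sqrt (?a R) * sqrt (?b R))" if R: "R \<ge> 0" for R
  proof -
    note bp = expw_bounded_multiplier[OF R, of \<xi>] and bm = expw_bounded_multiplier[OF R, of "- \<xi>"]
    let ?X = "U s ?F" and ?Y = "U s ?G"
    have "U t ?F = U s (U ?\<tau> ?X)"
      using U_add[of "s + ?\<tau>" s ?F] U_add[of s ?\<tau> "U s ?F"] s t by simp
    then have "U t ?F \<bullet> ?G = U ?\<tau> ?X \<bullet> ?Y"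
      using U_sym[of s "U ?\<tau> ?X" ?G] s by simp
    also have "\<dots> = W \<xi> R ?\<tau> (mul (expw \<xi> R) ?X) \<bullet> mul (expw (- \<xi>) R) ?Y"
    proof -
      have "mul (expw (- \<xi>) R) (mul (expw \<xi> R) X) = X" for X
        using mul_expw_inverse[OF R, of "- \<xi>" X] by simp
      then show ?thesis
        unfolding W_def mul_sym[OF bm, symmetric] by simp
    qed
    also have "\<dots> \<le> norm (W \<xi> R ?\<tau> (mul (expw \<xi> R) ?X)) * norm (mul (expw (- \<xi>) R) ?Y)"
      by (rule norm_cauchy_schwarz)
    also have "\<dots> \<le> (?e * norm (mul (expw \<xi> R) ?X)) * norm (mul (expw (- \<xi>) R) ?Y)"
    proof (rule mult_right_mono)
      have "W \<xi> R 0 (mul (expw \<xi> R) ?X) = mul (expw \<xi> R) ?X"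
        using mul_expw_inverse[OF R, of "- \<xi>" ?X] U_add[of 0 s ?F] s by (simp add: W_def)
      then show "norm (W \<xi> R ?\<tau> (mul (expw \<xi> R) ?X)) \<le> ?e * norm (mul (expw \<xi> R) ?X)"
        using t by (intro weighted_growth E R) auto
    qed simp
    also have "\<dots> \<le> (?e * sqrt (?a R)) * sqrt (?b R)"
      using weighted_norm_bound[OF s R A, of \<xi>] weighted_norm_bound[OF s R B, of "- \<xi>"]
      by (intro mult_mono mult_left_mono real_le_rsqrt) auto
    finally show ?thesis by (simp add: mult.assoc)
  qed
  have e0: "((\<lambda>R::real. exp (- 2 * R)) \<longlongrightarrow> 0) at_top"
    by (rule filterlim_compose[OF exp_at_bot]) (rule filterlim_tendsto_neg_mult_at_bot[OF tendsto_const _ filterlim_ident], simp)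
  have "((\<lambda>R. ?e * (sqrt (?a R) * sqrt (?b R))) \<longlongrightarrow> ?e * (sqrt (0 * (norm ?F)\<^sup>2 + cs s \<xi> * (enn2real (exp_mass \<xi> A))\<^sup>2) * sqrt (0 * (norm ?G)\<^sup>2 + cs s (- \<xi>) * (enn2real (exp_mass (- \<xi>) B))\<^sup>2))) at_top"
    by (intro tendsto_intros e0)
  then have "U t ?F \<bullet> ?G \<le> ?e * (sqrt (0 * (norm ?F)\<^sup>2 + cs s \<xi> * (enn2real (exp_mass \<xi> A))\<^sup>2) * sqrt (0 * (norm ?G)\<^sup>2 + cs s (- \<xi>) * (enn2real (exp_mass (- \<xi>) B))\<^sup>2))"
  proof (rule tendsto_lowerbound)
    show "\<forall>\<^sub>F R in at_top. U t ?F \<bullet> ?G \<le> ?e * (sqrt (?a R) * sqrt (?b R))"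
      by (rule eventually_at_top_linorderI[of 0]) (rule fin)
  qed simp
  also have "\<dots> = ?e * cs s \<xi> * (enn2real (exp_mass \<xi> A) * enn2real (exp_mass (- \<xi>) B))"
    by (simp add: real_sqrt_mult mult_ac)
  finally show ?thesis .
qed

end

section \<open>Pointwise kernel bounds\<close>

lemma AE_zero_of_generator:
  fixes r :: "'a \<Rightarrow> 'b::{second_countable_topology, banach}"
  assumes M: "sigma_finite_measure M" and r: "integrable M r" and G: "Int_stable G" "G \<subseteq> Pow (space M)" "sets M = sigma_sets (space M) G" "space M \<in> G"
    and zero: "\<And>A. A \<in> G \<Longrightarrow> set_lebesgue_integral M A r = 0"
  shows "AE x in M. r x = 0"
proof -
  have si: "set_integrable M A r" if "A \<in> sets M" for A
    using integrable_mult_indicator[OF that r] by (simp add: set_integrable_def)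
  have all: "set_lebesgue_integral M A r = 0" if "A \<in> sets M" for A
  proof -
    have "A \<in> sigma_sets (space M) G" using that G(3) by simp
    with G(1,2) show ?thesis
    proof (induction rule: sigma_sets_induct_disjoint)
      case (basic A) then show ?case by (rule zero)
    next
      case empty then show ?case by (simp add: set_lebesgue_integral_def)
    next
      case (compl A)
      have A: "A \<in> sets M" using compl G(3) by simp
      then have "set_lebesgue_integral M ((space M - A) \<union> A) r = set_lebesgue_integral M (space M - A) r + set_lebesgue_integral M A r"
        by (intro set_integral_Un si) auto
      moreover have "(space M - A) \<union> A = space M" using A sets.sets_into_space by blast
      ultimately show ?case using zero[OF G(4)] compl by simp
    next
      case (union A)
      have A: "range A \<subseteq> sets M" using union G(3) by simp
      then have "set_lebesgue_integral M (\<Union>i. A i) r = (\<Sum>i. set_lebesgue_integral M (A i) r)"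
        using union(1) by (intro lebesgue_integral_countable_add si) (auto simp: disjoint_family_on_def)
      then show ?case using union by simp
    qed
  qed
  show ?thesis
    by (rule sigma_finite_measure.density_unique_banach[OF M r integrable_zero]) (subst all, assumption, simp add: set_lebesgue_integral_def)
qed

lemma countable_borel_generator:
  obtains G :: "'a::second_countable_topology set set" where "countable G" "Int_stable G" "UNIV \<in> G"
    "sets borel = sigma_sets UNIV G"
proof -
  obtain B :: "'a set set" where B: "countable B" "topological_basis B"
    using ex_countable_basis by blast
  define G where "G = Inter ` {F. finite F \<and> F \<subseteq> B}"
  have G_open: "open A" if "A \<in> G" for A
    using that B(2) by (auto simp: G_def topological_basis_open intro!: open_Inter)
  show ?thesis
  proof
    show "countable G"
      unfolding G_def using countable_Collect_finite_subset[OF B(1)] by simp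
    show "Int_stable G"
    proof (rule Int_stableI)
      fix X Y assume "X \<in> G" "Y \<in> G"
      then obtain F F' where F: "finite F" "F \<subseteq> B" "X = \<Inter>F" "finite F'" "F' \<subseteq> B" "Y = \<Inter>F'"
        by (auto simp: G_def)
      then have "X \<inter> Y = \<Inter>(F \<union> F')" by auto
      then show "X \<inter> Y \<in> G" using F unfolding G_def by (intro image_eqI[of _ _ "F \<union> F'"]) auto
    qed
    show "UNIV \<in> G" unfolding G_def by (intro image_eqI[of _ _ "{}"]) auto
    have BG: "B \<subseteq> G"
    proof
      fix X assume "X \<in> B"
      then show "X \<in> G" unfolding G_def by (intro image_eqI[of _ _ "{X}"]) auto
    qed
    have "sets borel = sets (sigma UNIV B)"
      by (rule arg_cong[where f = sets, OF borel_eq_countable_basis[OF B]])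
    also have "\<dots> = sigma_sets UNIV B"
      by (rule sets_measure_of) simp
    also have "\<dots> \<subseteq> sigma_sets UNIV G" by (rule sigma_sets_mono'[OF BG])
    finally have "sets borel \<subseteq> sigma_sets UNIV G" .
    moreover have "G \<subseteq> sets borel" using G_open borel_open by blast
    then have "sigma_sets UNIV G \<subseteq> sets borel"
      using sets.sigma_sets_subset[of G borel] by simp
    ultimately show "sets borel = sigma_sets UNIV G" by blast
  qed
qed

context dominated_semigroup
begin

lemma kernel_unique:
  fixes q :: "'a \<times> 'a \<Rightarrow> real"
  assumes t: "t > 0" and q[measurable]: "q \<in> borel_measurable borel"
    and q_out: "\<And>x y. x \<notin> \<Omega> \<or> y \<notin> \<Omega> \<Longrightarrow> q (x, y) = 0"
    and K: "\<And>f. f \<in> L2 \<Omega> \<Longrightarrow> AE x in lborel. integrable lebesgue (\<lambda>y. complex_of_real (q (x, y)) * f y) \<and>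
       T t f x = (LINT y|lebesgue. complex_of_real (q (x, y)) * f y)"
    and p: "is_integral_kernel \<Omega> (T t) p"
  shows "AE z in lborel. p z = complex_of_real (q z)"
proof -
  have pm: "p \<in> borel_measurable lebesgue" and p_out: "\<And>x y. (x, y) \<notin> \<Omega> \<times> \<Omega> \<Longrightarrow> p (x, y) = 0"
    and pK: "\<And>f. f \<in> L2 \<Omega> \<Longrightarrow> AE x in lborel. x \<in> \<Omega> \<longrightarrow> set_integrable lebesgue \<Omega> (\<lambda>y. p (x, y) * f y) \<and>
        T t f x = (LINT y:\<Omega>|lebesgue. p (x, y) * f y)"
    using p by (auto simp: is_integral_kernel_def AE_lebesgue_iff)
  obtain p' where p'[measurable]: "p' \<in> borel_measurable borel" and pp': "AE z in lborel. p z = p' z"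
    using L2_borel_version[OF pm] .
  obtain G :: "'a set set" where G: "countable G" "Int_stable G" "UNIV \<in> G" "sets borel = sigma_sets UNIV G"
    by (rule countable_borel_generator)
  let ?f = "\<lambda>n A. core_indicator (A \<inter> ball 0 (real (n::nat)))"
  have Gs: "A \<in> sets borel" if "A \<in> G" for A using that G(4) by auto
  have f: "?f n A \<in> L2 \<Omega>" if "A \<in> sets borel" for n A
    by (intro core_indicator_L2) (use that in \<open>auto intro: bounded_subset[OF bounded_ball]\<close>)
  have "AE x in lborel. x \<in> \<Omega> \<longrightarrow> (AE y in lborel. p (x, y) = complex_of_real (q (x, y)))"
  proof -
    have "AE x in lborel. \<forall>n. \<forall>A\<in>G. (x \<in> \<Omega> \<longrightarrow> integrable lebesgue (\<lambda>y. p (x, y) * ?f n A y) \<and>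
        integrable lebesgue (\<lambda>y. complex_of_real (q (x, y)) * ?f n A y) \<and>
        (LINT y|lebesgue. p (x, y) * ?f n A y) = (LINT y|lebesgue. complex_of_real (q (x, y)) * ?f n A y))"
      unfolding AE_all_countable AE_ball_countable[OF G(1)]
    proof (intro allI ballI)
      fix n A assume A: "A \<in> G"
      have i: "indicator \<Omega> y *\<^sub>R (p (x, y) * ?f n A y) = p (x, y) * ?f n A y" for x y
        by (auto simp: core_indicator_def indicator_def)
      show "AE x in lborel. x \<in> \<Omega> \<longrightarrow> integrable lebesgue (\<lambda>y. p (x, y) * ?f n A y) \<and>
        integrable lebesgue (\<lambda>y. complex_of_real (q (x, y)) * ?f n A y) \<and>
        (LINT y|lebesgue. p (x, y) * ?f n A y) = (LINT y|lebesgue. complex_of_real (q (x, y)) * ?f n A y)"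
        using pK[OF f[OF Gs[OF A], of n]] K[OF f[OF Gs[OF A], of n]]
        unfolding set_integrable_def set_lebesgue_integral_def i by eventually_elim auto
    qed
    then show ?thesis
    proof eventually_elim
      case (elim x)
      show ?case
      proof
        assume x: "x \<in> \<Omega>"
        have "AE y in lborel. \<forall>n::nat. y \<in> ball 0 (real n) \<longrightarrow> p (x, y) = complex_of_real (q (x, y))"
          unfolding AE_all_countable
        proof
          fix n :: nat
          define r where "r y = p (x, y) * ?f n UNIV y - complex_of_real (q (x, y)) * ?f n UNIV y" for y
          have r_int: "integrable lebesgue r"
            unfolding r_def by (intro Bochner_Integration.integrable_diff) (use elim x G(3) in blast)+
          obtain r' where r'[measurable]: "r' \<in> borel_measurable borel" and rr': "AE y in lborel. r y = r' y"
            using L2_borel_version[OF borel_measurable_integrable[OF r_int]] .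
          have r'l: "r' \<in> borel_measurable lebesgue" using r' by (intro measurable_completion) simp
          have r'_int: "integrable lborel r'"
          proof -
            have "integrable lebesgue r'"
              using r_int integrable_cong_AE[OF borel_measurable_integrable[OF r_int] r'l] rr' by (simp add: AE_lebesgue_iff)
            then show ?thesis using integrable_completion[of r' lborel] r' by simp
          qed
          have "AE y in lborel. r' y = 0"
          proof (rule AE_zero_of_generator[OF sigma_finite_lborel r'_int G(2)])
            show "sets lborel = sigma_sets (space lborel) G" using G(4) by simp
            fix A assume A: "A \<in> G"
            have Al: "A \<in> sets lebesgue" using Gs[OF A] by (metis sets_completionI_sets sets_lborel)
            have "set_lebesgue_integral lborel A r' = (LINT y|lebesgue. indicator A y *\<^sub>R r' y)"
              unfolding set_lebesgue_integral_def using r' Gs[OF A] by (intro integral_completion[symmetric]) auto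
            also have "\<dots> = (LINT y|lebesgue. indicator A y *\<^sub>R r y)"
              using Al r'l borel_measurable_integrable[OF r_int] rr'
              by (intro integral_cong_AE borel_measurable_scaleR borel_measurable_indicator) (auto simp: AE_lebesgue_iff)
            also have "\<dots> = (LINT y|lebesgue. p (x, y) * ?f n A y - complex_of_real (q (x, y)) * ?f n A y)"
              by (intro Bochner_Integration.integral_cong refl) (auto simp: r_def core_indicator_def split: split_indicator)
            also have "\<dots> = 0"
              using elim x A by simp
            finally show "set_lebesgue_integral lborel A r' = 0" .
          qed (use G(3) in auto)
          then show "AE y in lborel. y \<in> ball 0 (real n) \<longrightarrow> p (x, y) = complex_of_real (q (x, y))"
            using rr'
          proof eventually_elim
            case (elim y)
            then have "r y = 0" by simp
            then show ?case
              using p_out[of x y] q_out[of x y] by (cases "y \<in> \<Omega>") (auto simp: r_def core_indicator_def indicator_def)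
          qed
        qed
        then show "AE y in lborel. p (x, y) = complex_of_real (q (x, y))"
        proof eventually_elim
          case (elim y)
          obtain n :: nat where "norm y < real n" using reals_Archimedean2 by blast
          then show ?case using elim[rule_format, of n] by simp
        qed
      qed
    qed
  qed
  then have "AE x in lborel. AE y in lborel. p' (x, y) = complex_of_real (q (x, y))"
    using AE_lborel_pair[OF pp']
  proof eventually_elim
    case (elim x)
    show ?case
    proof (cases "x \<in> \<Omega>")
      case True
      then have "AE y in lborel. p (x, y) = complex_of_real (q (x, y))" using elim by blast
      then show ?thesis using elim(2) by eventually_elim simp
    next
      case False
      from elim(2) show ?thesis
        by eventually_elim (use False p_out[of x] q_out[of x] in auto)
    qed
  qed
  moreover have "{z \<in> space (lborel \<Otimes>\<^sub>M lborel). p' z = complex_of_real (q z)} \<in> sets (lborel \<Otimes>\<^sub>M lborel)"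
    unfolding lborel_prod by measurable
  ultimately have "AE z in lborel \<Otimes>\<^sub>M lborel. p' z = complex_of_real (q z)"
    using lborel_pair.AE_pair_measure[of "\<lambda>z. p' z = complex_of_real (q z)"] by blast
  then have "AE z in lborel. p' z = complex_of_real (q z)"
    by (subst (asm) lborel_prod)
  with pp' show ?thesis by eventually_elim simp
qed

lemma kernel_exp_bound:
  fixes q :: "'a \<times> 'a \<Rightarrow> real"
  assumes E: "\<And>h F. h \<ge> 0 \<Longrightarrow> norm (U h F) \<le> exp (- E * h) * norm F"
    and s: "s > 0" and t: "t \<ge> 2 * s" and q[measurable]: "q \<in> borel_measurable borel" and q0: "\<And>z. 0 \<le> q z"
    and q_out: "\<And>x y. x \<notin> \<Omega> \<or> y \<notin> \<Omega> \<Longrightarrow> q (x, y) = 0"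
    and q1: "AE z in lborel. q z \<le> heat_kernel t (fst z - snd z)"
    and K: "\<And>f. f \<in> L2 \<Omega> \<Longrightarrow> AE x in lborel. integrable lebesgue (\<lambda>y. complex_of_real (q (x, y)) * f y) \<and>
       T t f x = (LINT y|lebesgue. complex_of_real (q (x, y)) * f y)"
  shows "AE z in lborel. q z \<le> exp (((norm \<xi>)\<^sup>2 - E) * (t - 2 * s)) * cs s \<xi> * exp (\<xi> \<bullet> (snd z - fst z))"
proof -
  let ?C = "exp (((norm \<xi>)\<^sup>2 - E) * (t - 2 * s)) * cs s \<xi>"
  have t0: "t > 0" using s t by simp
  define c where "c = (4 * pi * t) powr (- (real DIM('a) / 2))"
  define q' where "q' z = min (q z) c" for z
  have [measurable]: "q \<in> borel_measurable (borel \<Otimes>\<^sub>M borel)" by (simp add: borel_prod)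
  have "AE z in lborel. q' z \<le> ?C * exp (\<xi> \<bullet> (snd z - fst z))"
  proof (rule AE_le_of_rectangles[where c = c])
    show "q' \<in> borel_measurable borel" unfolding q'_def[abs_def] by measurable
    show "0 \<le> q' z" "q' z \<le> c" for z using q0[of z] by (auto simp: q'_def c_def)
    have "(\<lambda>z::'a \<times> 'a. ?C * exp (\<xi> \<bullet> (snd z - fst z))) \<in> borel_measurable (borel \<Otimes>\<^sub>M borel)" by measurable
    then show "(\<lambda>z::'a \<times> 'a. ?C * exp (\<xi> \<bullet> (snd z - fst z))) \<in> borel_measurable borel" by (simp only: borel_prod)
    show "0 \<le> ?C * exp (\<xi> \<bullet> (snd z - fst z))" for z :: "'a \<times> 'a" by simp
    show "\<exists>D. \<forall>x\<in>ball 0 (real n). \<forall>y\<in>ball 0 (real n). ?C * exp (\<xi> \<bullet> (snd (x, y) - fst (x, y))) \<le> D" for n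
    proof (intro exI ballI)
      fix x y :: 'a assume "x \<in> ball 0 (real n)" "y \<in> ball 0 (real n)"
      then have "norm (y - x) \<le> real n + real n"
        using norm_triangle_ineq4[of y x] by simp
      then have "\<xi> \<bullet> (y - x) \<le> norm \<xi> * (real n + real n)"
        using norm_cauchy_schwarz[of \<xi> "y - x"] mult_left_mono[of "norm (y - x)" "real n + real n" "norm \<xi>"] by simp
      then show "?C * exp (\<xi> \<bullet> (snd (x, y) - fst (x, y))) \<le> ?C * exp (norm \<xi> * (real n + real n))"
        by (intro mult_left_mono) auto
    qed
    fix A B :: "'a set" assume A[measurable]: "A \<in> sets borel" and B[measurable]: "B \<in> sets borel" and bA: "bounded A" and bB: "bounded B"
    let ?A = "core_indicator A" and ?B = "core_indicator B"
    have LA: "?A \<in> L2 \<Omega>" and LB: "?B \<in> L2 \<Omega>" by (intro core_indicator_L2 A B bA bB)+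
    have TB: "T t ?B \<in> L2 \<Omega>" using T_in[of t] t0 LB by simp
    have kB: "AE x in lborel. (\<integral>\<^sup>+y. ennreal (q (x, y) * indicator B y) \<partial>lborel) = ennreal (Re (T t ?B x)) \<and> 0 \<le> Re (T t ?B x)"
      using K[OF LB]
    proof eventually_elim
      case (elim x)
      have eq: "complex_of_real (q (x, y)) * ?B y = complex_of_real (q (x, y) * indicator B y)" for y
        using q_out[of x y] by (cases "y \<in> \<Omega>") (auto simp: core_indicator_def)
      have i: "integrable lebesgue (\<lambda>y. q (x, y) * indicator B y)"
        using integrable_Re[of lebesgue "\<lambda>y. complex_of_real (q (x, y) * indicator B y)"] elim unfolding eq by simp
      have v: "T t ?B x = complex_of_real (LINT y|lebesgue. q (x, y) * indicator B y)"
        using elim unfolding eq by (simp add: integral_complex_of_real del: of_real_mult)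
      have "(\<integral>\<^sup>+y. ennreal (q (x, y) * indicator B y) \<partial>lborel) = (\<integral>\<^sup>+y. ennreal (q (x, y) * indicator B y) \<partial>lebesgue)"
        by (rule nn_integral_completion[symmetric])
      also have "\<dots> = ennreal (LINT y|lebesgue. q (x, y) * indicator B y)"
        using i q0 by (intro nn_integral_eq_integral) auto
      finally show ?case
        using v q0 by (auto intro!: integral_nonneg_AE)
    qed
    have "(\<integral>\<^sup>+x. \<integral>\<^sup>+y. ennreal (q' (x, y) * (indicator A x * indicator B y)) \<partial>lborel \<partial>lborel)
      \<le> (\<integral>\<^sup>+x. ennreal (Re (T t ?B x) * indicator A x) \<partial>lborel)"
    proof (rule nn_integral_mono_AE)
      show "AE x in lborel. (\<integral>\<^sup>+y. ennreal (q' (x, y) * (indicator A x * indicator B y)) \<partial>lborel) \<le> ennreal (Re (T t ?B x) * indicator A x)"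
        using kB
      proof eventually_elim
        case (elim x)
        have "(\<integral>\<^sup>+y. ennreal (q' (x, y) * (indicator A x * indicator B y)) \<partial>lborel) \<le> (\<integral>\<^sup>+y. ennreal (indicator A x) * ennreal (q (x, y) * indicator B y) \<partial>lborel)"
          by (intro nn_integral_mono) (auto simp: q'_def split: split_indicator intro!: ennreal_leI)
        also have "\<dots> = ennreal (indicator A x) * (\<integral>\<^sup>+y. ennreal (q (x, y) * indicator B y) \<partial>lborel)"
          by (rule nn_integral_cmult) measurable
        also have "\<dots> = ennreal (Re (T t ?B x) * indicator A x)"
          using elim by (auto split: split_indicator)
        finally show ?case .
      qed
    qed
    also have "\<dots> = (\<integral>\<^sup>+x. ennreal (Re (T t ?B x * cnj (?A x))) \<partial>lebesgue)"
      unfolding nn_integral_completion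
    proof (rule nn_integral_cong)
      fix x
      show "ennreal (Re (T t ?B x) * indicator A x) = ennreal (Re (T t ?B x * cnj (?A x)))"
        using L2_outside[OF TB, of x] by (cases "x \<in> \<Omega>") (auto simp: core_indicator_def)
    qed
    also have "\<dots> = ennreal (LINT x|lebesgue. Re (T t ?B x * cnj (?A x)))"
    proof (rule nn_integral_eq_integral)
      show "integrable lebesgue (\<lambda>x. Re (T t ?B x * cnj (?A x)))"
        by (intro integrable_Re L2_mult_integrable[OF TB L2_cnj[OF LA]])
      show "AE x in lebesgue. 0 \<le> Re (T t ?B x * cnj (?A x))"
        unfolding AE_lebesgue_iff using kB by eventually_elim (auto simp: core_indicator_def)
    qed
    also have "(LINT x|lebesgue. Re (T t ?B x * cnj (?A x))) = U t (abs_l2 ?B) \<bullet> abs_l2 ?A"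
      using integral_Re[OF L2_mult_integrable[OF TB L2_cnj[OF LA]]] t0 LA LB TB
      by (simp add: U_abs abs_l2_inner L2_UNIV L2_inner_def)
    also have "ennreal \<dots> \<le> ennreal (?C * (enn2real (exp_mass \<xi> B) * enn2real (exp_mass (- \<xi>) A)))"
      by (intro ennreal_leI rectangle_bound E s t A B bA bB)
    also have "\<dots> = ennreal ?C * (exp_mass \<xi> B * exp_mass (- \<xi>) A)"
      using exp_mass_finite[OF B bB, of \<xi>] exp_mass_finite[OF A bA, of "- \<xi>"]
      by (subst ennreal_mult, simp, simp, subst ennreal_mult) simp_all
    also have "\<dots> = (\<integral>\<^sup>+x. \<integral>\<^sup>+y. ennreal ?C * (ennreal (exp (\<xi> \<bullet> y) * indicator B y) * ennreal (exp ((- \<xi>) \<bullet> x) * indicator A x)) \<partial>lborel \<partial>lborel)"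
      unfolding exp_mass_def by (simp add: nn_integral_cmult nn_integral_multc)
    also have "\<dots> = (\<integral>\<^sup>+x. \<integral>\<^sup>+y. ennreal (?C * exp (\<xi> \<bullet> (snd (x, y) - fst (x, y))) * (indicator A x * indicator B y)) \<partial>lborel \<partial>lborel)"
    proof (intro nn_integral_cong)
      fix x y
      show "ennreal ?C * (ennreal (exp (\<xi> \<bullet> y) * indicator B y) * ennreal (exp ((- \<xi>) \<bullet> x) * indicator A x))
        = ennreal (?C * exp (\<xi> \<bullet> (snd (x, y) - fst (x, y))) * (indicator A x * indicator B y))"
      proof (cases "x \<in> A \<and> y \<in> B")
        case True
        have "exp (\<xi> \<bullet> (y - x)) = exp (\<xi> \<bullet> y) * exp ((- \<xi>) \<bullet> x)"
          by (simp add: inner_diff_right exp_diff exp_minus divide_inverse)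
        then show ?thesis using True by (simp add: ennreal_mult)
      qed auto
    qed
    finally show "(\<integral>\<^sup>+x. \<integral>\<^sup>+y. ennreal (q' (x, y) * (indicator A x * indicator B y)) \<partial>lborel \<partial>lborel)
      \<le> (\<integral>\<^sup>+x. \<integral>\<^sup>+y. ennreal (?C * exp (\<xi> \<bullet> (snd (x, y) - fst (x, y))) * (indicator A x * indicator B y)) \<partial>lborel \<partial>lborel)" .
  qed
  then show ?thesis
    using q1
  proof eventually_elim
    case (elim z)
    have "q z \<le> c" using elim(2) heat_kernel_le[OF t0, of "fst z - snd z"] by (simp add: c_def)
    then show ?case using elim(1) by (simp add: q'_def)
  qed
qed

text \<open>The exponential bounds hold simultaneously for a countable dense set of \<open>\<xi>\<close>, hence for all
  \<open>\<xi>\<close> by continuity; \<open>\<xi> = (x - y) / (2 * t)\<close> is optimal.\<close>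

lemma kernel_gaussian_bound:
  fixes q :: "'a \<times> 'a \<Rightarrow> real"
  assumes E: "\<And>h F. h \<ge> 0 \<Longrightarrow> norm (U h F) \<le> exp (- E * h) * norm F"
    and s: "s > 0" and t: "t \<ge> 2 * s" and q: "q \<in> borel_measurable borel" "\<And>z. 0 \<le> q z"
    "\<And>x y. x \<notin> \<Omega> \<or> y \<notin> \<Omega> \<Longrightarrow> q (x, y) = 0"
    "AE z in lborel. q z \<le> heat_kernel t (fst z - snd z)"
    "\<And>f. f \<in> L2 \<Omega> \<Longrightarrow> AE x in lborel. integrable lebesgue (\<lambda>y. complex_of_real (q (x, y)) * f y) \<and>
       T t f x = (LINT y|lebesgue. complex_of_real (q (x, y)) * f y)"
  shows "AE (x, y) in lborel. q (x, y) \<le> (8 * pi * s) powr (- (real DIM('a) / 2)) * exp (2 * s * E) *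
    exp (- E * t - (norm (x - y))\<^sup>2 / (4 * t))"
proof -
  have t0: "t > 0" using s t by simp
  let ?b = "\<lambda>z \<xi>. exp (((norm \<xi>)\<^sup>2 - E) * (t - 2 * s)) * cs s \<xi> * exp (\<xi> \<bullet> (snd z - fst z))"
  obtain D :: "'a set" where D: "countable D" "\<And>X. open X \<Longrightarrow> X \<noteq> {} \<Longrightarrow> \<exists>d\<in>D. d \<in> X"
    using countable_dense_exists by blast
  have "AE z in lborel. \<forall>\<xi>\<in>D. q z \<le> ?b z \<xi>"
    unfolding AE_ball_countable[OF D(1)]
    by (intro ballI kernel_exp_bound[OF E s t q])
  then show ?thesis
  proof eventually_elim
    case (elim z)
    obtain x y where z: "z = (x, y)" by (cases z)
    have all: "q z \<le> ?b z \<xi>" for \<xi>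
    proof (rule ccontr)
      assume "\<not> q z \<le> ?b z \<xi>"
      then have "{\<xi>. ?b z \<xi> < q z} \<noteq> {}" by (auto simp: not_le)
      moreover have "open {\<xi>. ?b z \<xi> < q z}"
        by (intro open_Collect_less continuous_intros)
      ultimately obtain d where "d \<in> D" "?b z d < q z" using D(2) by blast
      then show False using elim by (meson not_le)
    qed
    let ?\<xi> = "(1 / (2 * t)) *\<^sub>R (x - y)"
    have n: "(norm ?\<xi>)\<^sup>2 = (norm (x - y))\<^sup>2 / (4 * t\<^sup>2)"
      using t0 by (simp add: power_mult_distrib power_divide)
    have dot: "?\<xi> \<bullet> (y - x) = - ((norm (x - y))\<^sup>2 / (2 * t))"
    proof -
      have "(x - y) \<bullet> (y - x) = - (norm (x - y))\<^sup>2"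
        by (metis inner_minus_right minus_diff_eq power2_norm_eq_inner)
      then show ?thesis by simp
    qed
    have ex: "((norm ?\<xi>)\<^sup>2 - E) * (t - 2 * s) + 2 * s * (norm ?\<xi>)\<^sup>2 + ?\<xi> \<bullet> (y - x)
      = 2 * s * E + (- E * t - (norm (x - y))\<^sup>2 / (4 * t))"
      unfolding n dot using t0 by (simp add: field_simps power2_eq_square)
    have "q z \<le> ?b z ?\<xi>" by (rule all)
    also have "\<dots> = (8 * pi * s) powr (- (real DIM('a) / 2)) * exp (((norm ?\<xi>)\<^sup>2 - E) * (t - 2 * s) + 2 * s * (norm ?\<xi>)\<^sup>2 + ?\<xi> \<bullet> (y - x))"
      unfolding z fst_conv snd_conv exp_add by (simp only: mult_ac)
    also have "\<dots> = (8 * pi * s) powr (- (real DIM('a) / 2)) * exp (2 * s * E) * exp (- E * t - (norm (x - y))\<^sup>2 / (4 * t))"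
      unfolding ex exp_add by (simp only: mult.assoc)
    finally show ?case unfolding z by simp
  qed
qed

end

theorem theorem1p5:
  fixes \<Omega> :: "'a::euclidean_space set"
    and T :: "real \<Rightarrow> ('a \<Rightarrow> complex) \<Rightarrow> ('a \<Rightarrow> complex)"
    and H :: "(('a \<Rightarrow> complex) \<times> ('a \<Rightarrow> complex)) set"
    and E\<^sub>0 :: real
  assumes "\<Omega> \<in> sets lebesgue"
    and "C0_semigroup \<Omega> T"
    and "selfadjoint_semigroup \<Omega> T"
    and "positivity_preserving \<Omega> T"
    and "dominated_by_heat_semigroup \<Omega> T"
    and "H = neg_operator (generator \<Omega> T)"
    and "E\<^sub>0 = Inf {r::real. complex_of_real r \<in> spectrum \<Omega> H}"
  shows "(\<forall>t>0. \<exists>p. is_integral_kernel \<Omega> (T t) p) \<and>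
    (E\<^sub>0 > 0 \<longrightarrow>
      (\<forall>t \<ge> real DIM('a) / (2 * E\<^sub>0). \<forall>p. is_integral_kernel \<Omega> (T t) p \<longrightarrow>
        (AE (x, y) in lebesgue.
           0 \<le> p (x, y) \<and>
           p (x, y) \<le> complex_of_real
             ((exp 1 * E\<^sub>0 / (2 * pi * real DIM('a))) powr (real DIM('a) / 2) *
              exp (- E\<^sub>0 * t - (norm (x - y))\<^sup>2 / (4 * t))))))"
proof (intro conjI allI impI)
  interpret dominated_semigroup \<Omega> T
    by unfold_locales fact+
  fix t :: real
  {
    assume t: "t > 0"
    obtain q :: "'a \<times> 'a \<Rightarrow> real" where q: "q \<in> borel_measurable borel"
      and q0: "\<And>z. 0 \<le> q z"
      and q_out: "\<And>x y. x \<notin> \<Omega> \<or> y \<notin> \<Omega> \<Longrightarrow> q (x, y) = 0"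
      and q1: "AE z in lborel. q z \<le> heat_kernel t (fst z - snd z)"
      and K: "\<And>f. f \<in> L2 \<Omega> \<Longrightarrow> AE x in lborel. integrable lebesgue (\<lambda>y. complex_of_real (q (x, y)) * f y) \<and>
         T t f x = (LINT y|lebesgue. complex_of_real (q (x, y)) * f y)"
      by (rule kernel[OF t]) (rule that)
    have "(\<lambda>z. complex_of_real (q z)) \<in> borel_measurable lborel" using q by measurable
    then have "(\<lambda>z. complex_of_real (q z)) \<in> borel_measurable lebesgue" by (rule measurable_completion)
    moreover have eq: "indicator \<Omega> y *\<^sub>R (complex_of_real (q (x, y)) * f y) = complex_of_real (q (x, y)) * f y" for x y f
      using q_out[of x y] by (cases "y \<in> \<Omega>") auto
    moreover have kf: "AE x in lborel. x \<in> \<Omega> \<longrightarrow> integrable lebesgue (\<lambda>y. complex_of_real (q (x, y)) * f y) \<and>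
         T t f x = (LINT y|lebesgue. complex_of_real (q (x, y)) * f y)" if "f \<in> L2 \<Omega>" for f
      using K[OF that] by eventually_elim blast
    ultimately have "is_integral_kernel \<Omega> (T t) (\<lambda>z. complex_of_real (q z))"
      unfolding is_integral_kernel_def set_integrable_def set_lebesgue_integral_def AE_lebesgue_iff eq
      using q_out by auto
    then show "\<exists>p. is_integral_kernel \<Omega> (T t) p" by blast
  }
  fix p :: "'a \<times> 'a \<Rightarrow> complex"
  assume E: "E\<^sub>0 > 0" and t: "t \<ge> real DIM('a) / (2 * E\<^sub>0)" and p: "is_integral_kernel \<Omega> (T t) p"
  let ?d = "real DIM('a)"
  define s where "s = ?d / (4 * E\<^sub>0)"
  have s: "s > 0" "t \<ge> 2 * s" using E t by (auto simp: s_def)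
  then have t0: "t > 0" by simp
  have bound: "norm (U h F) \<le> exp (- E\<^sub>0 * h) * norm F" if "h \<ge> 0" for h F
    by (rule U_spectral_bound[OF _ that]) (simp add: assms(6,7))
  obtain q :: "'a \<times> 'a \<Rightarrow> real" where q: "q \<in> borel_measurable borel"
    and q0: "\<And>z. 0 \<le> q z"
    and q_out: "\<And>x y. x \<notin> \<Omega> \<or> y \<notin> \<Omega> \<Longrightarrow> q (x, y) = 0"
    and q1: "AE z in lborel. q z \<le> heat_kernel t (fst z - snd z)"
    and K: "\<And>f. f \<in> L2 \<Omega> \<Longrightarrow> AE x in lborel. integrable lebesgue (\<lambda>y. complex_of_real (q (x, y)) * f y) \<and>
       T t f x = (LINT y|lebesgue. complex_of_real (q (x, y)) * f y)"
    by (rule kernel[OF t0]) (rule that)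
  have const: "(8 * pi * s) powr (- (?d / 2)) * exp (2 * s * E\<^sub>0) = (exp 1 * E\<^sub>0 / (2 * pi * ?d)) powr (?d / 2)"
  proof -
    have "(8 * pi * s) powr (- (?d / 2)) = (1 / (8 * pi * s)) powr (?d / 2)"
      using s(1) by (subst powr_divide) (simp_all add: powr_minus_divide)
    also have "1 / (8 * pi * s) = E\<^sub>0 / (2 * pi * ?d)"
      using E by (simp add: s_def field_simps)
    finally have "(8 * pi * s) powr (- (?d / 2)) = (E\<^sub>0 / (2 * pi * ?d)) powr (?d / 2)" .
    moreover have "exp (2 * s * E\<^sub>0) = exp 1 powr (?d / 2)"
      using E by (simp add: s_def powr_def)
    ultimately show ?thesis
      using E by (simp add: powr_mult[symmetric] mult_ac)
  qed
  have pq: "AE z in lborel. p z = complex_of_real (q z)"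
    by (rule kernel_unique; fact)
  have "AE (x, y) in lborel. q (x, y) \<le> (8 * pi * s) powr (- (?d / 2)) * exp (2 * s * E\<^sub>0) *
      exp (- E\<^sub>0 * t - (norm (x - y))\<^sup>2 / (4 * t))"
    by (rule kernel_gaussian_bound; fact)
  with pq show "AE (x, y) in lebesgue. 0 \<le> p (x, y) \<and> p (x, y) \<le> complex_of_real
      ((exp 1 * E\<^sub>0 / (2 * pi * ?d)) powr (?d / 2) * exp (- E\<^sub>0 * t - (norm (x - y))\<^sup>2 / (4 * t)))"
    unfolding AE_lebesgue_iff const[symmetric]
  proof eventually_elim
    case (elim z)
    then show ?case
      using q0[of z] by (cases z) (auto simp: less_eq_complex_def)
  qed
qed

end
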